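(* Consider a gauge-invariant fermionic model as in the context, with $L\times L$ Hermitian matrix $T_{S,0}$, $L\times K$ complex matrix $\Theta_0$, and gauge-invariant quasi-free bath state $\omega$, and let $(\Lambda^t)_{t\ge0}$ be the associated semigroup, $\rho(t)=\Lambda^t\rho(0)$. The following are equivalent: (1'') There exists a unique stationary state $\rho_\infty$; it is quasi-free, gauge-invariant (commutes with $N_S$), and $\rho(t)\to\rho_\infty$ for every initial state $\rho(0)$. (2'') $\ker\Theta_0^*$ contains no eigenvector of $T_{S,0}$. (3'') The linear span $V(T_{S,0},\Theta_0)$ of $\bigcup_{k\ge0}\mathrm{Ran}\big((T_{S,0})^k\Theta_0\big)$ is the whole of $\mathbb{C}^L$.
   Context: $\Gamma(\mathbb{C}^n)$ is the fermionic Fock space over $\mathbb{C}^n$ with annihilation operators $c_1,\dots,c_n$ (CAR: $\{c_i,c_j\}=0$, $\{c_i^*,c_j\}=\delta_{ij}I$), number operator $N=\sum c_i^*c_i$, Majorana operators $\gamma_i=c_i+c_i^*$, $\gamma_{i+n}=-i(c_i-c_i^* )$. Quasi-free states are limits of states $e^{-\beta H}/\mathrm{Tr}\,e^{-\beta H}$ with $H=\sum_{ij}T_{ij}\gamma_i\gamma_j$ self-adjoint; a state is gauge-invariant if it commutes with $N$. Gauge-invariant model: system $\mathcal{H}_S=\Gamma(\mathbb{C}^L)$ (operators $c^S_i$, number operator $N_S$), bath $\mathcal{H}_B=\Gamma(\mathbb{C}^K)$ (operators $c^B_j$, number operator $N_B$); $\mathcal{H}_S\otimes\mathcal{H}_B\cong\Gamma(\mathbb{C}^L\oplus\mathbb{C}^K)$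 via one fixed choice of $E_{SB}$ ($c^S_i\mapsto c^S_i\otimes I$, $c^B_j\mapsto(-1)^{N_S}\otimes c^B_j$) or $E_{BS}$ ($c^S_i\mapsto c^S_i\otimes(-1)^{N_B}$, $c^B_j\mapsto I\otimes c^B_j$). $H_S=\sum_{i,j}(T_{S,0})_{ij}c^{S*}_ic^S_j$, $V=\sum_{i,j}(\Theta_0)_{ij}c^{S*}_ic^B_j+\sum_{i,j}\overline{(\Theta_0)_{ij}}\,c^{B*}_jc^S_i$, and $\omega$ is a quasi-free state on $\mathcal{H}_B$ with $[N_B,\omega]=0$. The semigroup is $\Lambda^t=e^{t\mathcal{L}}$ on $\mathcal{B}(\mathcal{H}_S)$, $\mathcal{L}(\rho)=-i[H_S,\rho]+\Phi^*(\rho)-\frac12\{\Phi(I),\rho\}$, $\Phi^*(\rho)=\mathrm{Tr}_{\mathcal{H}_B}(V(\rho\otimes\omega)V)$, $\Phi$ its dual map (continuous-time limit of repeated interactions with interaction $\tau^{-1/2}V$). A stationary state satisfies $\Lambda^t\sigma=\sigma$ for all $t$. *)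

theory Defs
  imports "HOL-Analysis.Analysis"
begin

text \<open>Matrices are elements of complex^'c^'r (rows 'r, columns 'c); A$i$j is the (i,j) entry.
  The fermionic Fock space over C^n, with modes indexed by a finite linearly ordered type 'n,
  has orthonormal basis the occupation sets S :: 'n set; operators on it are
  complex^('n set)^('n set).  Jordan-Wigner ordering uses the linear order on 'n.\<close>

type_synonym ('r,'c) cmat = "complex^'c^'r"
type_synonym 'n fockop = "complex^('n set)^('n set)"

definition cadj :: "complex^'c^'r \<Rightarrow> complex^'r^'c" where
  "cadj A = (\<chi> i j. cnj (A$j$i))"

definition csc :: "complex \<Rightarrow> complex^'c^'r \<Rightarrow> complex^'c^'r" where
  "csc a A = (\<chi> i j. a * A$i$j)"

definition ctrace :: "complex^'n^'n \<Rightarrow> complex" where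
  "ctrace A = (\<Sum>i\<in>UNIV. A$i$i)"

definition hermitian :: "complex^'n^'n \<Rightarrow> bool" where
  "hermitian A \<longleftrightarrow> cadj A = A"

definition cinner :: "complex^'n \<Rightarrow> complex^'n \<Rightarrow> complex" where
  "cinner x y = (\<Sum>i\<in>UNIV. cnj (x$i) * y$i)"

definition psd :: "complex^'n^'n \<Rightarrow> bool" where
  "psd A \<longleftrightarrow> hermitian A \<and> (\<forall>x. Im (cinner x (A *v x)) = 0 \<and> Re (cinner x (A *v x)) \<ge> 0)"

definition is_state :: "complex^'n^'n \<Rightarrow> bool" where
  "is_state \<rho> \<longleftrightarrow> psd \<rho> \<and> ctrace \<rho> = 1"

definition commutator :: "complex^'n^'n \<Rightarrow> complex^'n^'n \<Rightarrow> complex^'n^'n" where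
  "commutator A B = A ** B - B ** A"

definition anticommutator :: "complex^'n^'n \<Rightarrow> complex^'n^'n \<Rightarrow> complex^'n^'n" where
  "anticommutator A B = A ** B + B ** A"

definition mpow :: "complex^'n^'n \<Rightarrow> nat \<Rightarrow> complex^'n^'n" where
  "mpow A k = ((\<lambda>X. X ** A) ^^ k) (mat 1)"

definition mexp :: "complex^'n^'n \<Rightarrow> complex^'n^'n" where
  "mexp A = (\<Sum>k. (1 / fact k) *\<^sub>R mpow A k)"

text \<open>annihilation operator c_i (Jordan-Wigner convention w.r.t. the order on 'n)\<close>
definition annih :: "'n::{finite,linorder} \<Rightarrow> 'n fockop" where
  "annih i = (\<chi> T S. if i \<in> S \<and> T = S - {i}
                       then (-1) ^ card {j\<in>S. j < i} else 0)"

definition creat :: "'n::{finite,linorder} \<Rightarrow> 'n fockop" where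
  "creat i = cadj (annih i)"

definition numop :: "'n::finite fockop" where
  "numop = (\<chi> T S. if T = S then of_nat (card S) else 0)"

definition parity :: "'n::finite fockop" where
  "parity = (\<chi> T S. if T = S then (-1) ^ card S else 0)"

text \<open>Majorana operators: Inl i is gamma_i, Inr i is gamma_{i+n}\<close>
definition majorana :: "'n + 'n \<Rightarrow> 'n::{finite,linorder} fockop" where
  "majorana a = (case a of
      Inl i \<Rightarrow> annih i + creat i
    | Inr i \<Rightarrow> csc (-\<i>) (annih i - creat i))"

definition quad_ham :: "complex^('n + 'n)^('n + 'n) \<Rightarrow> 'n::{finite,linorder} fockop" where
  "quad_ham T = (\<Sum>a\<in>UNIV. \<Sum>b\<in>UNIV. csc (T$a$b) (majorana a ** majorana b))"

definition gibbs_states :: "'n::{finite,linorder} fockop set" where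
  "gibbs_states = {csc (1 / ctrace (mexp (csc (- complex_of_real \<beta>) (quad_ham T))))
                       (mexp (csc (- complex_of_real \<beta>) (quad_ham T)))
                   | \<beta> T. \<beta> > 0 \<and> hermitian (quad_ham T)}"

definition quasi_free :: "'n::{finite,linorder} fockop \<Rightarrow> bool" where
  "quasi_free \<rho> \<longleftrightarrow> \<rho> \<in> closure gibbs_states"

text \<open>H_S tensor H_B has basis ('n set \<times> 'm set)\<close>
definition kron :: "complex^'c^'r \<Rightarrow> complex^'d^'s \<Rightarrow> complex^('c \<times> 'd)^('r \<times> 's)" where
  "kron A B = (\<chi> p q. A$(fst p)$(fst q) * B$(snd p)$(snd q))"

definition ptrace_B :: "complex^('n::finite \<times> 'm::finite)^('n \<times> 'm) \<Rightarrow> complex^'n^'n" where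
  "ptrace_B X = (\<chi> s s'. \<Sum>b\<in>UNIV. X$(s,b)$(s',b))"

text \<open>Embedded annihilation operators; sb = True is E_SB, sb = False is E_BS\<close>
definition sysannih :: "bool \<Rightarrow> 'n::{finite,linorder} \<Rightarrow> ('n set \<times> 'm::{finite,linorder} set, 'n set \<times> 'm set) cmat" where
  "sysannih sb i = (if sb then kron (annih i) (mat 1) else kron (annih i) parity)"

definition bathannih :: "bool \<Rightarrow> 'm::{finite,linorder} \<Rightarrow> ('n::{finite,linorder} set \<times> 'm set, 'n set \<times> 'm set) cmat" where
  "bathannih sb j = (if sb then kron parity (annih j) else kron (mat 1) (annih j))"

definition sys_ham :: "((complex,'n::{finite,linorder}) vec, 'n) vec \<Rightarrow> 'n fockop" where
  "sys_ham T0 = (\<Sum>i\<in>UNIV. \<Sum>j\<in>UNIV. csc (T0$i$j) (creat i ** annih j))"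

definition interaction :: "bool \<Rightarrow> ((complex,'m::{finite,linorder}) vec, 'n::{finite,linorder}) vec
      \<Rightarrow> ('n set \<times> 'm set, 'n set \<times> 'm set) cmat" where
  "interaction sb Th = (\<Sum>i\<in>UNIV. \<Sum>j\<in>UNIV.
       csc (Th$i$j) (cadj (sysannih sb i) ** bathannih sb j)
     + csc (cnj (Th$i$j)) (cadj (bathannih sb j) ** sysannih sb i))"

definition Phi_star :: "bool \<Rightarrow> ((complex,'m::{finite,linorder}) vec, 'n::{finite,linorder}) vec \<Rightarrow> 'm fockop \<Rightarrow> 'n fockop \<Rightarrow> 'n fockop"
  where "Phi_star sb Th \<omega> \<rho> =
    ptrace_B (interaction sb Th ** kron \<rho> \<omega> ** interaction sb Th)"

text \<open>Phi, the dual of Phi^* w.r.t. (X,rho) |-> Tr(X rho):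
  Phi(X) = Tr_B (V (X \<otimes> I) V (I \<otimes> omega)), so that Tr(Phi(X) rho) = Tr(X Phi^*(rho)).\<close>
definition Phi :: "bool \<Rightarrow> ((complex,'m::{finite,linorder}) vec, 'n::{finite,linorder}) vec \<Rightarrow> 'm fockop \<Rightarrow> 'n fockop \<Rightarrow> 'n fockop"
  where "Phi sb Th \<omega> X =
    ptrace_B (interaction sb Th ** kron X (mat 1) ** interaction sb Th ** kron (mat 1) \<omega>)"

definition lindbladian :: "bool \<Rightarrow> ((complex,'n::{finite,linorder}) vec, 'n) vec \<Rightarrow> ((complex,'m::{finite,linorder}) vec, 'n) vec \<Rightarrow> 'm fockop
      \<Rightarrow> 'n fockop \<Rightarrow> 'n fockop" where
  "lindbladian sb T0 Th \<omega> \<rho> =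
     csc (-\<i>) (commutator (sys_ham T0) \<rho>) + Phi_star sb Th \<omega> \<rho>
     - csc (1/2) (anticommutator (Phi sb Th \<omega> (mat 1)) \<rho>)"

definition semigroup :: "bool \<Rightarrow> ((complex,'n::{finite,linorder}) vec, 'n) vec \<Rightarrow> ((complex,'m::{finite,linorder}) vec, 'n) vec \<Rightarrow> 'm fockop
      \<Rightarrow> real \<Rightarrow> 'n fockop \<Rightarrow> 'n fockop" where
  "semigroup sb T0 Th \<omega> t \<rho> =
     (\<Sum>k. (t ^ k / fact k) *\<^sub>R (lindbladian sb T0 Th \<omega> ^^ k) \<rho>)"

definition stationary :: "bool \<Rightarrow> ((complex,'n::{finite,linorder}) vec, 'n) vec \<Rightarrow> ((complex,'m::{finite,linorder}) vec, 'n) vec \<Rightarrow> 'm fockop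
      \<Rightarrow> 'n fockop \<Rightarrow> bool" where
  "stationary sb T0 Th \<omega> \<sigma> \<longleftrightarrow> is_state \<sigma> \<and> (\<forall>t\<ge>0. semigroup sb T0 Th \<omega> t \<sigma> = \<sigma>)"

definition krylov_span :: "complex^'n^'n \<Rightarrow> complex^'m^'n \<Rightarrow> (complex^'n) set" where
  "krylov_span T Th = vec.span (\<Union>k. range (\<lambda>x. (mpow T k ** Th) *v x))"

end

theory Submission
  imports Defs
begin

text \<open>
  On the space of operators, graded left multiplication by and graded commutation with the field
  operators satisfy again the canonical anticommutation relations. In these terms the generator for
  the embedding \<open>E\<^sub>S\<^sub>B\<close> is \<open>A + q(Th Z Th\<^sup>*)\<close>, where \<open>A\<close> is the generator for a bath at infinite
  temperature, \<open>q(C)\<close> is quadratic in the graded multiplications and \<open>Z\<close> is the bath covariance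
  minus one half. With \<open>W = - i T - Th Th\<^sup>* / 2\<close> one has \<open>[A, q(C)] = q(W C + C W\<^sup>*)\<close> and the operators
  \<open>q(C)\<close> commute with each other. Hence, if \<open>C\<close> solves the Lyapunov equation
  \<open>W C + C W\<^sup>* = - Th Z Th\<^sup>*\<close>, the generator equals \<open>exp(q(C)) A exp(- q(C))\<close>.

  The part \<open>A\<close> is dissipative for the Hilbert-Schmidt inner product, and an operator that never
  dissipates commutes, in the graded sense, with the field operators of all Krylov vectors; under the
  Krylov condition it is a scalar, and \<open>exp(t A)\<close> converges to the normalised trace. So every state
  converges to \<open>exp(q(C)) 1\<close> divided by the dimension. In an eigenbasis of \<open>C\<close> this is a product over modes,
  that is, a Gibbs state or a limit of such, because the Lyapunov equation confines the spectrum of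
  \<open>C\<close> to \<open>[-1/2, 1/2]\<close>. Conversely, an eigenvector of \<open>T\<close> in the kernel of \<open>Th\<^sup>*\<close> is a mode whose
  occupation number is conserved, so the limit would depend on the initial state.
\<close>

text \<open>The limit has to be reached from every initial state, and two-point functions do not
  determine a general state; so convergence is proved for the whole operator rather than for
  covariance matrices. The interaction is linear in the bath fields, so the generator sees the bath
  only through two-point functions, and gauge invariance leaves a single matrix of rates,
  \<open>G\<close> for gain and \<open>1 - G\<close> for loss. Centring at one half, where gain and
  loss balance, separates the generator into a dissipative part that fixes the identity and a
  remainder linear in \<open>G - 1/2\<close>. Graded multiplications anticommute among themselves
  even for an operator and its adjoint, since the scalar anticommutator enters once from the left
  and once from the right with opposite signs. That is why the operators quadratic in them commute,
  why the commutator expansion of the conjugation ends after one term, and why each mode contributes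
  a nilpotent exponent. An eigenvalue of the Lyapunov solution is the occupation of its mode in the
  limit, minus one half; this is the origin of the interval that confines the spectrum.\<close>

section \<open>Exponentials of endomorphisms\<close>

text \<open>A copy of the type of bounded linear endomorphisms carrying the structure of a Banach algebra,
  which makes the exponential function of the library available.\<close>

typedef (overloaded) 'a endo = "UNIV :: ('a::euclidean_space \<Rightarrow>\<^sub>L 'a) set"
  morphisms blin_of_endo Endo ..

setup_lifting type_definition_endo

lift_definition app :: "'a::euclidean_space endo \<Rightarrow> 'a \<Rightarrow> 'a" is blinfun_apply .

lift_definition endo :: "('a::euclidean_space \<Rightarrow> 'a) \<Rightarrow> 'a endo" is Blinfun .

lemma app_endo: "linear f \<Longrightarrow> app (endo f) = f"
  by transfer (simp add: bounded_linear_Blinfun_apply linear_conv_bounded_linear)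

lemma endo_eqI: "(\<And>x. app A x = app B x) \<Longrightarrow> A = B"
  by transfer (rule blinfun_eqI)

instantiation endo :: (euclidean_space) real_vector
begin

lift_definition zero_endo :: "'a endo" is 0 .
lift_definition plus_endo :: "'a endo \<Rightarrow> 'a endo \<Rightarrow> 'a endo" is "(+)" .
lift_definition minus_endo :: "'a endo \<Rightarrow> 'a endo \<Rightarrow> 'a endo" is "(-)" .
lift_definition uminus_endo :: "'a endo \<Rightarrow> 'a endo" is uminus .
lift_definition scaleR_endo :: "real \<Rightarrow> 'a endo \<Rightarrow> 'a endo" is scaleR .
instance
  by standard (transfer, simp add: algebra_simps)+

end

instantiation endo :: (euclidean_space) real_normed_algebra_1
begin

lift_definition one_endo :: "'a endo" is id_blinfun .
lift_definition times_endo :: "'a endo \<Rightarrow> 'a endo \<Rightarrow> 'a endo" is blinfun_compose .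
lift_definition norm_endo :: "'a endo \<Rightarrow> real" is norm .
definition dist_endo :: "'a endo \<Rightarrow> 'a endo \<Rightarrow> real" where "dist_endo A B = norm (A - B)"
definition sgn_endo :: "'a endo \<Rightarrow> 'a endo" where "sgn_endo A = A /\<^sub>R norm A"
definition uniformity_endo :: "('a endo \<times> 'a endo) filter" where
  "uniformity_endo = (INF e\<in>{0 <..}. principal {(x, y). dist x y < e})"
definition open_endo :: "'a endo set \<Rightarrow> bool" where
  "open_endo U \<longleftrightarrow> (\<forall>x\<in>U. eventually (\<lambda>(x', y). x' = x \<longrightarrow> y \<in> U) uniformity)"

instance
proof
  fix A B C :: "'a endo" and r s :: real
  show "A * B * C = A * (B * C)" "1 * A = A" "A * 1 = A" "(A + B) * C = A * C + B * C"
    "A * (B + C) = A * B + A * C" "r *\<^sub>R A * B = r *\<^sub>R (A * B)" "A * r *\<^sub>R B = r *\<^sub>R (A * B)"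
    by (transfer, rule blinfun_eqI, simp add: blinfun.bilinear_simps)+
  show "(0::'a endo) \<noteq> 1"
  proof transfer
    obtain b :: 'a where "b \<in> Basis" using nonempty_Basis by blast
    hence "b \<noteq> 0" by (simp add: nonzero_Basis)
    moreover have "blinfun_apply 0 b = 0" "blinfun_apply id_blinfun b = b" by simp_all
    ultimately show "0 \<noteq> (id_blinfun :: 'a \<Rightarrow>\<^sub>L 'a)" by metis
  qed
  show "dist A B = norm (A - B)" "sgn A = A /\<^sub>R norm A" by (simp_all add: dist_endo_def sgn_endo_def)
  show "uniformity = (INF e\<in>{0 <..}. principal {(x::'a endo, y). dist x y < e})"
    by (rule uniformity_endo_def)
  show "open U \<longleftrightarrow> (\<forall>x\<in>U. eventually (\<lambda>(x', y). x' = x \<longrightarrow> y \<in> U) uniformity)" for U :: "'a endo set"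
    by (rule open_endo_def)
  show "norm A = 0 \<longleftrightarrow> A = 0" "norm (r *\<^sub>R A) = \<bar>r\<bar> * norm A"
    by (transfer, simp)+
  show "norm (A + B) \<le> norm A + norm B" by transfer (rule norm_triangle_ineq)
  show "norm (A * B) \<le> norm A * norm B" by transfer (rule norm_blinfun_compose)
  show "norm (1::'a endo) = 1" by transfer simp
qed

end

instance endo :: (euclidean_space) banach
proof
  fix X :: "nat \<Rightarrow> 'a endo"
  assume "Cauchy X"
  have d: "dist (blin_of_endo A) (blin_of_endo B) = dist A B" for A B :: "'a endo"
    unfolding dist_norm by transfer simp
  have "Cauchy (\<lambda>n. blin_of_endo (X n))"
    using \<open>Cauchy X\<close> unfolding Cauchy_def d .
  then obtain L where "(\<lambda>n. blin_of_endo (X n)) \<longlonglongrightarrow> L"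
    using Cauchy_convergent_iff convergent_def by blast
  moreover have "L = blin_of_endo (Endo L)" by (simp add: Endo_inverse)
  ultimately have "X \<longlonglongrightarrow> Endo L"
    unfolding LIMSEQ_def by (metis d)
  thus "convergent X" unfolding convergent_def by blast
qed

lemma bounded_bilinear_app: "bounded_bilinear app"
proof
  fix a a' :: "'a endo" and b b' :: 'a and r :: real
  show "app (a + a') b = app a b + app a' b" "app a (b + b') = app a b + app a b'"
    "app (r *\<^sub>R a) b = r *\<^sub>R app a b" "app a (r *\<^sub>R b) = r *\<^sub>R app a b"
    by (transfer, simp add: blinfun.bilinear_simps)+
  show "\<exists>K. \<forall>a b. norm (app a (b::'a)) \<le> norm a * norm b * K"
    by (rule exI[of _ 1], transfer) (simp add: norm_blinfun)
qed

interpretation app: bounded_bilinear app by (rule bounded_bilinear_app)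

lemma app_one [simp]: "app 1 x = x" by transfer simp

lemma app_mult [simp]: "app (A * B) x = app A (app B x)" by transfer simp

lemma app_power: "app (A ^ k) x = (app A ^^ k) x"
  by (induction k) auto

lemma app_exp: "app (exp A) x = (\<Sum>k. (1 / fact k) *\<^sub>R (app A ^^ k) x)"
proof -
  have "app (exp A) x = app (\<Sum>k. A ^ k /\<^sub>R fact k) x" by (simp add: exp_def)
  also have "\<dots> = (\<Sum>k. app (A ^ k /\<^sub>R fact k) x)"
    using bounded_linear.suminf[OF app.bounded_linear_left summable_exp_generic[of A]] by simp
  also have "\<dots> = (\<Sum>k. (1 / fact k) *\<^sub>R (app A ^^ k) x)"
    by (simp add: app.scaleR_left app_power inverse_eq_divide)
  finally show ?thesis .
qed

lemma sums_app_exp: "(\<lambda>k. (1 / fact k) *\<^sub>R app (A ^ k) x) sums app (exp A) x"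
proof -
  have "(\<lambda>k. A ^ k /\<^sub>R fact k) sums exp A"
    unfolding exp_def by (rule summable_sums[OF summable_exp_generic])
  from bounded_linear.sums[OF app.bounded_linear_left this, of x]
  show ?thesis by (simp add: app.scaleR_left inverse_eq_divide)
qed

text \<open>The two endomorphisms may live on different spaces. With \<open>B = 0\<close> the lemma
  says that a linear map annihilating all values of the generator is conserved, which covers traces
  and occupation numbers.\<close>

lemma app_exp_intertwine:
  assumes "linear M" "\<And>x. M (app A x) = app B (M x)"
  shows "M (app (exp A) x) = app (exp B) (M x)"
proof -
  have M: "bounded_linear M" using assms(1) by (simp add: linear_conv_bounded_linear)
  have "M (app (A ^ k) x) = app (B ^ k) (M x)" for k
    by (induction k) (auto simp: assms(2))
  hence "(\<lambda>k. (1 / fact k) *\<^sub>R app (B ^ k) (M x)) sums M (app (exp A) x)"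
    using bounded_linear.sums[OF M sums_app_exp[of A x]]
    by (simp add: linear_scale[OF assms(1)])
  thus ?thesis using sums_app_exp[of B "M x"] sums_unique2 by blast
qed

lemma app_exp_fixed:
  assumes "app A x = 0" shows "app (exp A) x = x"
proof -
  have "(\<lambda>k. (1 / fact k) *\<^sub>R app (A ^ k) x) = (\<lambda>k. if k = 0 then x else 0)"
  proof
    fix k show "(1 / fact k) *\<^sub>R app (A ^ k) x = (if k = 0 then x else 0)"
      by (cases k) (simp_all add: power_Suc2 assms app.zero_right del: power_Suc)
  qed
  moreover have "(\<lambda>k. if k = 0 then x else 0) sums x"
    using sums_single[of 0 "\<lambda>_. x"] by simp
  ultimately show ?thesis using sums_app_exp[of A x] sums_unique2 by metis
qed

text \<open>Since \<open>R\<close> commutes with \<open>Q\<close>, the second commutator vanishes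
  and conjugating \<open>A\<close> by \<open>exp Q\<close> adds exactly \<open>R\<close>. The form
  without an inverse allows a comparison of exponential series term by term.\<close>

lemma exp_similarity:
  fixes A Q R :: "'a::{real_normed_algebra_1,banach}"
  assumes "Q * A - A * Q = R" "Q * R = R * Q"
  shows "exp Q * A = (A + R) * exp Q"
proof -
  have p: "Q ^ Suc k * A = A * Q ^ Suc k + of_nat (Suc k) * (R * Q ^ k)" for k
  proof (induction k)
    case 0 show ?case using assms(1) by (simp add: algebra_simps)
  next
    case (Suc k)
    have QR: "Q * (R * X) = R * (Q * X)" for X by (metis assms(2) mult.assoc)
    have QA: "Q * (A * X) = A * (Q * X) + R * X" for X
      using assms(1) by (metis add.commute diff_add_cancel distrib_right mult.assoc)
    have "Q ^ Suc (Suc k) * A = Q * (A * Q ^ Suc k + of_nat (Suc k) * (R * Q ^ k))"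
      using Suc by (metis mult.assoc power_Suc)
    also have "\<dots> = A * Q ^ Suc (Suc k) + R * Q ^ Suc k + of_nat (Suc k) * (R * Q ^ Suc k)"
    proof -
      have "Q * (of_nat n * Y) = of_nat n * (Q * Y)" for n Y by (metis mult.assoc mult_of_nat_commute)
      moreover have "Q * (R * Q ^ k) = R * Q ^ Suc k" by (simp add: QR)
      moreover have "Q * (A * Q ^ Suc k) = A * Q ^ Suc (Suc k) + R * Q ^ Suc k" by (simp add: QA)
      ultimately show ?thesis by (simp only: distrib_left)
    qed
    finally show ?case by (simp add: algebra_simps)
  qed
  \<comment> \<open>Dividing by the factorial turns the factor \<open>Suc k\<close> into an index
    shift, which rebuilds \<open>exp Q\<close> behind \<open>R\<close>.\<close>
  have q: "Q ^ Suc k /\<^sub>R fact (Suc k) * A = A * (Q ^ Suc k /\<^sub>R fact (Suc k)) + R * (Q ^ k /\<^sub>R fact k)" for k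
  proof -
    have "of_nat (Suc k) * (R * Q ^ k) = real (Suc k) *\<^sub>R (R * Q ^ k)"
      by (metis of_real_of_nat_eq scaleR_conv_of_real)
    hence "(Q ^ Suc k * A) /\<^sub>R fact (Suc k) = A * Q ^ Suc k /\<^sub>R fact (Suc k) + (real (Suc k) / fact (Suc k)) *\<^sub>R (R * Q ^ k)"
      by (simp only: p scaleR_add_right) (simp add: divide_inverse_commute)
    moreover have "real (Suc k) / fact (Suc k) = inverse (fact k)"
      by (subst fact_Suc) (simp add: divide_inverse del: of_nat_Suc)
    ultimately show ?thesis by simp
  qed
  have s: "(\<lambda>k. Q ^ k /\<^sub>R fact k) sums exp Q"
    unfolding exp_def by (rule summable_sums[OF summable_exp_generic])
  hence s1: "(\<lambda>k. Q ^ Suc k /\<^sub>R fact (Suc k)) sums (exp Q - 1)"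
    using sums_Suc_iff[of "\<lambda>k. Q ^ k /\<^sub>R fact k" "exp Q - 1"] by simp
  have "(\<lambda>k. Q ^ Suc k /\<^sub>R fact (Suc k) * A) sums ((exp Q - 1) * A)"
    by (rule sums_mult2[OF s1])
  moreover have "(\<lambda>k. A * (Q ^ Suc k /\<^sub>R fact (Suc k)) + R * (Q ^ k /\<^sub>R fact k)) sums (A * (exp Q - 1) + R * exp Q)"
    by (intro sums_add sums_mult s1 s)
  ultimately have "(exp Q - 1) * A = A * (exp Q - 1) + R * exp Q"
    unfolding q using sums_unique2 by blast
  thus ?thesis by (simp add: algebra_simps)
qed

lemma exp_square_zero:
  fixes Q :: "'a::{real_normed_algebra_1,banach}"
  assumes "Q * Q = 0" shows "exp Q = 1 + Q"
proof -
  have "Q ^ k /\<^sub>R fact k = 0" if "k \<notin> {0,1}" for k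
  proof -
    have "k = Suc (Suc (k - 2))" using that by (simp; arith)
    then obtain j where "k = Suc (Suc j)" by blast
    thus ?thesis using assms by (simp add: mult.assoc[symmetric])
  qed
  hence "(\<lambda>k. Q ^ k /\<^sub>R fact k) sums (\<Sum>k\<in>{0,1}. Q ^ k /\<^sub>R fact k)"
    by (intro sums_finite) auto
  moreover have "(\<lambda>k. Q ^ k /\<^sub>R fact k) sums exp Q"
    unfolding exp_def by (rule summable_sums[OF summable_exp_generic])
  ultimately show ?thesis using sums_unique2 by fastforce
qed

lemma exp_idempotent:
  fixes n :: "'a::{real_normed_algebra_1,banach}"
  assumes "n * n = n" shows "exp (c *\<^sub>R n) = 1 + (exp c - 1) *\<^sub>R n"
proof -
  have p: "n ^ Suc k = n" for k using assms by (induction k) auto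
  have "(\<lambda>k. c ^ k /\<^sub>R fact k) sums exp c"
    unfolding exp_def by (rule summable_sums[OF summable_exp_generic])
  hence "(\<lambda>k. c ^ Suc k /\<^sub>R fact (Suc k)) sums (exp c - 1)"
    using sums_Suc_iff[of "\<lambda>k. c ^ k /\<^sub>R fact k" "exp c - 1"] by simp
  from bounded_linear.sums[OF bounded_linear_scaleR_left this, of n]
  have "(\<lambda>k. (c *\<^sub>R n) ^ Suc k /\<^sub>R fact (Suc k)) sums ((exp c - 1) *\<^sub>R n)"
    by (simp only: scaleR_power p) (simp add: mult.commute)
  moreover have "(\<lambda>k. (c *\<^sub>R n) ^ k /\<^sub>R fact k) sums exp (c *\<^sub>R n)"
    unfolding exp_def by (rule summable_sums[OF summable_exp_generic])
  hence "(\<lambda>k. (c *\<^sub>R n) ^ Suc k /\<^sub>R fact (Suc k)) sums (exp (c *\<^sub>R n) - 1)"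
    using sums_Suc_iff[of "\<lambda>k. (c *\<^sub>R n) ^ k /\<^sub>R fact k" "exp (c *\<^sub>R n) - 1"] by simp
  ultimately have "exp (c *\<^sub>R n) - 1 = (exp c - 1) *\<^sub>R n" using sums_unique2 by blast
  thus ?thesis by (simp add: algebra_simps)
qed

text \<open>A LaSalle argument. The norm cannot grow; if it stayed constant up to time 1, the
  dissipation and all its derivatives would vanish along the orbit, which \<open>obs\<close> forbids
  for a nonzero vector. So time 1 shrinks every nonzero vector, and compactness of the unit sphere
  makes the factor uniform.\<close>

lemma app_exp_dissipative_tendsto_0:
  fixes A :: "'a::euclidean_space endo"
  assumes diss: "\<And>x. x \<bullet> app A x \<le> 0"
    and obs: "\<And>y. (\<And>k. app (A ^ k) y \<bullet> app A (app (A ^ k) y) = 0) \<Longrightarrow> y = 0"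
  shows "((\<lambda>t. app (exp (t *\<^sub>R A)) x) \<longlongrightarrow> 0) at_top"
proof -
  define E where "E t = app (exp (t *\<^sub>R A))" for t
  \<comment> \<open>The polarised dissipation: \<open>B x x\<close> at a point of the orbit is the
    derivative of the squared norm.\<close>
  define B where "B x y = x \<bullet> app A y + y \<bullet> app A x" for x y
  have E0: "E 0 x = x" for x by (simp add: E_def)
  have E_add: "E (s + t) x = E s (E t x)" for s t x
    unfolding E_def app_mult[symmetric] scaleR_add_left by (subst exp_add_commuting) auto
  have der: "((\<lambda>t. E t x) has_vector_derivative app A (E t x)) (at t)" for t x
    using bounded_linear.has_vector_derivative[OF app.bounded_linear_left
        exp_scaleR_has_vector_derivative_left[of A t], of x]
    by (simp add: E_def)
  have nder: "((\<lambda>t. (norm (E t x))\<^sup>2) has_real_derivative B (E t x) (E t x)) (at t)" for t x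
  proof -
    note d = der[of x t, unfolded has_vector_derivative_def]
    have "((\<lambda>t. E t x \<bullet> E t x) has_derivative (\<lambda>h. h * B (E t x) (E t x))) (at t)"
      by (rule has_derivative_eq_rhs[OF has_derivative_inner[OF d d]])
         (auto simp: B_def inner_commute algebra_simps)
    thus ?thesis
      by (simp add: power2_norm_eq_inner has_field_derivative_def mult_commute_abs)
  qed
  have anti: "norm (E t x) \<le> norm (E s x)" if "s \<le> t" for s t x
  proof -
    have "(norm (E t x))\<^sup>2 \<le> (norm (E s x))\<^sup>2"
      using that
    proof (rule DERIV_nonpos_imp_nonincreasing)
      fix r
      have "B (E r x) (E r x) \<le> 0" using diss[of "E r x"] by (simp add: B_def)
      with nder[of x r]
      show "\<exists>y. ((\<lambda>t. (norm (E t x))\<^sup>2) has_real_derivative y) (at r) \<and> y \<le> 0"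
        by (intro exI[of _ "B (E r x) (E r x)"] conjI)
    qed
    thus ?thesis by (rule power2_le_imp_le) simp
  qed
  have ker: "B x y = 0" if "B x x = 0" for x y
  proof -
    define c d where "c = B x y" and "d = y \<bullet> app A y"
    \<comment> \<open>A null vector of a semidefinite form lies in its radical: this
      \<open>s\<close> solves \<open>c + s * d = s\<close>, so the form at
      \<open>x + s *\<^sub>R y\<close> takes the value \<open>s\<^sup>2\<close>, while it must be at
      most 0.\<close>
    define s where "s = c / (1 - d)"
    have d: "d \<le> 0" unfolding d_def by (rule diss)
    have "(x + s *\<^sub>R y) \<bullet> app A (x + s *\<^sub>R y) = s * c + s\<^sup>2 * d"
      using that unfolding B_def c_def d_def
      by (simp add: app.add_right app.scaleR_right inner_add_left inner_add_right power2_eq_square algebra_simps)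
    also have "\<dots> = (c / (1 - d))\<^sup>2"
    proof -
      have "c = s * (1 - d)" using d by (simp add: s_def)
      hence "c + s * d = s" by (simp add: algebra_simps)
      hence "s * (c + s * d) = s * s" by simp
      hence "s * c + s\<^sup>2 * d = s\<^sup>2" by (simp add: distrib_left power2_eq_square)
      thus ?thesis by (simp add: s_def)
    qed
    finally have "(c / (1 - d))\<^sup>2 \<le> 0" using diss[of "x + s *\<^sub>R y"] by simp
    hence "c / (1 - d) = 0" by simp
    thus ?thesis using d by (simp add: c_def)
  qed
  have strict: "norm (E 1 x) < norm x" if "x \<noteq> 0" for x
  proof (rule ccontr)
    assume "\<not> norm (E 1 x) < norm x"
    hence const: "norm (E t x) = norm x" if "0 \<le> t" "t \<le> 1" for t
      using anti[OF that(1), of x] anti[OF that(2), of x] by (simp add: E0)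
    have zero: "L (app A (E t x)) = 0"
      if "bounded_linear L" "\<And>t. 0 < t \<Longrightarrow> t < 1 \<Longrightarrow> L (E t x) = 0" "0 < t" "t < 1"
      for L :: "'a \<Rightarrow> real" and t
    proof (rule DERIV_local_const)
      show "((\<lambda>t. L (E t x)) has_real_derivative L (app A (E t x))) (at t)"
        unfolding has_real_derivative_iff_has_vector_derivative
        by (rule bounded_linear.has_vector_derivative[OF that(1) der])
      show "0 < min t (1 - t)" using that by simp
      show "\<forall>y. \<bar>t - y\<bar> < min t (1 - t) \<longrightarrow> L (E t x) = L (E y x)"
        using that(2) that(3,4) by (auto simp: abs_if split: if_splits)
    qed
    \<comment> \<open>With the second argument held fixed the condition is linear in the orbit, so
      each derivative brings down one more \<open>A\<close>; differentiating the quadratic form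
      would produce mixed terms.\<close>
    have "B (app (A ^ k) (E t x)) y = 0" if "0 < t" "t < 1" for k t y
      using that
    proof (induction k arbitrary: t y)
      case 0
      have "B (E t x) (E t x) = 0"
      proof (rule DERIV_local_const[OF nder])
        show "0 < min t (1 - t)" using 0 by simp
        show "\<forall>y. \<bar>t - y\<bar> < min t (1 - t) \<longrightarrow> (norm (E t x))\<^sup>2 = (norm (E y x))\<^sup>2"
          using const 0 by (auto simp: abs_if split: if_splits)
      qed
      thus ?case using ker by simp
    next
      case (Suc k)
      have "bounded_linear (\<lambda>z. B (app (A ^ k) z) y)"
        unfolding B_def by (intro bounded_linear_intros app.bounded_linear_right
            bounded_linear_compose[OF app.bounded_linear_right])
      from zero[OF this Suc.IH Suc.prems]
      show ?case by (simp add: power_Suc2 del: power_Suc)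
    qed
    \<comment> \<open>Time 1/2 is an interior point, where two-sided derivatives are
      available.\<close>
    from this[of "1/2"] have "B (app (A ^ k) (E (1/2) x)) (app (A ^ k) (E (1/2) x)) = 0" for k
      by simp
    hence "app (A ^ k) (E (1/2) x) \<bullet> app A (app (A ^ k) (E (1/2) x)) = 0" for k
      by (simp add: B_def)
    hence "E (1/2) x = 0" by (rule obs)
    thus False using const[of "1/2"] \<open>x \<noteq> 0\<close> by simp
  qed
  have cont: "continuous_on (sphere 0 1) (\<lambda>x. norm (E 1 x))"
    unfolding E_def by (intro continuous_intros linear_continuous_on app.bounded_linear_right)
  have ne: "sphere (0::'a) 1 \<noteq> {}"
  proof -
    have "(SOME i. i \<in> Basis) \<in> sphere (0::'a) 1" using SOME_Basis by simp
    thus ?thesis by blast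
  qed
  obtain u :: 'a where u: "u \<in> sphere 0 1" "\<And>x. x \<in> sphere 0 1 \<Longrightarrow> norm (E 1 x) \<le> norm (E 1 u)"
    using continuous_attains_sup[OF compact_sphere ne cont] by auto
  define q where "q = norm (E 1 u)"
  have q: "0 \<le> q" "q < 1" using u(1) strict[of u] by (fastforce simp: q_def)+
  have contr: "norm (E 1 x) \<le> q * norm x" for x
  proof (cases "x = 0")
    case True thus ?thesis by (simp add: E_def app.zero_right)
  next
    case False
    hence "norm (E 1 (x /\<^sub>R norm x)) \<le> q" unfolding q_def by (intro u(2)) simp
    thus ?thesis using False by (simp add: E_def app.scaleR_right field_simps)
  qed
  have pow: "norm (E (real n) x) \<le> q ^ n * norm x" for n x
  proof (induction n)
    case (Suc n)
    have "norm (E (real (Suc n)) x) \<le> q * norm (E (real n) x)"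
      using contr[of "E (real n) x"] by (simp add: E_add)
    also have "\<dots> \<le> q * (q ^ n * norm x)" by (rule mult_left_mono[OF Suc q(1)])
    finally show ?case by simp
  qed (simp add: E0)
  have lim: "((\<lambda>t::real. q ^ nat \<lfloor>t\<rfloor> * norm x) \<longlongrightarrow> 0) at_top"
  proof -
    have "filterlim (\<lambda>t::real. nat \<lfloor>t\<rfloor>) sequentially at_top"
      by (rule filterlim_compose[OF filterlim_nat_sequentially filterlim_floor_sequentially])
    from filterlim_compose[OF LIMSEQ_realpow_zero[OF q] this]
    show ?thesis by (rule tendsto_mult_left_zero)
  qed
  show ?thesis unfolding E_def[symmetric]
  proof (rule Lim_null_comparison[OF _ lim])
    show "\<forall>\<^sub>F t in at_top. norm (E t x) \<le> q ^ nat \<lfloor>t\<rfloor> * norm x"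
      using eventually_ge_at_top[of 0]
    proof eventually_elim
      case (elim t)
      have "norm (E t x) \<le> norm (E (real (nat \<lfloor>t\<rfloor>)) x)"
        by (rule anti) (use elim in simp)
      also have "\<dots> \<le> q ^ nat \<lfloor>t\<rfloor> * norm x" by (rule pow)
      finally show ?case .
    qed
  qed
qed

section \<open>Complex matrices\<close>

lemma csc_nth [simp]: "csc a A $ i $ j = a * A $ i $ j"
  by (simp add: csc_def)

lemma cadj_nth [simp]: "cadj A $ i $ j = cnj (A $ j $ i)"
  by (simp add: cadj_def)

lemma matrix_mult_nth: "(A ** B) $ i $ j = (\<Sum>k\<in>UNIV. A $ i $ k * B $ k $ j)"
  by (simp add: matrix_matrix_mult_def)

lemma matrix_vector_nth: "(A *v x) $ i = (\<Sum>k\<in>UNIV. A $ i $ k * x $ k)"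
  by (simp add: matrix_vector_mult_def)

lemma mat_eqI: "(\<And>i j. A $ i $ j = B $ i $ j) \<Longrightarrow> A = B"
  by (simp add: vec_eq_iff)

named_theorems mat_simps

lemma csc_simps [mat_simps]:
  "csc a (A + B) = csc a A + csc a B" "csc a (A - B) = csc a A - csc a B" "csc a (- A) = - csc a A"
  "csc (a + b) A = csc a A + csc b A" "csc (a - b) A = csc a A - csc b A" "csc (- a) A = - csc a A"
  "csc a (csc b A) = csc (a * b) A" "csc 0 A = 0" "csc 1 A = A" "csc a 0 = 0"
  by (vector csc_def algebra_simps)+

lemma csc_sum: "csc a (\<Sum>i\<in>I. f i) = (\<Sum>i\<in>I. csc a (f i))"
  by (induction I rule: infinite_finite_induct) (auto simp: mat_simps)

lemma csc_sum_left: "csc (\<Sum>i\<in>I. g i) A = (\<Sum>i\<in>I. csc (g i) A)"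
  by (induction I rule: infinite_finite_induct) (auto simp: mat_simps)

lemma scaleR_csc: "r *\<^sub>R A = csc (complex_of_real r) A"
  by (simp add: vec_eq_iff) (simp add: scaleR_conv_of_real)

lemma csc_mult [mat_simps]:
  fixes A :: "complex^'c^'r" and B :: "complex^'d^'c"
  shows "csc a A ** B = csc a (A ** B)" "A ** csc a B = csc a (A ** B)"
  by (rule mat_eqI; simp add: matrix_mult_nth sum_distrib_left algebra_simps)+

lemma matrix_mult_simps [mat_simps]:
  fixes A A' :: "complex^'c^'r" and B B' :: "complex^'d^'c"
  shows "(A + A') ** B = A ** B + A' ** B" "A ** (B + B') = A ** B + A ** B'"
    "(A - A') ** B = A ** B - A' ** B" "A ** (B - B') = A ** B - A ** B'"
    "(- A) ** B = - (A ** B)" "A ** (- B) = - (A ** B)" "0 ** B = 0" "A ** (0 :: complex^'d^'c) = 0"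
  by (rule mat_eqI; simp add: matrix_mult_nth algebra_simps sum.distrib sum_subtractf sum_negf)+

lemma matrix_mult_sum_left:
  fixes B :: "complex^'d^'c"
  shows "(\<Sum>i\<in>I. f i) ** B = (\<Sum>i\<in>I. f i ** B)"
  by (induction I rule: infinite_finite_induct) (auto simp: mat_simps)

lemma matrix_mult_sum_right:
  fixes A :: "complex^'c^'r"
  shows "A ** (\<Sum>i\<in>I. f i) = (\<Sum>i\<in>I. A ** f i)"
  by (induction I rule: infinite_finite_induct) (auto simp: mat_simps)

lemma cadj_simps [mat_simps]:
  "cadj (A + B) = cadj A + cadj B" "cadj (A - B) = cadj A - cadj B" "cadj (- A) = - cadj A"
  "cadj 0 = 0" "cadj (csc a A) = csc (cnj a) (cadj A)" "cadj (cadj A) = A" "cadj (mat 1) = mat 1"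
  by (rule mat_eqI; simp add: mat_def)+

lemma cadj_sum: "cadj (\<Sum>i\<in>I. f i) = (\<Sum>i\<in>I. cadj (f i))"
  by (induction I rule: infinite_finite_induct) (auto simp: mat_simps)

lemma cadj_mult [mat_simps]:
  fixes A :: "complex^'c^'r" and B :: "complex^'d^'c"
  shows "cadj (A ** B) = cadj B ** cadj A"
  by (rule mat_eqI) (simp add: matrix_mult_nth mult.commute)

lemma ctrace_simps [simp]:
  "ctrace (A + B) = ctrace A + ctrace B" "ctrace (A - B) = ctrace A - ctrace B"
  "ctrace (- A) = - ctrace A" "ctrace 0 = 0" "ctrace (csc a A) = a * ctrace A"
  "ctrace (cadj A) = cnj (ctrace A)"
  by (simp_all add: ctrace_def sum.distrib sum_subtractf sum_negf sum_distrib_left)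

lemma ctrace_sum: "ctrace (\<Sum>i\<in>I. f i) = (\<Sum>i\<in>I. ctrace (f i))"
  by (induction I rule: infinite_finite_induct) auto

lemma ctrace_one: "ctrace (mat 1 :: complex^'n^'n) = of_nat CARD('n)"
  by (simp add: ctrace_def mat_def)

lemma ctrace_commute:
  fixes A :: "complex^'c^'r" and B :: "complex^'r^'c"
  shows "ctrace (A ** B) = ctrace (B ** A)"
  unfolding ctrace_def matrix_mult_nth by (subst sum.swap) (simp add: mult.commute)

lemma inner_cmat: "A \<bullet> B = Re (ctrace (cadj A ** B))" for A B :: "complex^'c^'r"
  unfolding ctrace_def matrix_mult_nth inner_vec_def
  by (subst sum.swap) (simp add: inner_complex_def)

lemma inner_cvec: "x \<bullet> y = Re (cinner x y)"
  by (simp add: cinner_def inner_vec_def inner_complex_def)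

lemma cinner_simps [simp]:
  "cinner (x + y) z = cinner x z + cinner y z" "cinner x (y + z) = cinner x y + cinner x z"
  "cinner (x - y) z = cinner x z - cinner y z" "cinner x (y - z) = cinner x y - cinner x z"
  "cinner (- x) z = - cinner x z" "cinner x (- z) = - cinner x z"
  "cinner (a *s x) z = cnj a * cinner x z" "cinner x (a *s z) = a * cinner x z"
  "cinner 0 z = 0" "cinner x 0 = 0"
  by (simp_all add: cinner_def sum.distrib sum_subtractf sum_negf sum_distrib_left algebra_simps)

lemma cinner_commute: "cinner y x = cnj (cinner x y)"
  by (simp add: cinner_def mult.commute)

lemma cinner_self: "cinner x x = of_real ((norm x)\<^sup>2)"
proof (rule complex_eqI)
  show "Re (cinner x x) = Re (of_real ((norm x)\<^sup>2))"
    by (simp add: power2_norm_eq_inner inner_cvec)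
  show "Im (cinner x x) = Im (of_real ((norm x)\<^sup>2))"
    by (simp add: cinner_def)
qed

lemma cinner_self_eq_0 [simp]: "cinner x x = 0 \<longleftrightarrow> x = 0"
  by (simp add: cinner_self)

lemma cinner_cadj: "cinner (A *v x) y = cinner x (cadj A *v y)"
  unfolding cinner_def matrix_vector_nth
  by (simp add: sum_distrib_left sum_distrib_right) (subst sum.swap, simp add: algebra_simps)

lemma cinner_cadj': "cinner x (A *v y) = cinner (cadj A *v x) y"
  by (simp add: cinner_cadj mat_simps)

lemma matrix_vector_smult: "A *v (a *s x) = a *s (A *v x)" for A :: "complex^'c^'r"
  by (simp add: vec_eq_iff matrix_vector_nth sum_distrib_left algebra_simps)

lemma csc_matrix_vector: "csc a A *v x = a *s (A *v x)"
  by (simp add: vec_eq_iff matrix_vector_nth sum_distrib_left algebra_simps)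

lemma matrix_vector_uminus: "(- A) *v x = - (A *v x)" for A :: "complex^'c^'r"
  by (simp add: vec_eq_iff matrix_vector_nth sum_negf)

section \<open>Hermitian and positive semidefinite matrices\<close>

lemma hermitianD: "hermitian A \<Longrightarrow> cadj A = A"
  by (simp add: hermitian_def)

lemma psdI:
  assumes "hermitian A" "\<And>x. 0 \<le> Re (cinner x (A *v x))"
  shows "psd A"
proof -
  have "Im (cinner x (A *v x)) = 0" for x
  proof -
    have "cnj (cinner x (A *v x)) = cinner x (A *v x)"
      by (subst cinner_commute[symmetric]) (simp add: cinner_cadj hermitianD[OF assms(1)])
    thus ?thesis by (metis Im_complex_of_real Reals_cnj_iff complex_is_Real_iff)
  qed
  thus ?thesis using assms by (simp add: psd_def)
qed

lemma psd_cadj_mult: "psd (cadj A ** A)"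
proof (rule psdI)
  show "hermitian (cadj A ** A)" by (simp add: hermitian_def mat_simps)
  fix x
  have "cinner x ((cadj A ** A) *v x) = cinner (A *v x) (A *v x)"
    by (simp add: cinner_cadj matrix_vector_mul_assoc)
  thus "0 \<le> Re (cinner x ((cadj A ** A) *v x))" by (simp add: cinner_self)
qed

lemma psd_csc: "psd A \<Longrightarrow> 0 \<le> r \<Longrightarrow> psd (csc (complex_of_real r) A)"
  by (auto simp: psd_def hermitian_def mat_simps csc_matrix_vector)

lemma tendsto_csc [tendsto_intros]:
  assumes "(f \<longlongrightarrow> a) F" "(X \<longlongrightarrow> A) F"
  shows "((\<lambda>t. csc (f t) (X t)) \<longlongrightarrow> csc a A) F"
  unfolding csc_def by (intro tendsto_intros assms)

lemma tendsto_cmat_mult [tendsto_intros]: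
  fixes A :: "complex^'c^'r" and B :: "complex^'d^'c"
  assumes "(X \<longlongrightarrow> A) F" "(Y \<longlongrightarrow> B) F"
  shows "((\<lambda>t. X t ** Y t) \<longlongrightarrow> A ** B) F"
  unfolding matrix_matrix_mult_def by (intro tendsto_intros assms)

lemma tendsto_cadj [tendsto_intros]:
  assumes "(X \<longlongrightarrow> A) F" shows "((\<lambda>t. cadj (X t)) \<longlongrightarrow> cadj A) F"
  unfolding cadj_def by (intro tendsto_intros assms)

lemma tendsto_ctrace [tendsto_intros]:
  assumes "(X \<longlongrightarrow> A) F" shows "((\<lambda>t. ctrace (X t)) \<longlongrightarrow> ctrace A) F"
  unfolding ctrace_def by (intro tendsto_intros assms)

lemma tendsto_cinner_mult [tendsto_intros]:
  assumes "(X \<longlongrightarrow> A) F" shows "((\<lambda>t. cinner x (X t *v y)) \<longlongrightarrow> cinner x (A *v y)) F"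
  unfolding cinner_def matrix_vector_mult_def by (simp, intro tendsto_intros assms)

lemma psd_limit:
  assumes "(X \<longlongrightarrow> A) F" "F \<noteq> bot" "\<forall>\<^sub>F t in F. psd (X t)"
  shows "psd A"
proof (rule psdI)
  have lim: "((\<lambda>t. cadj (X t) - X t) \<longlongrightarrow> cadj A - A) F" by (intro tendsto_intros assms)
  have "\<forall>\<^sub>F t in F. cadj (X t) - X t = 0"
    using assms(3) by eventually_elim (simp add: psd_def hermitian_def)
  from tendsto_unique[OF assms(2) lim tendsto_eventually[OF this]]
  have "cadj A - A = 0" .
  thus "hermitian A" by (simp add: hermitian_def)
  fix x
  show "0 \<le> Re (cinner x (A *v x))"
    by (rule tendsto_lowerbound[OF tendsto_Re[OF tendsto_cinner_mult[OF assms(1)]] _ assms(2)])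
       (use assms(3) in \<open>auto elim!: eventually_mono simp: psd_def\<close>)
qed

section \<open>Spectral theory\<close>

text \<open>The maximum \<open>c\<close> of the Rayleigh quotient on the unit sphere of
  \<open>S\<close> makes \<open>g\<close> semidefinite on \<open>S\<close> with a null vector, and
  such a vector lies in the kernel. Restricting to an invariant subspace serves both the
  diagonalisation and the search for an eigenvector orthogonal to the Krylov space.\<close>

lemma symmetric_eigenvector_in_subspace:
  fixes f :: "'a::euclidean_space \<Rightarrow> 'a"
  assumes "linear f" "\<And>x y. x \<bullet> f y = f x \<bullet> y" "subspace S" "\<And>x. x \<in> S \<Longrightarrow> f x \<in> S" "S \<noteq> {0}"
  obtains x c where "x \<in> S" "norm x = 1" "f x = c *\<^sub>R x"
proof -
  let ?K = "sphere 0 1 \<inter> S"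
  obtain z where "z \<in> S" "z \<noteq> 0" using assms(3,5) subspace_0 by blast
  hence "z /\<^sub>R norm z \<in> ?K" using assms(3) by (simp add: subspace_scale)
  hence "?K \<noteq> {}" by blast
  moreover have "compact ?K" using closed_subspace[OF assms(3)] by (simp add: compact_Int_closed)
  moreover have "continuous_on ?K (\<lambda>x. x \<bullet> f x)"
    by (intro continuous_intros linear_continuous_on) (simp add: assms(1) linear_conv_bounded_linear[symmetric])
  ultimately obtain x where x: "x \<in> ?K" "\<And>y. y \<in> ?K \<Longrightarrow> y \<bullet> f y \<le> x \<bullet> f x"
    using continuous_attains_sup[of ?K "\<lambda>x. x \<bullet> f x"] by blast
  define c where "c = x \<bullet> f x"
  define g where "g y = c *\<^sub>R y - f y" for y
  have "linear g" unfolding g_def using assms(1) by (simp add: linear_compose_sub linear_compose_scale_right linear_id[unfolded id_def] linear_ident)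
  have pos: "0 \<le> y \<bullet> g y" if "y \<in> S" for y
  proof (cases "y = 0")
    case False
    have "y /\<^sub>R norm y \<in> ?K" using False that assms(3) by (simp add: subspace_scale)
    from x(2)[OF this] have "y \<bullet> f y / (norm y)\<^sup>2 \<le> c"
      by (simp add: linear_scale[OF assms(1)] c_def power2_eq_square divide_inverse mult_ac)
    thus ?thesis using False
      by (simp add: g_def inner_diff_right divide_le_eq dot_square_norm)
  qed (simp add: g_def)
  have "g x \<in> S" using x assms(3,4) by (simp add: g_def subspace_diff subspace_scale)
  define y where "y = g x"
  have xx: "x \<bullet> g x = 0" using x(1) by (simp add: g_def inner_diff_right c_def dot_square_norm)
  have "x \<bullet> g y = g x \<bullet> y"
    using assms(2)[of x y] by (simp add: g_def inner_diff_left inner_diff_right)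
  hence gsym: "x \<bullet> g y = y \<bullet> y" by (simp add: y_def)
  define d where "d = y \<bullet> g y"
  have d: "0 \<le> d" unfolding d_def y_def by (rule pos) fact
  \<comment> \<open>With this \<open>s\<close> the form equals
    \<open>- (s\<^sup>2 * (2 + d))\<close>, which is negative unless \<open>y = 0\<close>.\<close>
  define s where "s = - (y \<bullet> y) / (1 + d)"
  have "0 \<le> (x + s *\<^sub>R y) \<bullet> g (x + s *\<^sub>R y)"
    using x(1) \<open>g x \<in> S\<close> assms(3) by (intro pos) (simp add: y_def subspace_add subspace_scale)
  also have "\<dots> = 2 * s * (y \<bullet> y) + s\<^sup>2 * d"
    using xx gsym unfolding d_def
    by (simp add: linear_add[OF \<open>linear g\<close>] linear_scale[OF \<open>linear g\<close>] inner_add y_def[symmetric]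
        inner_commute power2_eq_square algebra_simps)
  also have "\<dots> = - (s\<^sup>2 * (2 + d))"
  proof -
    have yy: "y \<bullet> y = - (s * (1 + d))" using d by (simp add: s_def)
    show ?thesis unfolding yy by (simp add: algebra_simps power2_eq_square)
  qed
  finally have "s\<^sup>2 * (2 + d) \<le> 0" by simp
  hence "s = 0" using d by (simp add: mult_le_0_iff)
  hence "y = 0" using d by (auto simp: s_def)
  hence "f x = c *\<^sub>R x" by (simp add: y_def g_def)
  thus ?thesis using that x by auto
qed

lemma scaleR_csmult: "r *\<^sub>R x = complex_of_real r *s (x :: complex^'n)"
  by (simp add: vec_eq_iff) (simp add: scaleR_conv_of_real)

lemma vec_subspace_imp_subspace: "vec.subspace S \<Longrightarrow> subspace (S :: (complex^'n) set)"
  unfolding vec.subspace_def subspace_def by (simp add: scaleR_csmult)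

lemma hermitian_eigenvector_in_subspace:
  fixes A :: "complex^'n^'n"
  assumes "hermitian A" "vec.subspace S" "\<And>x. x \<in> S \<Longrightarrow> A *v x \<in> S" "S \<noteq> {0}"
  obtains x c where "x \<in> S" "cinner x x = 1" "A *v x = complex_of_real c *s x"
proof -
  have "x \<bullet> (A *v y) = (A *v x) \<bullet> y" for x y
    by (simp add: inner_cvec cinner_cadj hermitianD[OF assms(1)])
  moreover have "linear ((*v) A)" by simp
  ultimately show ?thesis
    using symmetric_eigenvector_in_subspace[of "(*v) A" S] vec_subspace_imp_subspace[OF assms(2)] assms(3,4) that
    by (metis cinner_self one_power2 of_real_1 scaleR_csmult)
qed

lemma exists_orthogonal_to_proper_subspace:
  assumes "vec.subspace S" "S \<noteq> (UNIV :: (complex^'n) set)"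
  obtains u where "u \<noteq> 0" "\<And>x. x \<in> S \<Longrightarrow> cinner x u = 0"
proof -
  have sub: "span S = S" using vec_subspace_imp_subspace[OF assms(1)] by (simp add: span_eq_iff)
  have "span S \<subset> span UNIV" unfolding sub using assms(2) by auto
  then obtain u where u: "u \<noteq> 0" "\<And>y. y \<in> S \<Longrightarrow> orthogonal u y"
    using orthogonal_to_subspace_exists_gen[of S UNIV] sub by metis
  have "cinner y u = 0" if "y \<in> S" for y
  proof -
    \<comment> \<open>The real inner product sees only a real part; testing with
      \<open>\<i> *s y\<close> supplies the imaginary part.\<close>
    have "\<i> *s y \<in> S" using assms(1) that by (simp add: vec.subspace_scale)
    hence "u \<bullet> (\<i> *s y) = 0" "u \<bullet> y = 0" using u that by (auto simp: orthogonal_def)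
    hence "cinner u y = 0" by (simp add: inner_cvec complex_eq_iff)
    thus ?thesis by (metis cinner_commute complex_cnj_zero)
  qed
  thus ?thesis using u that by blast
qed

text \<open>Induction over sets of modes attaches one eigenvector to each mode. Fewer vectors than
  the dimension leave a nonzero orthogonal complement, which the Hermitian matrix maps into
  itself.\<close>

lemma hermitian_orthonormal_eigenvectors:
  fixes A :: "complex^'n^'n"
  assumes "hermitian A"
  obtains u :: "'n \<Rightarrow> complex^'n" and d :: "'n \<Rightarrow> real"
  where "\<And>i j. cinner (u i) (u j) = (if i = j then 1 else 0)" "\<And>i. A *v u i = complex_of_real (d i) *s u i"
proof -
  have "\<exists>(u :: 'n \<Rightarrow> complex^'n) (d :: 'n \<Rightarrow> real). (\<forall>i\<in>F. \<forall>j\<in>F. cinner (u i) (u j) = (if i = j then 1 else 0)) \<and>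
      (\<forall>i\<in>F. A *v u i = complex_of_real (d i) *s u i)" if "finite F" for F :: "'n set"
    using that
  proof (induction F)
    case (insert k F)
    then obtain u d where ud: "\<And>i j. i \<in> F \<Longrightarrow> j \<in> F \<Longrightarrow> cinner (u i) (u j) = (if i = j then 1 else 0)"
      "\<And>i. i \<in> F \<Longrightarrow> A *v u i = complex_of_real (d i) *s u i" by blast
    define S where "S = {x. \<forall>i\<in>F. cinner (u i) x = 0}"
    have "vec.dim (vec.span (u ` F)) \<le> card (u ` F)"
      using vec.dim_le_card'[of "u ` F"] by (simp add: insert.hyps)
    also have "\<dots> \<le> card F" by (rule card_image_le[OF insert.hyps(1)])
    also have "card F < CARD('n)"
      using insert.hyps by (intro psubset_card_mono) auto
    finally have "vec.span (u ` F) \<noteq> UNIV"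
      by (metis less_irrefl vec_dim_card)
    then obtain w where "w \<noteq> 0" "\<And>x. x \<in> vec.span (u ` F) \<Longrightarrow> cinner x w = 0"
      using exists_orthogonal_to_proper_subspace[of "vec.span (u ` F)"] by auto
    hence "S \<noteq> {0}" unfolding S_def by (auto simp: vec.span_base)
    moreover have "vec.subspace S" unfolding vec.subspace_def S_def by simp
    moreover have "A *v x \<in> S" if "x \<in> S" for x
      using that ud(2) unfolding S_def by (simp add: cinner_cadj' hermitianD[OF assms])
    ultimately obtain x c where x: "x \<in> S" "cinner x x = 1" "A *v x = complex_of_real c *s x"
      using hermitian_eigenvector_in_subspace[OF assms] by metis
    have x': "cinner x (u i) = 0" "cinner (u i) x = 0" if "i \<in> F" for i
      using x(1) that unfolding S_def by (auto simp: cinner_commute[of x])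
    show ?case
      by (rule exI[of _ "u(k := x)"], rule exI[of _ "d(k := c)"])
         (use insert.hyps ud x x' in auto)
  qed auto
  from this[of UNIV] show ?thesis using that by auto
qed

lemma hermitian_spectral:
  fixes A :: "complex^'n^'n" and u :: "'n \<Rightarrow> complex^'n"
  assumes "\<And>i j. cinner (u i) (u j) = (if i = j then 1 else 0)"
    "\<And>i. A *v u i = complex_of_real (d i) *s u i"
  shows "A $ k $ l = (\<Sum>i\<in>UNIV. complex_of_real (d i) * (u i $ k * cnj (u i $ l)))"
proof -
  define U :: "complex^'n^'n" where "U = (\<chi> k i. u i $ k)"
  have "cadj U ** U = mat 1"
    by (rule mat_eqI) (simp add: matrix_mult_nth U_def mat_def assms(1)[unfolded cinner_def])
  hence UU: "U ** cadj U = mat 1" by (simp add: matrix_left_right_inverse)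
  have "A ** U = (\<chi> k i. complex_of_real (d i) * u i $ k)"
    using assms(2) by (intro mat_eqI) (simp add: matrix_mult_nth U_def vec_eq_iff matrix_vector_nth)
  hence "A = (\<chi> k i. complex_of_real (d i) * u i $ k) ** cadj U"
    by (metis UU matrix_mul_assoc matrix_mul_rid)
  thus ?thesis by (simp add: matrix_mult_nth U_def mult.assoc)
qed

section \<open>Canonical anticommutation relations\<close>

definition jw_sign :: "'n::{finite,linorder} \<Rightarrow> 'n set \<Rightarrow> complex" where
  "jw_sign i S = (-1) ^ card {j\<in>S. j < i}"

lemma jw_sign_square [simp]: "jw_sign i S * jw_sign i S = 1"
  by (simp add: jw_sign_def power_add[symmetric] mult_2[symmetric])

lemma jw_sign_insert [simp]:
  assumes "k \<notin> S" shows "jw_sign i (insert k S) = (if k < i then - jw_sign i S else jw_sign i S)"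
proof -
  have "{j \<in> insert k S. j < i} = (if k < i then insert k {j\<in>S. j < i} else {j\<in>S. j < i})" by auto
  thus ?thesis using assms by (simp add: jw_sign_def)
qed

lemma jw_sign_remove [simp]:
  assumes "k \<in> S" shows "jw_sign i (S - {k}) = (if k < i then - jw_sign i S else jw_sign i S)"
  using jw_sign_insert[of k "S - {k}" i] assms by (auto simp: insert_absorb split: if_splits)

lemma annih_nth: "annih i $ S $ T = (if i \<notin> S \<and> T = insert i S then jw_sign i S else 0)"
proof -
  have "i \<in> T \<and> S = T - {i} \<longleftrightarrow> i \<notin> S \<and> T = insert i S" by auto
  moreover have "{j \<in> insert i S. j < i} = {j \<in> S. j < i}" by auto
  ultimately show ?thesis by (auto simp: annih_def jw_sign_def)
qed

lemma annih_apply: "(annih i *v x) $ S = (if i \<in> S then 0 else jw_sign i S * x $ insert i S)"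
  by (simp add: matrix_vector_nth annih_nth if_distrib[of "\<lambda>z. z * _"] cong: if_cong)

lemma creat_nth: "creat i $ S $ T = (if i \<in> S \<and> T = S - {i} then jw_sign i S else 0)"
proof -
  have e: "(i \<notin> T \<and> S = insert i T) = (i \<in> S \<and> T = S - {i})" by auto
  have r: "cnj (jw_sign i R) = jw_sign i R" for R by (simp add: jw_sign_def)
  show ?thesis by (cases "i \<in> S \<and> T = S - {i}") (simp_all add: creat_def annih_nth r e insert_absorb del: de_Morgan_conj)
qed

lemma creat_apply: "(creat i *v x) $ S = (if i \<in> S then jw_sign i S * x $ (S - {i}) else 0)"
  by (simp add: matrix_vector_nth creat_nth if_distrib[of "\<lambda>z. z * _"] cong: if_cong)

lemma cadj_creat [simp]: "cadj (creat i) = annih i"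
  by (simp add: creat_def mat_simps)

lemma cadj_annih [simp]: "cadj (annih i) = creat i"
  by (simp add: creat_def)

lemma annih_annih: "annih i ** annih j + annih j ** annih i = 0"
proof -
  have "annih i *v (annih j *v x) + annih j *v (annih i *v x) = 0" for x
    by (cases i j rule: linorder_cases) (auto simp: vec_eq_iff annih_apply insert_commute)
  thus ?thesis
    by (simp add: matrix_eq matrix_vector_mult_add_rdistrib matrix_vector_mul_assoc)
qed

lemma annih_creat: "annih i ** creat j + creat j ** annih i = (if i = j then mat 1 else 0)"
proof -
  have "annih i *v (creat j *v x) + creat j *v (annih i *v x) = (if i = j then x else 0)" for x
  proof -
    have [simp]: "insert i (S - {j}) = insert i S - {j}" if "i \<noteq> j" for S using that by auto
    show ?thesis
      by (cases i j rule: linorder_cases)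
         (auto simp: vec_eq_iff annih_apply creat_apply mult.assoc[symmetric] insert_absorb)
  qed
  thus ?thesis
    by (simp add: matrix_eq matrix_vector_mult_add_rdistrib matrix_vector_mul_assoc)
qed

section \<open>Parity and the grading of operators\<close>

lemma parity_apply: "(parity *v x) $ S = (-1) ^ card S * x $ S"
  by (simp add: matrix_vector_nth parity_def if_distrib[of "\<lambda>z. z * _"] cong: if_cong)

lemma cadj_parity [simp]: "cadj parity = parity"
  by (rule mat_eqI) (simp add: parity_def)

lemma parity_parity [simp]: "parity ** parity = (mat 1 :: 'n::finite fockop)"
proof -
  have "parity *v (parity *v x) = x" for x :: "complex^'n set"
    by (simp add: vec_eq_iff parity_apply mult.assoc[symmetric] power_mult_distrib[symmetric])
  thus ?thesis by (simp add: matrix_eq matrix_vector_mul_assoc)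
qed

lemma parity_annih: "parity ** annih i = - (annih i ** parity)"
proof -
  have "parity *v (annih i *v x) = - (annih i *v (parity *v x))" for x
    by (auto simp: vec_eq_iff parity_apply annih_apply)
  thus ?thesis by (simp add: matrix_eq matrix_vector_mul_assoc matrix_vector_uminus)
qed

text \<open>The grading automorphism: even operators are fixed and odd ones change sign.\<close>

definition par :: "'n::finite fockop \<Rightarrow> 'n fockop" where
  "par X = parity ** X ** parity"

lemma parity_cancel: "X ** parity ** parity = X"
  by (simp add: matrix_mul_assoc[symmetric])

lemma par_simps [mat_simps]:
  "par (X + Y) = par X + par Y" "par (X - Y) = par X - par Y" "par (- X) = - par X"
  "par 0 = 0" "par (csc a X) = csc a (par X)" "par (X ** Y) = par X ** par Y"
  "par (par X) = X" "par (mat 1) = mat 1" "par parity = parity"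
  by (simp_all add: par_def mat_simps matrix_mul_assoc parity_cancel)

lemma par_sum: "par (\<Sum>i\<in>I. f i) = (\<Sum>i\<in>I. par (f i))"
  by (induction I rule: infinite_finite_induct) (auto simp: mat_simps)

lemma cadj_par: "cadj (par X) = par (cadj X)"
  by (simp add: par_def mat_simps matrix_mul_assoc)

lemma ctrace_par: "ctrace (par X) = ctrace X"
  unfolding par_def by (subst ctrace_commute) (simp add: matrix_mul_assoc)

lemma parity_mult: "parity ** X = par X ** parity"
  by (simp add: par_def parity_cancel)

lemma par_annih: "par (annih i) = - annih i"
  by (simp add: par_def parity_annih mat_simps parity_cancel)

lemma par_creat: "par (creat i) = - creat i"
  using cadj_par[of "annih i"] by (simp add: par_annih mat_simps)

lemma par_nth: "par X $ S $ T = (-1) ^ card S * (-1) ^ card T * X $ S $ T"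
  by (simp add: par_def matrix_mult_nth parity_def if_distrib[of "\<lambda>z. z * _"] if_distrib[of "\<lambda>z. _ * z"] cong: if_cong)

text \<open>The smeared annihilator, antilinear in \<open>f\<close>, so that its adjoint is linear
  and \<open>cinner\<close> appears in the anticommutator without conjugation.\<close>

definition fa :: "complex^('n::{finite,linorder}) \<Rightarrow> 'n fockop" where
  "fa f = (\<Sum>i\<in>UNIV. csc (cnj (f $ i)) (annih i))"

lemma cadj_fa: "cadj (fa f) = (\<Sum>i\<in>UNIV. csc (f $ i) (creat i))"
  by (simp add: fa_def cadj_sum mat_simps)

lemma fa_simps: "fa (f + g) = fa f + fa g" "fa (f - g) = fa f - fa g" "fa (- f) = - fa f"
  "fa (a *s f) = csc (cnj a) (fa f)" "fa 0 = 0"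
  by (simp_all add: fa_def mat_simps sum.distrib sum_subtractf sum_negf csc_sum)

lemma fa_axis: "fa (axis i 1) = annih i"
proof -
  have "csc (cnj (axis i 1 $ j)) (annih j) = (if j = i then annih j else 0)" for j
    by (simp add: axis_def mat_simps)
  thus ?thesis by (simp add: fa_def)
qed

lemma par_fa: "par (fa f) = - fa f"
  by (simp add: fa_def par_sum mat_simps par_annih sum_negf)

lemma par_cadj_fa: "par (cadj (fa f)) = - cadj (fa f)"
  by (simp add: cadj_par[symmetric] par_fa mat_simps)

lemma sum_mult_sum_csc:
  fixes A :: "'i::finite \<Rightarrow> complex^'c^'r" and B :: "'j::finite \<Rightarrow> complex^'d^'c"
  shows "(\<Sum>i\<in>UNIV. csc (x i) (A i)) ** (\<Sum>j\<in>UNIV. csc (y j) (B j))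
    = (\<Sum>i\<in>UNIV. \<Sum>j\<in>UNIV. csc (x i * y j) (A i ** B j))"
  unfolding matrix_mult_sum_left by (simp add: matrix_mult_sum_right csc_sum mat_simps mult.commute)

lemma fa_fa: "fa f ** fa g + fa g ** fa f = 0"
proof -
  have "fa f ** fa g + fa g ** fa f
      = (\<Sum>i\<in>UNIV. \<Sum>j\<in>UNIV. csc (cnj (f $ i) * cnj (g $ j)) (annih i ** annih j + annih j ** annih i))"
    unfolding fa_def sum_mult_sum_csc mat_simps sum.distrib
    by (subst (4) sum.swap) (simp add: mult.commute)
  thus ?thesis by (simp add: annih_annih mat_simps)
qed

lemma fa_cadj_fa: "fa f ** cadj (fa g) + cadj (fa g) ** fa f = csc (cinner f g) (mat 1)"
proof -
  have "fa f ** cadj (fa g) + cadj (fa g) ** fa f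
      = (\<Sum>i\<in>UNIV. \<Sum>j\<in>UNIV. csc (cnj (f $ i) * g $ j) (annih i ** creat j + creat j ** annih i))"
    unfolding fa_def[of f] cadj_fa sum_mult_sum_csc mat_simps sum.distrib
    by (subst (4) sum.swap) (simp add: mult.commute)
  also have "\<dots> = (\<Sum>i\<in>UNIV. \<Sum>j\<in>UNIV. if i = j then csc (cnj (f $ i) * g $ j) (mat 1) else 0)"
    by (intro sum.cong refl) (simp add: annih_creat mat_simps)
  also have "\<dots> = csc (cinner f g) (mat 1)"
    by (simp add: cinner_def csc_sum_left)
  finally show ?thesis .
qed

text \<open>For odd \<open>a\<close> these play the role of creation and annihilation operators on the space of
  operators.\<close>

definition gmult :: "'n::finite fockop \<Rightarrow> 'n fockop \<Rightarrow> 'n fockop" where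
  "gmult a X = a ** X + par X ** a"

definition gcomm :: "'n::finite fockop \<Rightarrow> 'n fockop \<Rightarrow> 'n fockop" where
  "gcomm a X = a ** X - par X ** a"

lemma gmult_simps [mat_simps]:
  "gmult a (X + Y) = gmult a X + gmult a Y" "gmult a (X - Y) = gmult a X - gmult a Y"
  "gmult a (- X) = - gmult a X" "gmult a (csc z X) = csc z (gmult a X)" "gmult a 0 = 0"
  "gmult (a + b) X = gmult a X + gmult b X" "gmult (a - b) X = gmult a X - gmult b X"
  "gmult (- a) X = - gmult a X" "gmult (csc z a) X = csc z (gmult a X)" "gmult 0 X = 0"
  by (simp_all add: gmult_def mat_simps)

lemma gcomm_simps [mat_simps]:
  "gcomm a (X + Y) = gcomm a X + gcomm a Y" "gcomm a (X - Y) = gcomm a X - gcomm a Y"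
  "gcomm a (- X) = - gcomm a X" "gcomm a (csc z X) = csc z (gcomm a X)" "gcomm a 0 = 0"
  "gcomm (a + b) X = gcomm a X + gcomm b X" "gcomm (a - b) X = gcomm a X - gcomm b X"
  "gcomm (- a) X = - gcomm a X" "gcomm (csc z a) X = csc z (gcomm a X)" "gcomm 0 X = 0"
  by (simp_all add: gcomm_def mat_simps)

lemma gmult_sum: "gmult (\<Sum>i\<in>I. f i) X = (\<Sum>i\<in>I. gmult (f i) X)"
  by (induction I rule: infinite_finite_induct) (auto simp: mat_simps)

lemma gmult_sum_right: "gmult a (\<Sum>i\<in>I. f i) = (\<Sum>i\<in>I. gmult a (f i))"
  by (induction I rule: infinite_finite_induct) (auto simp: mat_simps)

text \<open>The sum of the two compositions is left minus right multiplication by the anticommutator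
  of \<open>a\<close> and \<open>b\<close>, and a scalar cancels there. Hence all graded
  multiplications by field operators anticommute, also those by an operator and its adjoint.\<close>

lemma gmult_anticommute:
  assumes "par a = - a" "par b = - b" "a ** b + b ** a = csc z (mat 1)"
  shows "gmult a (gmult b X) = - gmult b (gmult a X)"
proof -
  have 1: "b ** a = csc z (mat 1) - a ** b" using assms(3) by (simp add: algebra_simps)
  have 2: "Y ** b ** a = csc z Y - Y ** a ** b" for Y
    by (simp add: matrix_mul_assoc[symmetric] 1 mat_simps)
  show ?thesis
    by (simp add: gmult_def mat_simps assms(1,2) matrix_mul_assoc 1 2)
qed

text \<open>Here left and right multiplication by the scalar add up, which gives
  \<open>2 * z\<close>.\<close>

lemma gcomm_gmult:
  assumes "par a = - a" "par b = - b" "a ** b + b ** a = csc z (mat 1)"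
  shows "gcomm a (gmult b X) = csc (2 * z) X - gmult b (gcomm a X)"
proof -
  have 1: "b ** a = csc z (mat 1) - a ** b" using assms(3) by (simp add: algebra_simps)
  have 2: "Y ** b ** a = csc z Y - Y ** a ** b" for Y
    by (simp add: matrix_mul_assoc[symmetric] 1 mat_simps)
  have 3: "csc (2 * z) X = csc z X + csc z X" by (simp add: csc_simps(4)[symmetric])
  show ?thesis
    by (simp add: gmult_def gcomm_def mat_simps assms(1,2) matrix_mul_assoc 1 2 3)
qed

text \<open>The trace is invariant under the grading, so \<open>par X ** a\<close> has the trace of
  \<open>- (X ** a)\<close>. A generator with graded multiplications on the outside therefore
  preserves the trace.\<close>

lemma ctrace_gmult:
  assumes "par a = - a" shows "ctrace (gmult a X) = 0"
proof -
  have "ctrace (par X ** a) = ctrace (par (par X ** a))" by (rule ctrace_par[symmetric])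
  also have "\<dots> = - ctrace (X ** a)" by (simp add: mat_simps assms)
  also have "\<dots> = - ctrace (a ** X)" by (simp add: ctrace_commute[of X])
  finally show ?thesis by (simp add: gmult_def)
qed

text \<open>Graded commutation and graded multiplication by the adjoint are adjoint to each other
  for the Hilbert-Schmidt product; composing them gives positive maps.\<close>

lemma inner_gmult:
  assumes "par a = - a" shows "X \<bullet> gmult (cadj a) Y = gcomm a X \<bullet> Y"
proof -
  have "ctrace (cadj X ** (par Y ** cadj a)) = ctrace (par (cadj X ** (par Y ** cadj a)))"
    by (simp add: ctrace_par)
  also have "\<dots> = - ctrace (cadj (par X) ** Y ** cadj a)"
    by (simp add: mat_simps cadj_par[symmetric] assms matrix_mul_assoc)
  also have "\<dots> = - ctrace (cadj a ** (cadj (par X) ** Y))"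
    by (subst ctrace_commute) simp
  finally show ?thesis
    by (simp add: inner_cmat gmult_def gcomm_def mat_simps matrix_mul_assoc)
qed

lemma mult_annih_nth: "(X ** annih i) $ S $ T = (if i \<in> T then X $ S $ (T - {i}) * jw_sign i T else 0)"
proof -
  have "X $ S $ R * annih i $ R $ T = (if R = T - {i} then (if i \<in> T then X $ S $ R * jw_sign i T else 0) else 0)" for R
    by (auto simp: annih_nth)
  thus ?thesis by (simp add: matrix_mult_nth)
qed

lemma annih_mult_nth: "(annih i ** X) $ S $ T = (if i \<in> S then 0 else jw_sign i S * X $ insert i S $ T)"
  by (simp add: matrix_mult_nth annih_nth if_distrib[of "\<lambda>z. z * _"] cong: if_cong)

lemma creat_mult_nth: "(creat i ** X) $ S $ T = (if i \<in> S then jw_sign i S * X $ (S - {i}) $ T else 0)"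
  by (simp add: matrix_mult_nth creat_nth if_distrib[of "\<lambda>z. z * _"] cong: if_cong)

text \<open>A graded form of irreducibility. \<open>X\<close> commutes with every occupation number,
  so it is diagonal in the occupation basis and hence even; graded commutation is then ordinary
  commutation, and adding one particle at a time makes all diagonal entries equal.\<close>

lemma gcomm_kernel_scalar:
  fixes X :: "'n::{finite,linorder} fockop"
  assumes "\<And>i. gcomm (annih i) X = 0" "\<And>i. gcomm (creat i) X = 0"
  shows "X = csc (ctrace X / of_nat CARD('n set)) (mat 1)"
proof -
  have a: "annih i ** X = par X ** annih i" and c: "creat i ** X = par X ** creat i" for i
    using assms[of i] by (auto simp: gcomm_def)
  have n: "creat i ** (annih i ** X) = X ** creat i ** annih i" for i
  proof -
    have "par (creat i ** X) = par (par X ** creat i)" by (simp add: c)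
    hence "creat i ** par X = X ** creat i" by (simp add: mat_simps par_creat)
    thus ?thesis by (simp add: a) (simp add: matrix_mul_assoc)
  qed
  have off: "X $ S $ T = 0" if "S \<noteq> T" for S T
  proof -
    have *: "X $ S $ T = 0" if "i \<in> S" "i \<notin> T" for i S T
    proof -
      have "(creat i ** (annih i ** X)) $ S $ T = (X ** creat i ** annih i) $ S $ T"
        by (simp only: n)
      thus ?thesis using that
        by (simp add: creat_mult_nth annih_mult_nth mult_annih_nth mult.assoc[symmetric] insert_absorb)
    qed
    have **: "X $ S $ T = 0" if "i \<notin> S" "i \<in> T" for i
    proof -
      have "(creat i ** (annih i ** X)) $ S $ T = (X ** creat i ** annih i) $ S $ T"
        by (simp only: n)
      hence "(X ** creat i) $ S $ (T - {i}) = 0"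
        using that by (simp add: creat_mult_nth mult_annih_nth) (metis jw_sign_square mult_eq_0_iff zero_neq_one)
      moreover have "(X ** creat i) $ S $ (T - {i}) = cnj ((annih i ** cadj X) $ (T - {i}) $ S)"
        using cadj_nth[of "annih i ** cadj X" S "T - {i}"] by (simp add: mat_simps)
      ultimately show ?thesis
        using that by (simp add: annih_mult_nth insert_absorb) (metis jw_sign_square mult_eq_0_iff zero_neq_one)
    qed
    obtain i where "i \<in> S \<and> i \<notin> T \<or> i \<notin> S \<and> i \<in> T" using \<open>S \<noteq> T\<close> by blast
    thus ?thesis using * ** by blast
  qed
  have "par X = X"
    by (rule mat_eqI) (metis (no_types, lifting) off par_nth mult.commute mult_1 mult_zero_right
        power_mult_distrib[symmetric] minus_one_mult_self)
  hence ac: "annih i ** X = X ** annih i" for i by (simp add: a)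
  have diag: "X $ S $ S = X $ {} $ {}" if "finite S" for S
    using that
  proof (induction S)
    case (insert i S)
    have "(annih i ** X) $ S $ insert i S = (X ** annih i) $ S $ insert i S" by (simp add: ac)
    hence "jw_sign i S * X $ insert i S $ insert i S = jw_sign i S * X $ S $ S"
      using insert.hyps by (simp add: annih_mult_nth mult_annih_nth mult.commute)
    thus ?case using insert.IH by (metis jw_sign_square mult.assoc mult_1)
  qed simp
  have X: "X = csc (X $ {} $ {}) (mat 1)"
    by (rule mat_eqI) (use off diag in \<open>auto simp: mat_def\<close>)
  hence "ctrace X = X $ {} $ {} * of_nat CARD('n set)"
    by (metis ctrace_one ctrace_simps(5))
  thus ?thesis using X by (simp add: zero_less_card_finite)
qed

section \<open>The infinite-temperature generator\<close>

definition outer :: "complex^'n \<Rightarrow> complex^'m \<Rightarrow> complex^'m^'n" where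
  "outer f g = (\<chi> i j. f $ i * cnj (g $ j))"

lemma outer_mult: "A ** outer f g = outer (A *v f) g" "outer f g ** A = outer f (cadj A *v g)"
  by (rule mat_eqI; simp add: outer_def matrix_mult_nth matrix_vector_nth sum_distrib_left sum_distrib_right algebra_simps)+

text \<open>Identities linear in a matrix need checking only on rank-one matrices, where quadratic
  expressions factor into two field operators.\<close>

lemma cmat_outer_induct [case_names add scale outer]:
  fixes C :: "complex^'m^'n"
  assumes "\<And>C D. P C \<Longrightarrow> P D \<Longrightarrow> P (C + D)" "\<And>z C. P C \<Longrightarrow> P (csc z C)" "\<And>f g. P (outer f g)"
  shows "P C"
proof -
  have "P 0" using assms(2)[of "outer 0 0" 0] assms(3) by (simp add: mat_simps)
  hence S: "P (sum F I)" if "\<And>i. P (F i)" for I and F :: "'k \<Rightarrow> complex^'m^'n"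
    using that assms(1) by (induction I rule: infinite_finite_induct) auto
  have "C = (\<Sum>i\<in>UNIV. \<Sum>j\<in>UNIV. csc (C $ i $ j) (outer (axis i 1) (axis j 1)))"
  proof (rule mat_eqI)
    fix k l
    have "csc (C $ i $ j) (outer (axis i 1) (axis j 1)) $ k $ l = (if j = l then (if i = k then C $ i $ j else 0) else 0)" for i j
      by (simp add: outer_def axis_def)
    thus "C $ k $ l = (\<Sum>i\<in>UNIV. \<Sum>j\<in>UNIV. csc (C $ i $ j) (outer (axis i 1) (axis j 1))) $ k $ l"
      by (simp del: csc_nth)
  qed
  moreover have "P (\<Sum>i\<in>UNIV. \<Sum>j\<in>UNIV. csc (C $ i $ j) (outer (axis i 1) (axis j 1)))"
    by (intro S assms)
  ultimately show ?thesis by simp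
qed

section \<open>Quadratic Hamiltonians and their action on field operators\<close>

lemma sys_ham_simps [mat_simps]:
  "sys_ham (K + L) = sys_ham K + sys_ham L" "sys_ham (csc z K) = csc z (sys_ham K)"
  by (simp_all add: sys_ham_def mat_simps sum.distrib csc_sum)

lemma cadj_sys_ham: "cadj (sys_ham K) = sys_ham (cadj K)"
  unfolding sys_ham_def cadj_sum by (subst sum.swap) (simp add: mat_simps)

lemma par_sys_ham: "par (sys_ham K) = sys_ham K"
  by (simp add: sys_ham_def par_sum mat_simps par_annih par_creat)

lemma sys_ham_outer: "sys_ham (outer f g) = cadj (fa f) ** fa g"
  by (subst cadj_fa, subst fa_def, subst sum_mult_sum_csc) (simp add: sys_ham_def outer_def)

lemma fa_sum: "fa (\<Sum>i\<in>I. f i) = (\<Sum>i\<in>I. fa (f i))"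
  by (induction I rule: infinite_finite_induct) (auto simp: fa_simps)

lemma fa_fa_minus: "fa f ** fa g = - (fa g ** fa f)"
  using fa_fa[of f g] by (simp add: eq_neg_iff_add_eq_0)

lemma fa_cadj_fa_minus: "fa f ** cadj (fa g) = csc (cinner f g) (mat 1) - cadj (fa g) ** fa f"
  using fa_cadj_fa[of f g] by (simp add: algebra_simps)

lemma cadj_fa_cadj_fa: "cadj (fa f) ** cadj (fa g) + cadj (fa g) ** cadj (fa f) = 0"
  using arg_cong[OF fa_fa[of g f], of cadj] by (simp add: mat_simps)

lemma cadj_fa_fa: "cadj (fa f) ** fa g + fa g ** cadj (fa f) = csc (cinner g f) (mat 1)"
  using fa_cadj_fa[of g f] by (simp add: add.commute)

lemma commutator_simps [mat_simps]:
  "commutator H (X + Y) = commutator H X + commutator H Y" "commutator H (X - Y) = commutator H X - commutator H Y"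
  "commutator H (- X) = - commutator H X" "commutator H (csc z X) = csc z (commutator H X)"
  "commutator H 0 = 0" "commutator (H + K) X = commutator H X + commutator K X"
  "commutator (csc z H) X = csc z (commutator H X)"
  by (simp_all add: commutator_def mat_simps)

text \<open>Second quantisation acts on a field operator through the one-particle matrix; the
  adjoint appears because \<open>fa\<close> is antilinear.\<close>

lemma commutator_sys_ham_fa: "commutator (sys_ham K) (fa f) = - fa (cadj K *v f)"
proof (induction K rule: cmat_outer_induct)
  case (outer g h)
  have "cadj (fa g) ** fa h ** fa f - fa f ** cadj (fa g) ** fa h
    = - (cadj (fa g) ** fa f ** fa h) - (csc (cinner f g) (mat 1) - cadj (fa g) ** fa f) ** fa h"
    by (simp add: fa_cadj_fa_minus[of f g] matrix_mul_assoc[symmetric] fa_fa_minus[of h f] mat_simps)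
  also have "\<dots> = - csc (cinner f g) (fa h)" by (simp add: mat_simps matrix_mul_assoc)
  also have "csc (cinner f g) (fa h) = fa (cinner g f *s h)"
    by (simp add: fa_simps cinner_commute[of f g])
  also have "cinner g f *s h = cadj (outer g h) *v f"
    by (simp add: vec_eq_iff outer_def matrix_vector_nth cinner_def sum_distrib_left algebra_simps)
  finally show ?case by (simp add: commutator_def sys_ham_outer matrix_mul_assoc)
qed (simp_all add: mat_simps matrix_vector_mult_add_rdistrib fa_simps csc_matrix_vector)

lemma commutator_sys_ham_cadj_fa:
  assumes "hermitian T" shows "commutator (sys_ham T) (cadj (fa f)) = cadj (fa (T *v f))"
proof -
  have "cadj (commutator (sys_ham T) (fa f)) = - commutator (sys_ham T) (cadj (fa f))"
    by (simp add: commutator_def mat_simps cadj_sys_ham hermitianD[OF assms])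
  thus ?thesis
    by (simp add: commutator_sys_ham_fa hermitianD[OF assms] mat_simps)
qed

text \<open>Commutation with an even operator is a derivation of the graded product.\<close>

lemma commutator_gmult:
  assumes "par H = H"
  shows "commutator H (gmult a X) = gmult (commutator H a) X + gmult a (commutator H X)"
  by (simp add: commutator_def gmult_def mat_simps assms matrix_mul_assoc)

lemma commutator_gcomm:
  assumes "par H = H"
  shows "commutator H (gcomm a X) = gcomm (commutator H a) X + gcomm a (commutator H X)"
  by (simp add: commutator_def gcomm_def mat_simps assms matrix_mul_assoc)

lemma ctrace_commutator: "ctrace (commutator H X) = 0"
  by (simp add: commutator_def ctrace_commute[of H])

text \<open>The dissipative part is minus a sum of maps composed with their adjoints. The constant
  \<open>1/4\<close> matches Lindblad terms for gain and loss at equal rate \<open>1/2\<close>, as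
  \<open>inf_temp_gen_term\<close> shows.\<close>

definition inf_temp_gen :: "((complex, 'n::{finite,linorder}) vec, 'n) vec \<Rightarrow> ((complex, 'm::finite) vec, 'n) vec \<Rightarrow> 'n fockop \<Rightarrow> 'n fockop" where
  "inf_temp_gen T Th X = csc (- \<i>) (commutator (sys_ham T) X) - csc (1/4) (\<Sum>j\<in>UNIV.
     gmult (cadj (fa (column j Th))) (gcomm (fa (column j Th)) X)
     + gmult (fa (column j Th)) (gcomm (cadj (fa (column j Th))) X))"

lemma inf_temp_gen_simps [mat_simps]:
  "inf_temp_gen T Th (X + Y) = inf_temp_gen T Th X + inf_temp_gen T Th Y" "inf_temp_gen T Th (csc z X) = csc z (inf_temp_gen T Th X)"
proof -
  show "inf_temp_gen T Th (X + Y) = inf_temp_gen T Th X + inf_temp_gen T Th Y"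
    by (simp add: inf_temp_gen_def mat_simps sum.distrib)
  show "inf_temp_gen T Th (csc z X) = csc z (inf_temp_gen T Th X)"
    by (simp add: inf_temp_gen_def mat_simps csc_sum sum.distrib mult.commute)
qed

lemma ctrace_inf_temp_gen: "ctrace (inf_temp_gen T Th X) = 0"
  by (simp add: inf_temp_gen_def ctrace_commutator ctrace_sum ctrace_gmult par_fa par_cadj_fa)

lemma inf_temp_gen_one: "inf_temp_gen T Th (mat 1) = 0"
  by (simp add: inf_temp_gen_def commutator_def gcomm_def mat_simps)

text \<open>Commuting the generator with a graded multiplication gives a single graded
  multiplication again: the Hamiltonian moves \<open>c\<close>, and each contraction
  \<open>2 * z\<close> from \<open>gcomm_gmult\<close>, times \<open>1/4\<close>, yields the
  coefficient \<open>1/2\<close>.\<close>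

lemma inf_temp_gen_gmult:
  assumes c: "par c = - c"
    and z: "\<And>j. fa (column j Th) ** c + c ** fa (column j Th) = csc (z j) (mat 1)"
    and w: "\<And>j. cadj (fa (column j Th)) ** c + c ** cadj (fa (column j Th)) = csc (w j) (mat 1)"
  shows "inf_temp_gen T Th (gmult c X) = gmult c (inf_temp_gen T Th X)
    + gmult (csc (- \<i>) (commutator (sys_ham T) c) - csc (1/2) (\<Sum>j\<in>UNIV. csc (z j) (cadj (fa (column j Th)))
        + csc (w j) (fa (column j Th)))) X"
proof -
  define a where "a j = fa (column j Th)" for j
  have pa: "par (a j) = - a j" "par (cadj (a j)) = - cadj (a j)" for j
    by (simp_all add: a_def par_fa par_cadj_fa)
  have 1: "gmult (cadj (a j)) (gcomm (a j) (gmult c X)) + gmult (a j) (gcomm (cadj (a j)) (gmult c X))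
     = gmult c (gmult (cadj (a j)) (gcomm (a j) X) + gmult (a j) (gcomm (cadj (a j)) X))
       + csc 2 (gmult (csc (z j) (cadj (a j)) + csc (w j) (a j)) X)" for j
    using gcomm_gmult[OF pa(1)[of j] c z[of j, folded a_def], of X]
      gcomm_gmult[OF pa(2)[of j] c w[of j, folded a_def], of X]
      gmult_anticommute[OF pa(2)[of j] c w[of j, folded a_def], of "gcomm (a j) X"]
      gmult_anticommute[OF pa(1)[of j] c z[of j, folded a_def], of "gcomm (cadj (a j)) X"]
    by (simp add: mat_simps)
  show ?thesis
    unfolding inf_temp_gen_def a_def[symmetric] 1 commutator_gmult[OF par_sys_ham]
    by (simp add: mat_simps sum.distrib csc_sum gmult_sum gmult_sum_right)
qed

lemma matrix_mult_cadj_sum: "(Th ** cadj Th) *v f = (\<Sum>j\<in>UNIV. cinner (column j Th) f *s column j Th)"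
  by (simp add: vec_eq_iff matrix_vector_nth matrix_mult_nth cinner_def column_def
      sum_distrib_left sum_distrib_right) (subst sum.swap, simp add: algebra_simps)

definition drift :: "complex^'n^'n \<Rightarrow> complex^'m^'n \<Rightarrow> complex^'n^'n" where
  "drift T Th = csc (- \<i>) T - csc (1/2) (Th ** cadj Th)"

lemma drift_apply:
  "drift T Th *v f = (- \<i>) *s (T *v f) - (1/2) *s (\<Sum>j\<in>UNIV. cinner (column j Th) f *s column j Th)"
  unfolding drift_def matrix_vector_mult_diff_rdistrib csc_matrix_vector matrix_mult_cadj_sum ..

lemma inf_temp_gen_gmult_fa:
  assumes "hermitian T"
  shows "inf_temp_gen T Th (gmult (fa f) X) = gmult (fa f) (inf_temp_gen T Th X) + gmult (fa (drift T Th *v f)) X"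
proof -
  have "csc (- \<i>) (commutator (sys_ham T) (fa f)) - csc (1/2) (\<Sum>j\<in>UNIV. csc 0 (cadj (fa (column j Th)))
        + csc (cinner f (column j Th)) (fa (column j Th))) = fa (drift T Th *v f)"
    by (simp add: drift_apply commutator_sys_ham_fa hermitianD[OF assms] mat_simps fa_simps fa_sum
        cinner_commute[of f])
  moreover have "fa (column j Th) ** fa f + fa f ** fa (column j Th) = csc 0 (mat 1)" for j
    by (simp add: fa_fa mat_simps)
  note inf_temp_gen_gmult[where c = "fa f", OF par_fa this cadj_fa_fa, of T X]
  ultimately show ?thesis by (simp only:)
qed

lemma inf_temp_gen_gmult_cadj_fa:
  assumes "hermitian T"
  shows "inf_temp_gen T Th (gmult (cadj (fa f)) X) = gmult (cadj (fa f)) (inf_temp_gen T Th X) + gmult (cadj (fa (drift T Th *v f))) X"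
proof -
  have "csc (- \<i>) (commutator (sys_ham T) (cadj (fa f))) - csc (1/2) (\<Sum>j\<in>UNIV. csc (cinner (column j Th) f) (cadj (fa (column j Th)))
        + csc 0 (fa (column j Th))) = cadj (fa (drift T Th *v f))"
    by (simp add: drift_apply commutator_sys_ham_cadj_fa[OF assms] mat_simps fa_simps fa_sum cadj_sum
        cinner_commute[of f])
  moreover have "cadj (fa (column j Th)) ** cadj (fa f) + cadj (fa f) ** cadj (fa (column j Th)) = csc 0 (mat 1)" for j
    by (simp add: cadj_fa_cadj_fa mat_simps)
  note inf_temp_gen_gmult[where c = "cadj (fa f)", OF par_cadj_fa fa_cadj_fa this, of T X]
  ultimately show ?thesis by (simp only:)
qed

text \<open>This is \<open>q(C)\<close>: the expression \<open>sys_ham C\<close> with field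
  operators replaced by graded multiplications.\<close>

definition pair_op :: "((complex, 'n::{finite,linorder}) vec, 'n) vec \<Rightarrow> 'n fockop \<Rightarrow> 'n fockop" where
  "pair_op C X = (\<Sum>i\<in>UNIV. \<Sum>l\<in>UNIV. csc (C $ i $ l) (gmult (creat i) (gmult (annih l) X)))"

lemma pair_op_simps [mat_simps]:
  "pair_op (C + D) X = pair_op C X + pair_op D X" "pair_op (csc z C) X = csc z (pair_op C X)"
  "pair_op C (X + Y) = pair_op C X + pair_op C Y" "pair_op C (csc z X) = csc z (pair_op C X)"
  by (simp_all add: pair_op_def mat_simps sum.distrib csc_sum mult.commute)

lemma pair_op_outer: "pair_op (outer f g) X = gmult (cadj (fa f)) (gmult (fa g) X)"
proof -
  have "gmult (fa g) X = (\<Sum>l\<in>UNIV. csc (cnj (g $ l)) (gmult (annih l) X))"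
    by (simp add: fa_def gmult_sum mat_simps)
  thus ?thesis
    unfolding cadj_fa gmult_sum by (simp add: pair_op_def outer_def gmult_sum_right csc_sum mat_simps mult.commute)
qed

text \<open>Exchanging two pairs takes four sign changes, and no contraction terms arise because
  graded multiplications anticommute exactly.\<close>

lemma pair_op_commute:
  fixes X :: "'n::{finite,linorder} fockop"
  shows "pair_op C (pair_op D X) = pair_op D (pair_op C X)"
proof (induction C arbitrary: X rule: cmat_outer_induct)
  case (outer f g)
  show ?case
  proof (induction D arbitrary: X rule: cmat_outer_induct)
    case (outer h k)
    have fc: "gmult (fa f) (gmult (cadj (fa g)) Y) = - gmult (cadj (fa g)) (gmult (fa f) Y)" for f g :: "(complex, 'n) vec" and Y
      by (rule gmult_anticommute[OF par_fa par_cadj_fa fa_cadj_fa])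
    have ff: "gmult (fa f) (gmult (fa g) Y) = - gmult (fa g) (gmult (fa f) Y)" for f g :: "(complex, 'n) vec" and Y
      by (rule gmult_anticommute[OF par_fa par_fa, where z = 0]) (simp add: fa_fa mat_simps)
    have cc: "gmult (cadj (fa f)) (gmult (cadj (fa g)) Y) = - gmult (cadj (fa g)) (gmult (cadj (fa f)) Y)" for f g :: "(complex, 'n) vec" and Y
      by (rule gmult_anticommute[OF par_cadj_fa par_cadj_fa, where z = 0]) (simp add: cadj_fa_cadj_fa mat_simps)
    show ?case
      by (simp add: pair_op_outer fc mat_simps) (simp add: ff[of g k] cc[of f h] mat_simps)
  qed (auto simp: mat_simps)
qed (auto simp: mat_simps)

text \<open>The Leibniz rule over the two factors: by \<open>outer_mult\<close> the drift of the
  first multiplies \<open>C\<close> from the left, that of the second gives the adjoint on the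
  right.\<close>

lemma inf_temp_gen_pair_op:
  assumes "hermitian T"
  shows "inf_temp_gen T Th (pair_op C X) = pair_op C (inf_temp_gen T Th X) + pair_op (drift T Th ** C + C ** cadj (drift T Th)) X"
proof (induction C rule: cmat_outer_induct)
  case (outer f g)
  show ?case
    by (simp add: outer_mult mat_simps pair_op_outer inf_temp_gen_gmult_fa[OF assms] inf_temp_gen_gmult_cadj_fa[OF assms])
qed (auto simp: mat_simps)

lemma ctrace_pair_op: "ctrace (pair_op C X) = 0"
  by (simp add: pair_op_def ctrace_sum ctrace_gmult par_creat)

section \<open>Dissipativity and convergence at infinite temperature\<close>

lemma linear_csc_iff:
  assumes "\<And>X Y. f (X + Y) = f X + f Y" "\<And>z X. f (csc z X) = csc z (f X)"
  shows "linear f"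
  by (rule linearI) (simp_all add: assms scaleR_csc)

lemma linear_inf_temp_gen: "linear (inf_temp_gen T Th)"
  by (rule linear_csc_iff) (simp_all add: mat_simps)

lemma linear_pair_op: "linear (pair_op C)"
  by (rule linear_csc_iff) (simp_all add: mat_simps)

lemma inner_csc_of_real: "X \<bullet> csc (complex_of_real r) Y = r * (X \<bullet> Y)"
  by (simp add: scaleR_csc[symmetric])

lemma inner_commutator_hermitian:
  assumes "cadj H = H" shows "X \<bullet> csc (- \<i>) (commutator H X) = 0"
proof -
  have "Im (ctrace (cadj X ** H ** X)) = 0"
    using ctrace_simps(6)[of "cadj X ** H ** X"]
    by (simp add: mat_simps assms matrix_mul_assoc complex_eq_iff)
  moreover have "Im (ctrace (cadj X ** X ** H)) = 0"
    using ctrace_simps(6)[of "cadj X ** X ** H"] ctrace_commute[of H "cadj X ** X"]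
    by (simp add: mat_simps assms matrix_mul_assoc complex_eq_iff)
  ultimately show ?thesis
    by (simp add: inner_cmat commutator_def mat_simps matrix_mul_assoc)
qed

lemma inner_inf_temp_gen:
  fixes X :: "'n::{finite,linorder} fockop"
  assumes "hermitian T"
  shows "X \<bullet> inf_temp_gen T Th X = - (1/4) * (\<Sum>j\<in>UNIV. (norm (gcomm (fa (column j Th)) X))\<^sup>2
     + (norm (gcomm (cadj (fa (column j Th))) X))\<^sup>2)"
proof -
  have "X \<bullet> gmult (cadj (fa f)) (gcomm (fa f) X) = (norm (gcomm (fa f) X))\<^sup>2" for f :: "(complex, 'n) vec"
    by (simp add: inner_gmult par_fa power2_norm_eq_inner)
  moreover have "X \<bullet> gmult (fa f) (gcomm (cadj (fa f)) X) = (norm (gcomm (cadj (fa f)) X))\<^sup>2" for f :: "(complex, 'n) vec"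
    using inner_gmult[OF par_cadj_fa, of X f "gcomm (cadj (fa f)) X"]
    by (simp add: power2_norm_eq_inner mat_simps)
  moreover have "X \<bullet> csc (1/4) Y = (1/4) * (X \<bullet> Y)" for Y
    using inner_csc_of_real[of X "1/4" Y] by simp
  ultimately show ?thesis
    unfolding inf_temp_gen_def inner_diff_right
    by (simp add: inner_commutator_hermitian cadj_sys_ham hermitianD[OF assms] inner_sum_right inner_add_right)
qed

lemma mpow_Suc: "mpow A (Suc k) = mpow A k ** A"
  by (simp add: mpow_def)

lemma mpow_Suc': "mpow A (Suc k) = A ** mpow A k"
proof (induction k)
  case (Suc k)
  have "mpow A (Suc (Suc k)) = A ** mpow A k ** A" by (simp only: mpow_Suc[of A "Suc k"] Suc)
  thus ?case by (simp add: mpow_Suc matrix_mul_assoc[symmetric])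
qed (simp add: mpow_def)

lemma column_mult: "column j (A ** B) = A *v column j B"
  by (simp add: vec_eq_iff column_def matrix_mult_nth matrix_vector_nth)

lemma krylov_span_subset:
  assumes "krylov_span T Th = UNIV" "vec.subspace S" "\<And>k j. mpow T k *v column j Th \<in> S"
  shows "S = UNIV"
proof -
  have "(mpow T k ** Th) *v x = (\<Sum>j\<in>UNIV. x $ j *s (mpow T k *v column j Th))" for k x
    by (simp add: matrix_mult_sum column_mult)
  hence "(mpow T k ** Th) *v x \<in> S" for k x
    using assms(2,3) by (auto intro!: vec.subspace_sum vec.subspace_scale)
  hence "vec.span (\<Union>k. range (\<lambda>x. (mpow T k ** Th) *v x)) \<subseteq> S"
    by (intro vec.span_minimal assms(2)) auto
  thus ?thesis using assms(1) unfolding krylov_span_def by auto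
qed

text \<open>Scalars are fixed, so decay to zero fails for the generator itself; subtracting the
  projection \<open>Pr\<close> onto scalars damps this direction as well and leaves the evolution of
  traceless operators unchanged.\<close>

lemma inf_temp_gen_tendsto:
  fixes T :: "((complex, 'n::{finite,linorder}) vec, 'n) vec" and Th :: "((complex, 'm::finite) vec, 'n) vec" and X :: "'n fockop"
  assumes "hermitian T" "krylov_span T Th = UNIV"
  shows "((\<lambda>t. app (exp (t *\<^sub>R endo (inf_temp_gen T Th))) X) \<longlongrightarrow> csc (ctrace X / of_nat CARD('n set)) (mat 1)) at_top"
proof -
  define N where "N = real CARD('n set)"
  have N: "0 < N" by (simp add: N_def zero_less_card_finite)
  define Pr :: "'n fockop \<Rightarrow> 'n fockop" where "Pr X = csc (ctrace X / of_real N) (mat 1)" for X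
  define A where "A X = inf_temp_gen T Th X - Pr X" for X
  have lPr: "linear Pr" unfolding Pr_def
    by (rule linear_csc_iff) (simp_all add: mat_simps add_divide_distrib)
  have lA: "linear A" unfolding A_def by (rule linear_compose_sub[OF linear_inf_temp_gen lPr])
  note app_simps = app_endo[OF linear_inf_temp_gen] app_endo[OF lPr] app_endo[OF lA]
  have form: "X \<bullet> A X = - (1/4) * (\<Sum>j\<in>UNIV. (norm (gcomm (fa (column j Th)) X))\<^sup>2
     + (norm (gcomm (cadj (fa (column j Th))) X))\<^sup>2) - (cmod (ctrace X))\<^sup>2 / N" for X
  proof -
    have "X \<bullet> Pr X = (cmod (ctrace X))\<^sup>2 / N"
      unfolding cmod_power2
      by (simp add: inner_cmat Pr_def mat_simps power2_eq_square add_divide_distrib)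
    thus ?thesis by (simp add: A_def inner_diff_right inner_inf_temp_gen[OF assms(1)])
  qed
  have zero: "ctrace X = 0 \<and> (\<forall>j. gcomm (fa (column j Th)) X = 0 \<and> gcomm (cadj (fa (column j Th))) X = 0)"
    if "X \<bullet> A X = 0" for X
  proof -
    define F where "F j = (norm (gcomm (fa (column j Th)) X))\<^sup>2 + (norm (gcomm (cadj (fa (column j Th))) X))\<^sup>2" for j
    have F: "0 \<le> F j" for j by (simp add: F_def)
    have "0 \<le> sum F UNIV" by (simp add: F sum_nonneg)
    moreover have "0 \<le> (cmod (ctrace X))\<^sup>2 / N" using N by simp
    ultimately have "sum F UNIV = 0" "(cmod (ctrace X))\<^sup>2 / N = 0"
      using form[of X] that unfolding F_def by linarith+
    thus ?thesis using N F by (simp add: sum_nonneg_eq_0_iff F_def add_nonneg_eq_0_iff)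
  qed
  have lim0: "((\<lambda>t. app (exp (t *\<^sub>R endo A)) X) \<longlongrightarrow> 0) at_top" for X
  proof (rule app_exp_dissipative_tendsto_0)
    fix X show "X \<bullet> app (endo A) X \<le> 0"
    proof -
      have "0 \<le> (\<Sum>j\<in>UNIV. (norm (gcomm (fa (column j Th)) X))\<^sup>2 + (norm (gcomm (cadj (fa (column j Th))) X))\<^sup>2)"
        by (simp add: sum_nonneg)
      moreover have "0 \<le> (cmod (ctrace X))\<^sup>2 / N" using N by simp
      ultimately show ?thesis unfolding app_simps form by linarith
    qed
  next
    fix y assume "\<And>k. app (endo A ^ k) y \<bullet> app (endo A) (app (endo A ^ k) y) = 0"
    hence y0: "app (endo A ^ k) y \<bullet> A (app (endo A ^ k) y) = 0" for k by (simp add: app_simps)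
    define Y where "Y k = app (endo A ^ k) y" for k
    note Yz = zero[OF y0, folded Y_def]
    define H where "H = sys_ham T"
    have Hp: "par H = H" by (simp add: H_def par_sys_ham)
    have YS: "Y (Suc k) = csc (- \<i>) (commutator H (Y k))" for k
    proof -
      have "Y (Suc k) = A (Y k)" by (simp add: Y_def app_simps)
      also have "\<dots> = inf_temp_gen T Th (Y k)" using Yz[of k] by (simp add: A_def Pr_def mat_simps)
      also have "\<dots> = csc (- \<i>) (commutator H (Y k))"
        using Yz[of k] by (simp add: inf_temp_gen_def H_def mat_simps)
      finally show ?thesis .
    qed
    \<comment> \<open>A graded commutator vanishing along the whole orbit still vanishes after
      \<open>c\<close> is replaced by its commutator with \<open>H\<close>; this carries the
      property from the columns of \<open>Th\<close> to all Krylov vectors.\<close>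
    have step: "gcomm (commutator H c) (Y k) = 0" if "\<And>k. gcomm c (Y k) = 0" for c k
    proof -
      have "csc \<i> (gcomm c (Y (Suc k))) = gcomm c (commutator H (Y k))"
        unfolding YS by (simp add: mat_simps)
      hence "gcomm c (commutator H (Y k)) = 0" by (simp add: that mat_simps)
      thus ?thesis using commutator_gcomm[OF Hp, of c "Y k"] that[of k] by (simp add: mat_simps)
    qed
    have "gcomm (fa (mpow T p *v column j Th)) (Y k) = 0 \<and> gcomm (cadj (fa (mpow T p *v column j Th))) (Y k) = 0" for p j k
    proof (induction p arbitrary: k)
      case 0 show ?case using Yz[of k] by (simp add: mpow_def)
    next
      case (Suc p)
      show ?case
        using step[of "fa (mpow T p *v column j Th)" k] step[of "cadj (fa (mpow T p *v column j Th))" k] Suc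
        by (simp add: mpow_Suc' H_def commutator_sys_ham_fa commutator_sys_ham_cadj_fa[OF assms(1)]
            hermitianD[OF assms(1)] matrix_vector_mul_assoc mat_simps)
    qed
    from this[of _ _ 0] have "mpow T k *v column j Th \<in> {f. gcomm (fa f) y = 0 \<and> gcomm (cadj (fa f)) y = 0}" for k j
      by (simp add: Y_def)
    moreover have "vec.subspace {f. gcomm (fa f) y = 0 \<and> gcomm (cadj (fa f)) y = 0}"
      unfolding vec.subspace_def by (simp add: fa_simps mat_simps)
    ultimately have "{f. gcomm (fa f) y = 0 \<and> gcomm (cadj (fa f)) y = 0} = UNIV"
      by (intro krylov_span_subset[OF assms(2)])
    hence "gcomm (fa f) y = 0" "gcomm (cadj (fa f)) y = 0" for f by auto
    from this[of "axis _ 1"] have "gcomm (annih i) y = 0" "gcomm (creat i) y = 0" for i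
      by (simp_all add: fa_axis)
    from gcomm_kernel_scalar[OF this] show "y = 0"
      using Yz[of 0] by (simp add: Y_def mat_simps)
  qed
  \<comment> \<open>The projection onto traceless operators intertwines the damped evolution with
    the original one.\<close>
  define M where "M X = X - Pr X" for X
  have lM: "linear M" unfolding M_def using linear_compose_sub[OF linear_id lPr] by (simp add: id_def)
  have Pr2: "Pr (Pr X) = Pr X" "inf_temp_gen T Th (Pr X) = 0" "Pr (inf_temp_gen T Th X) = 0" for X
    using N by (simp_all add: Pr_def mat_simps ctrace_one N_def inf_temp_gen_one ctrace_inf_temp_gen zero_less_card_finite)
  have inter: "M (app (exp (t *\<^sub>R endo A)) X) = app (exp (t *\<^sub>R endo (inf_temp_gen T Th))) (M X)" for t X
  proof (rule app_exp_intertwine[OF lM])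
    fix X
    have "M (A X) = inf_temp_gen T Th (M X)"
      by (simp add: M_def A_def linear_diff[OF lPr] linear_diff[OF linear_inf_temp_gen] Pr2)
    thus "M (app (t *\<^sub>R endo A) X) = app (t *\<^sub>R endo (inf_temp_gen T Th)) (M X)"
      by (simp add: app.scaleR_left app_simps linear_scale[OF lM])
  qed
  have "app (exp (t *\<^sub>R endo (inf_temp_gen T Th))) X = M (app (exp (t *\<^sub>R endo A)) X) + Pr X" for t
  proof -
    have "app (exp (t *\<^sub>R endo (inf_temp_gen T Th))) (Pr X) = Pr X"
      by (rule app_exp_fixed) (simp add: app.scaleR_left app_simps Pr2)
    thus ?thesis unfolding inter by (simp add: M_def app.diff_right)
  qed
  moreover have "((\<lambda>t. M (app (exp (t *\<^sub>R endo A)) X) + Pr X) \<longlongrightarrow> M 0 + Pr X) at_top"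
    using lM by (intro tendsto_intros bounded_linear.tendsto[OF _ lim0]) (simp add: linear_conv_bounded_linear)
  ultimately show ?thesis by (simp add: linear_0[OF lM] Pr_def N_def)
qed

section \<open>Observability and the Lyapunov equation\<close>

lemma cadj_apply_nth: "(cadj A *v x) $ j = cinner (column j A) x"
  by (simp add: matrix_vector_nth cinner_def column_def)

lemma orthogonal_krylov_imp_zero:
  assumes "krylov_span T Th = UNIV" "\<And>k j. cinner u (mpow T k *v column j Th) = 0"
  shows "u = 0"
proof -
  have "vec.subspace {x. cinner u x = 0}" unfolding vec.subspace_def by simp
  from krylov_span_subset[OF assms(1) this] assms(2) have "{x. cinner u x = 0} = UNIV" by simp
  hence "cinner u u = 0" by blast
  thus ?thesis by simp
qed

text \<open>The orthogonal complement of the Krylov space is invariant under the Hermitian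
  \<open>T\<close> and lies in the kernel of \<open>cadj Th\<close>; if it is nonzero, it contains
  an eigenvector.\<close>

lemma krylov_span_UNIV_iff:
  fixes T :: "complex^'n^'n" and Th :: "complex^'m^'n"
  assumes "hermitian T"
  shows "krylov_span T Th = UNIV \<longleftrightarrow> \<not> (\<exists>v c. v \<noteq> 0 \<and> T *v v = c *s v \<and> cadj Th *v v = 0)"
proof (intro iffI notI)
  assume K: "krylov_span T Th = UNIV" and "\<exists>v c. v \<noteq> 0 \<and> T *v v = c *s v \<and> cadj Th *v v = 0"
  then obtain v c where v: "v \<noteq> 0" "T *v v = c *s v" "cadj Th *v v = 0" by blast
  have "cinner v (mpow T k *v column j Th) = 0" for k j
  proof (induction k)
    case 0
    have "cinner (column j Th) v = 0" using v(3) by (simp add: cadj_apply_nth[symmetric])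
    thus ?case by (simp add: mpow_def cinner_commute[of v])
  next
    case (Suc k)
    thus ?case
      by (simp add: mpow_Suc' matrix_vector_mul_assoc[symmetric] cinner_cadj' hermitianD[OF assms] v matrix_vector_smult)
  qed
  from orthogonal_krylov_imp_zero[OF K this] v(1) show False by simp
next
  assume nex: "\<not> (\<exists>v c. v \<noteq> 0 \<and> T *v v = c *s v \<and> cadj Th *v v = 0)"
  show "krylov_span T Th = UNIV"
  proof (rule ccontr)
    let ?K = "krylov_span T Th"
    assume "?K \<noteq> UNIV"
    have sub: "vec.subspace ?K" unfolding krylov_span_def by (rule vec.subspace_span)
    have generator: "(mpow T k ** Th) *v x \<in> ?K" for k x
      unfolding krylov_span_def by (rule vec.span_base) blast
    have TK: "T *v x \<in> ?K" if "x \<in> ?K" for x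
      using that unfolding krylov_span_def
    proof (rule vec.span_induct)
      show "vec.subspace {x. T *v x \<in> vec.span (\<Union>k. range ((*v) (mpow T k ** Th)))}"
        using sub unfolding vec.subspace_def krylov_span_def
        by (auto simp: matrix_vector_right_distrib matrix_vector_smult)
      fix x assume "x \<in> (\<Union>k. range ((*v) (mpow T k ** Th)))"
      then obtain k y where "x = (mpow T k ** Th) *v y" by blast
      hence "T *v x = (mpow T (Suc k) ** Th) *v y"
        by (simp add: mpow_Suc' matrix_vector_mul_assoc matrix_mul_assoc)
      thus "T *v x \<in> vec.span (\<Union>k. range ((*v) (mpow T k ** Th)))"
        using generator[of "Suc k" y] unfolding krylov_span_def by simp
    qed
    define S where "S = {u. \<forall>x\<in>?K. cinner x u = 0}"
    obtain w where "w \<noteq> 0" "\<And>x. x \<in> ?K \<Longrightarrow> cinner x w = 0"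
      using exists_orthogonal_to_proper_subspace[OF sub \<open>?K \<noteq> UNIV\<close>] by blast
    hence "S \<noteq> {0}" unfolding S_def by auto
    moreover have "vec.subspace S" unfolding vec.subspace_def S_def by simp
    moreover have "T *v u \<in> S" if "u \<in> S" for u
      using that TK unfolding S_def by (simp add: cinner_cadj' hermitianD[OF assms])
    ultimately obtain v c where v: "v \<in> S" "cinner v v = 1" "T *v v = complex_of_real c *s v"
      using hermitian_eigenvector_in_subspace[OF assms] by metis
    have "cinner (Th *v y) v = 0" for y
      using v(1) generator[of 0 y] unfolding S_def by (simp add: mpow_def)
    hence "cinner y (cadj Th *v v) = 0" for y by (simp add: cinner_cadj)
    from this[of "cadj Th *v v"] have "cadj Th *v v = 0" by simp
    moreover have "v \<noteq> 0" using v(2) by auto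
    ultimately show False using nex v(3) by blast
  qed
qed

lemma cadj_drift: "hermitian T \<Longrightarrow> cadj (drift T Th) = csc \<i> T - csc (1/2) (Th ** cadj Th)"
  by (simp add: drift_def mat_simps hermitianD)

text \<open>An eigenspace of \<open>C\<close> with eigenvalue outside the bound would be annihilated by \<open>Th\<^sup>*\<close>
  and invariant under \<open>T\<close>.\<close>

lemma lyapunov_eigenvalue_bound:
  fixes T C :: "complex^'n^'n" and Th :: "complex^'m^'n"
  assumes T: "hermitian T" and K: "krylov_span T Th = UNIV" and C: "hermitian C"
    and eq: "drift T Th ** C + C ** cadj (drift T Th) = - (Th ** Z ** cadj Th)"
    and Z: "\<And>y. \<bar>Re (cinner y (Z *v y))\<bar> \<le> r * (norm y)\<^sup>2"
    and u: "C *v u = complex_of_real p *s u" "u \<noteq> 0"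
  shows "\<bar>p\<bar> \<le> r"
proof (rule ccontr)
  assume p: "\<not> \<bar>p\<bar> \<le> r"
  define W where "W = drift T Th"
  have Wv: "W *v w = (- \<i>) *s (T *v w) - (1/2) *s (Th *v (cadj Th *v w))"
    "cadj W *v w = \<i> *s (T *v w) - (1/2) *s (Th *v (cadj Th *v w))" for w
    unfolding W_def cadj_drift[OF T] unfolding drift_def
    by (simp_all add: matrix_vector_mult_diff_rdistrib csc_matrix_vector matrix_vector_mul_assoc)
  have eqv: "W *v (C *v w) + C *v (cadj W *v w) = - (Th *v (Z *v (cadj Th *v w)))" for w
    using arg_cong[OF eq, of "\<lambda>M. M *v w"]
    by (simp add: W_def matrix_vector_mult_add_rdistrib matrix_vector_mul_assoc matrix_mul_assoc matrix_vector_uminus)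
  have ker: "cadj Th *v w = 0" if w: "C *v w = complex_of_real p *s w" for w
  proof -
    define y where "y = cadj Th *v w"
    \<comment> \<open>Pairing the equation with the eigenvector turns its left side into
      \<open>- p\<close> times the squared norm of \<open>y\<close>, and its right side into minus
      the form of \<open>Z\<close> at \<open>y\<close>.\<close>
    have "cinner w (W *v (C *v w) + C *v (cadj W *v w)) = complex_of_real p * (cinner w (W *v w) + cinner w (cadj W *v w))"
      by (simp add: w matrix_vector_smult cinner_cadj'[of w C] hermitianD[OF C] distrib_left)
    also have "cinner w (W *v w) + cinner w (cadj W *v w) = - cinner w (Th *v y)"
      unfolding Wv y_def by simp
    also have "cinner w (Th *v y) = cinner y y" by (simp add: cinner_cadj' y_def)
    finally have "complex_of_real p * cinner y y = cinner w (Th *v (Z *v y))"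
      unfolding eqv y_def by simp
    also have "\<dots> = cinner y (Z *v y)" by (simp add: cinner_cadj'[of w] y_def)
    finally have "Re (cinner y (Z *v y)) = p * (norm y)\<^sup>2"
      by (metis Re_complex_of_real cinner_self of_real_mult)
    hence "\<bar>p\<bar> * (norm y)\<^sup>2 \<le> r * (norm y)\<^sup>2" using Z[of y] by (simp add: abs_mult)
    hence "y = 0" using p by (simp add: mult_le_cancel_right)
    thus ?thesis by (simp add: y_def)
  qed
  have "C *v (mpow T k *v u) = complex_of_real p *s (mpow T k *v u)" for k
  proof (induction k)
    case 0 show ?case using u by (simp add: mpow_def)
  next
    case (Suc k)
    define w where "w = mpow T k *v u"
    have w: "C *v w = complex_of_real p *s w" using Suc by (simp add: w_def)
    \<comment> \<open>With \<open>cadj Th *v w = 0\<close> only the Hamiltonian part of the equation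
      is left, and it makes \<open>T *v w\<close> satisfy the eigenvalue equation for the same
      \<open>p\<close>.\<close>
    have "complex_of_real p *s (W *v w) + C *v (cadj W *v w) = 0"
      using eqv[of w] by (simp add: ker[OF w] w matrix_vector_smult)
    hence "\<i> *s (C *v (T *v w)) = \<i> *s (complex_of_real p *s (T *v w))"
      by (simp add: Wv ker[OF w] matrix_vector_smult vec_eq_iff algebra_simps add_eq_0_iff)
    hence "C *v (T *v w) = complex_of_real p *s (T *v w)" by (simp add: vec_eq_iff)
    thus ?case by (simp add: mpow_Suc' w_def matrix_vector_mul_assoc)
  qed
  from ker[OF this] have k0: "cadj Th *v (mpow T k *v u) = 0" for k .
  have cm: "cadj (mpow T k) = mpow T k" for k
    by (induction k) (simp add: mpow_def mat_simps, metis T cadj_mult hermitianD mpow_Suc mpow_Suc')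
  have "cinner u (mpow T k *v column j Th) = 0" for k j
  proof -
    have "cinner u (mpow T k *v column j Th) = cinner (mpow T k *v u) (column j Th)"
      by (simp add: cinner_cadj' cm)
    also have "\<dots> = cnj ((cadj Th *v (mpow T k *v u)) $ j)"
      unfolding cadj_apply_nth by (rule cinner_commute)
    finally show ?thesis by (simp add: k0)
  qed
  from orthogonal_krylov_imp_zero[OF K this] u(2) show False by simp
qed

text \<open>In finite dimension it suffices that the Lyapunov map is injective, and this is the
  eigenvalue bound with right-hand side zero. The map commutes with taking adjoints, so the solution
  for Hermitian data is Hermitian.\<close>

lemma lyapunov_solution:
  fixes T :: "complex^'n^'n" and Th :: "complex^'m^'n"
  assumes T: "hermitian T" and K: "krylov_span T Th = UNIV" and "hermitian Z"
  obtains C where "hermitian C" "drift T Th ** C + C ** cadj (drift T Th) = - (Th ** Z ** cadj Th)"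
proof -
  define f where "f C = drift T Th ** C + C ** cadj (drift T Th)" for C
  have f_add: "f (C + D) = f C + f D" and f_csc: "f (csc z C) = csc z (f C)" for C D z
    by (simp_all add: f_def mat_simps)
  have lf: "linear f" by (rule linear_csc_iff) (simp_all add: f_add f_csc)
  have f_adj: "f (cadj C) = cadj (f C)" for C by (simp add: f_def mat_simps add.commute)
  have herm: "C = 0" if h: "hermitian C" "f C = 0" for C
  proof -
    obtain u :: "'n \<Rightarrow> complex^'n" and d where ud: "\<And>i j. cinner (u i) (u j) = (if i = j then 1 else 0)"
      "\<And>i. C *v u i = complex_of_real (d i) *s u i"
      by (rule hermitian_orthonormal_eigenvectors[OF h(1)]) blast
    have "d i = 0" for i
    proof -
      have "\<bar>d i\<bar> \<le> 0"
      proof (rule lyapunov_eigenvalue_bound[OF T K h(1), of 0])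
        show "drift T Th ** C + C ** cadj (drift T Th) = - (Th ** 0 ** cadj Th)"
          using h(2) by (simp add: f_def mat_simps)
        show "u i \<noteq> 0" using ud(1)[of i i] by auto
      qed (simp_all add: ud)
      thus ?thesis by simp
    qed
    thus ?thesis using hermitian_spectral[OF ud] by (intro mat_eqI) simp
  qed
  have inj0: "C = 0" if "f C = 0" for C
  proof -
    \<comment> \<open>The kernel is closed under adjoints, so it is enough to treat the Hermitian
      matrices \<open>C + cadj C\<close> and \<open>csc \<i> (C - cadj C)\<close>.\<close>
    have "C + cadj C = 0"
      by (rule herm) (simp_all add: hermitian_def mat_simps add.commute f_add f_adj that)
    moreover have "csc \<i> (C - cadj C) = 0"
    proof (rule herm)
      show "hermitian (csc \<i> (C - cadj C))" by (simp add: hermitian_def mat_simps)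
      show "f (csc \<i> (C - cadj C)) = 0"
        by (simp add: f_csc linear_diff[OF lf] f_adj that mat_simps)
    qed
    hence "csc (- \<i>) (csc \<i> (C - cadj C)) = 0" by (simp add: mat_simps)
    hence "C - cadj C = 0" by (simp only: csc_simps(7)) (simp add: csc_simps)
    ultimately have "2 *\<^sub>R C = 0" by (simp add: scaleR_2)
    thus ?thesis by simp
  qed
  have inj: "inj f"
    by (rule injI) (metis inj0 lf linear_diff right_minus_eq)
  from linear_injective_imp_surjective[OF lf this] obtain C where C: "f C = - (Th ** Z ** cadj Th)"
    by (metis surjD)
  have "f (cadj C) = f C"
    by (simp add: f_adj C mat_simps hermitianD[OF assms(3)] matrix_mul_assoc)
  hence "cadj C = C" using inj by (simp add: inj_eq)
  thus ?thesis using that C by (simp add: hermitian_def f_def)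
qed

section \<open>Reduction of the generator\<close>

lemma kron_mult:
  fixes A :: "complex^'c^'r" and B :: "complex^'d^'s" and C :: "complex^'e^'c" and D :: "complex^'f^'d"
  shows "kron A B ** kron C D = kron (A ** C) (B ** D)"
  by (rule mat_eqI)
     (simp add: matrix_mult_nth kron_def sum_product UNIV_Times_UNIV[symmetric] sum.cartesian_product
        case_prod_beta algebra_simps del: UNIV_Times_UNIV)

lemma kron_simps [mat_simps]:
  "kron (A + A') B = kron A B + kron A' B" "kron A (B + B') = kron A B + kron A B'"
  "kron (csc z A) B = csc z (kron A B)" "kron A (csc z B) = csc z (kron A B)"
  "cadj (kron A B) = kron (cadj A) (cadj B)" "kron 0 B = 0"
  by (rule mat_eqI; simp add: kron_def algebra_simps)+

lemma kron_sum: "kron (\<Sum>i\<in>I. f i) B = (\<Sum>i\<in>I. kron (f i) B)"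
  by (induction I rule: infinite_finite_induct) (auto simp: mat_simps)

lemma ptrace_B_kron: "ptrace_B (kron A B) = csc (ctrace B) A"
  by (rule mat_eqI) (simp add: ptrace_B_def kron_def ctrace_def sum_distrib_left mult.commute)

lemma ptrace_B_sum: "ptrace_B (\<Sum>i\<in>I. f i) = (\<Sum>i\<in>I. ptrace_B (f i))"
proof -
  have "ptrace_B (X + Y) = ptrace_B X + ptrace_B Y" for X Y :: "complex^('a \<times> 'b)^('a \<times> 'b)"
    by (rule mat_eqI) (simp add: ptrace_B_def sum.distrib)
  moreover have "ptrace_B 0 = (0 :: complex^'a^'a)"
    by (rule mat_eqI) (simp add: ptrace_B_def)
  ultimately show ?thesis by (induction I rule: infinite_finite_induct) auto
qed

lemma ptrace_B_sandwich:
  fixes A :: "'s::finite \<Rightarrow> complex^'a^'a" and B :: "'s \<Rightarrow> complex^'b^'b"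
  assumes "V = (\<Sum>s\<in>UNIV. kron (A s) (B s))"
  shows "ptrace_B (V ** kron \<rho> \<omega> ** V)
      = (\<Sum>s\<in>UNIV. \<Sum>t\<in>UNIV. csc (ctrace (B s ** \<omega> ** B t)) (A s ** \<rho> ** A t))"
    and "ptrace_B (V ** kron (mat 1) (mat 1) ** V ** kron (mat 1) \<omega>)
      = (\<Sum>s\<in>UNIV. \<Sum>t\<in>UNIV. csc (ctrace (B s ** B t ** \<omega>)) (A s ** A t))"
proof -
  have "V ** kron X Y ** V ** kron Z W =
      (\<Sum>s\<in>UNIV. \<Sum>t\<in>UNIV. kron (A s ** X ** A t ** Z) (B s ** Y ** B t ** W))" for X Y Z W
    unfolding assms matrix_mult_sum_left matrix_mult_sum_right kron_mult by (rule sum.swap)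
  note * = this
  have "ptrace_B (V ** kron X Y ** V ** kron Z W) =
      (\<Sum>s\<in>UNIV. \<Sum>t\<in>UNIV. csc (ctrace (B s ** Y ** B t ** W)) (A s ** X ** A t ** Z))" for X Y Z W
    unfolding * ptrace_B_sum ptrace_B_kron ..
  note ** = this
  have one: "kron (mat 1) (mat 1) = (mat 1 :: complex^('a \<times> 'b)^('a \<times> 'b))"
    by (rule mat_eqI) (auto simp: kron_def mat_def prod_eq_iff)
  show "ptrace_B (V ** kron \<rho> \<omega> ** V)
      = (\<Sum>s\<in>UNIV. \<Sum>t\<in>UNIV. csc (ctrace (B s ** \<omega> ** B t)) (A s ** \<rho> ** A t))"
    using **[of \<rho> \<omega> "mat 1" "mat 1"] by (simp add: one)
  show "ptrace_B (V ** kron (mat 1) (mat 1) ** V ** kron (mat 1) \<omega>)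
      = (\<Sum>s\<in>UNIV. \<Sum>t\<in>UNIV. csc (ctrace (B s ** B t ** \<omega>)) (A s ** A t))"
    using **[of "mat 1" "mat 1" "mat 1" \<omega>] by simp
qed

section \<open>Two-point functions of the bath\<close>

lemma numop_mult_nth: "(numop ** X) $ S $ T = of_nat (card S) * X $ S $ T"
  "(X ** numop) $ S $ T = of_nat (card T) * X $ S $ T"
proof -
  have "numop $ S $ R * X $ R $ T = (if R = S then of_nat (card S) * X $ S $ T else 0)" for R
    by (simp add: numop_def)
  thus "(numop ** X) $ S $ T = of_nat (card S) * X $ S $ T" by (simp add: matrix_mult_nth)
  have "X $ S $ R * numop $ R $ T = (if R = T then of_nat (card T) * X $ S $ T else 0)" for R
    by (simp add: numop_def)
  thus "(X ** numop) $ S $ T = of_nat (card T) * X $ S $ T" by (simp add: matrix_mult_nth)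
qed

lemma commutator_numop_annih: "commutator numop (annih i) = - annih i"
  by (rule mat_eqI) (auto simp: commutator_def numop_mult_nth annih_nth algebra_simps)

lemma commutator_sum: "commutator H (\<Sum>i\<in>I. f i) = (\<Sum>i\<in>I. commutator H (f i))"
  by (induction I rule: infinite_finite_induct) (auto simp: mat_simps)

lemma commutator_numop_fa: "commutator numop (fa f) = - fa f"
  by (simp add: fa_def mat_simps commutator_sum commutator_numop_annih sum_negf)

lemma cadj_numop [simp]: "cadj numop = numop"
  by (rule mat_eqI) (simp add: numop_def)

text \<open>A number-conserving operator has matrix entries only between sets of equal size, where
  the two parity signs cancel.\<close>

lemma par_gauge_invariant:
  assumes "commutator numop \<omega> = 0" shows "par \<omega> = \<omega>"
proof (rule mat_eqI)
  fix S T :: "'a set"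
  have "of_nat (card S) * \<omega> $ S $ T = of_nat (card T) * \<omega> $ S $ T"
    using arg_cong[OF assms, of "\<lambda>M. M $ S $ T"] by (simp add: commutator_def numop_mult_nth)
  thus "par \<omega> $ S $ T = \<omega> $ S $ T"
    by (cases "card S = card T") (auto simp: par_nth power_mult_distrib[symmetric])
qed

lemma csc_2: "csc 2 A = A + A"
  by (rule mat_eqI) (simp only: csc_nth vector_add_component mult_2)

text \<open>Two annihilators lower the particle number by two, while \<open>\<omega>\<close>
  conserves it: moving \<open>numop\<close> once around the trace changes nothing, yet produces
  twice the value in question.\<close>

lemma ctrace_two_annih:
  assumes "commutator numop \<omega> = 0"
  shows "ctrace (annih j ** \<omega> ** annih k) = 0"
proof -
  let ?X = "annih k ** annih j"
  have N: "numop ** annih i = annih i ** numop - annih i" for i :: 'a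
    using commutator_numop_annih[of i] by (simp add: commutator_def algebra_simps)
  have "numop ** ?X = ?X ** numop - csc 2 ?X"
    by (simp add: csc_2 matrix_mul_assoc N mat_simps) (simp add: matrix_mul_assoc[symmetric] N mat_simps)
  hence "ctrace (numop ** ?X ** \<omega>) = ctrace (?X ** (numop ** \<omega>)) - 2 * ctrace (?X ** \<omega>)"
    by (simp add: mat_simps matrix_mul_assoc)
  also have "numop ** \<omega> = \<omega> ** numop" using assms by (simp add: commutator_def)
  also have "ctrace (?X ** (\<omega> ** numop)) = ctrace (numop ** ?X ** \<omega>)"
    by (simp add: matrix_mul_assoc ctrace_commute[of _ numop])
  finally have "ctrace (?X ** \<omega>) = 0" by simp
  thus ?thesis by (simp add: ctrace_commute[of _ "annih k"] matrix_mul_assoc)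
qed

lemma ctrace_two_creat:
  assumes "commutator numop \<omega> = 0" "hermitian \<omega>"
  shows "ctrace (creat j ** \<omega> ** creat k) = 0"
proof -
  have "cnj (ctrace (annih k ** \<omega> ** annih j)) = ctrace (cadj (annih k ** \<omega> ** annih j))" by simp
  also have "\<dots> = ctrace (creat j ** \<omega> ** creat k)"
    by (simp only: cadj_mult cadj_annih hermitianD[OF assms(2)]) (simp add: matrix_mul_assoc)
  finally show ?thesis using ctrace_two_annih[OF assms(1)] by simp
qed

text \<open>The one-particle density matrix: by cyclicity the entry \<open>(j,k)\<close> is the
  expectation of \<open>creat k ** annih j\<close>.\<close>

definition covariance :: "'m::{finite,linorder} fockop \<Rightarrow> ((complex, 'm) vec, 'm) vec" where
  "covariance \<omega> = (\<chi> j k. ctrace (annih j ** \<omega> ** creat k))"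

lemma ctrace_creat_annih:
  assumes "ctrace \<omega> = 1"
  shows "ctrace (creat j ** \<omega> ** annih k) = (if j = k then 1 else 0) - covariance \<omega> $ k $ j"
proof -
  have "annih k ** creat j = (if k = j then mat 1 else 0) - creat j ** annih k"
    using annih_creat[of k j] by (simp add: algebra_simps)
  hence "ctrace (annih k ** creat j ** \<omega>) = (if j = k then 1 else 0) - ctrace (creat j ** annih k ** \<omega>)"
    using assms by (auto simp: mat_simps)
  moreover have "ctrace (creat j ** \<omega> ** annih k) = ctrace (annih k ** creat j ** \<omega>)"
    by (simp add: ctrace_commute[of _ "annih k"] matrix_mul_assoc)
  moreover have "ctrace (annih k ** \<omega> ** creat j) = ctrace (creat j ** annih k ** \<omega>)"
    by (simp add: ctrace_commute[of _ "creat j"] matrix_mul_assoc)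
  ultimately show ?thesis by (simp add: covariance_def)
qed

text \<open>Quantum jumps: particles enter the system with rate matrix \<open>G\<close> and leave it
  with the complementary rates; \<open>damping\<close> is the corresponding total rate.\<close>

definition dissip :: "((complex, 'm::{finite,linorder}) vec, 'm) vec \<Rightarrow> ((complex, 'm) vec, 'n::{finite,linorder}) vec \<Rightarrow> 'n fockop \<Rightarrow> 'n fockop" where
  "dissip G Th X = (\<Sum>j\<in>UNIV. \<Sum>k\<in>UNIV.
     csc (G $ j $ k) (cadj (fa (column j Th)) ** X ** fa (column k Th))
   + csc ((if j = k then 1 else 0) - G $ j $ k) (fa (column k Th) ** X ** cadj (fa (column j Th))))"

definition damping :: "((complex, 'm::{finite,linorder}) vec, 'm) vec \<Rightarrow> ((complex, 'm) vec, 'n::{finite,linorder}) vec \<Rightarrow> 'n fockop" where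
  "damping G Th = (\<Sum>j\<in>UNIV. \<Sum>k\<in>UNIV.
     csc (G $ j $ k) (fa (column k Th) ** cadj (fa (column j Th)))
   + csc ((if j = k then 1 else 0) - G $ j $ k) (cadj (fa (column j Th)) ** fa (column k Th)))"

lemma fa_column: "fa (column j Th) = (\<Sum>i\<in>UNIV. csc (cnj (Th $ i $ j)) (annih i))"
  by (simp add: fa_def column_def)

lemma cadj_fa_column: "cadj (fa (column j Th)) = (\<Sum>i\<in>UNIV. csc (Th $ i $ j) (creat i))"
  by (simp add: cadj_fa column_def)

text \<open>Index \<open>(True, j)\<close> carries the terms \<open>c\<^sup>S\<^sup>* c\<^sup>B\<^sub>j\<close> of the interaction, \<open>(False, j)\<close> their adjoints.\<close>

definition sys_part :: "bool \<Rightarrow> ((complex, 'm::{finite,linorder}) vec, 'n::{finite,linorder}) vec \<Rightarrow> bool \<times> 'm \<Rightarrow> 'n fockop" where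
  "sys_part sb Th s = (let a = fa (column (snd s) Th) in
     if fst s then (if sb then cadj a ** parity else cadj a) else (if sb then parity ** a else a))"

definition bath_part :: "bool \<Rightarrow> bool \<times> 'm::{finite,linorder} \<Rightarrow> 'm fockop" where
  "bath_part sb s = (if fst s then (if sb then annih (snd s) else parity ** annih (snd s))
     else (if sb then creat (snd s) else creat (snd s) ** parity))"

lemma sum_bool_prod: "(\<Sum>s\<in>UNIV. f s) = (\<Sum>j\<in>UNIV. f (True, j) + f (False, j))"
  for f :: "bool \<times> 'm::finite \<Rightarrow> 'a::comm_monoid_add"
proof -
  have "(\<Sum>s\<in>UNIV. f s) = (\<Sum>b\<in>UNIV. \<Sum>j\<in>UNIV. f (b, j))"
    by (simp add: sum.cartesian_product)
  thus ?thesis by (simp add: UNIV_bool sum.distrib add.commute)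
qed

lemma interaction_eq:
  fixes Th :: "((complex, 'm::{finite,linorder}) vec, 'n::{finite,linorder}) vec"
  shows "interaction sb Th = (\<Sum>s\<in>UNIV. kron (sys_part sb Th s) (bath_part sb s))"
proof -
  have 1: "kron (sys_part sb Th (True, j)) (bath_part sb (True, j))
      = (\<Sum>i\<in>UNIV. csc (Th $ i $ j) (cadj (sysannih sb i) ** bathannih sb j))" for j
    by (cases sb)
       (simp_all add: sys_part_def bath_part_def cadj_fa_column matrix_mult_sum_left kron_sum
          sysannih_def bathannih_def mat_simps kron_mult)
  have 2: "kron (sys_part sb Th (False, j)) (bath_part sb (False, j))
      = (\<Sum>i\<in>UNIV. csc (cnj (Th $ i $ j)) (cadj (bathannih sb j) ** sysannih sb i))" for j
    by (cases sb)
       (simp_all add: sys_part_def bath_part_def fa_column matrix_mult_sum_right kron_sum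
          sysannih_def bathannih_def mat_simps kron_mult)
  show ?thesis
    unfolding sum_bool_prod 1 2 interaction_def sum.distrib by (intro arg_cong2[where f = "(+)"] sum.swap)
qed

text \<open>The embeddings differ in which factor carries the parity. For \<open>E_SB\<close> it
  stays on the system and turns \<open>\<rho>\<close> into \<open>par \<rho>\<close>; for
  \<open>E_BS\<close> it meets the bath state, which is even, and drops out. Gauge invariance
  removes the terms with two bath annihilators or two bath creators.\<close>

lemma
  fixes Th :: "((complex, 'm::{finite,linorder}) vec, 'n::{finite,linorder}) vec" and \<omega> :: "'m fockop"
  assumes "is_state \<omega>" "commutator numop \<omega> = 0"
  shows Phi_star_eq: "Phi_star sb Th \<omega> \<rho> = dissip (covariance \<omega>) Th (if sb then par \<rho> else \<rho>)"
    and Phi_one_eq: "Phi sb Th \<omega> (mat 1) = damping (covariance \<omega>) Th"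
proof -
  have h: "hermitian \<omega>" and tr: "ctrace \<omega> = 1" using assms(1) by (auto simp: is_state_def psd_def)
  have pw: "par \<omega> = \<omega>" by (rule par_gauge_invariant[OF assms(2)])
  let ?A = "sys_part sb Th" and ?B = "bath_part sb :: bool \<times> 'm \<Rightarrow> _"
  have pp: "parity ** annih j ** \<omega> ** parity = - (annih j ** \<omega>)" for j
  proof -
    have "parity ** annih j ** \<omega> ** parity = par (annih j ** \<omega>)" by (simp add: par_def matrix_mul_assoc)
    thus ?thesis by (simp add: mat_simps par_annih pw)
  qed
  have B: "ctrace (?B (True, j) ** \<omega> ** ?B (True, k)) = 0"
    "ctrace (?B (False, j) ** \<omega> ** ?B (False, k)) = 0"
    "ctrace (?B (True, j) ** \<omega> ** ?B (False, k)) = covariance \<omega> $ j $ k"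
    "ctrace (?B (False, j) ** \<omega> ** ?B (True, k)) = (if j = k then 1 else 0) - covariance \<omega> $ k $ j" for j k
  proof -
    have t1: "ctrace (parity ** annih j ** \<omega> ** (parity ** annih k)) = - ctrace (annih j ** \<omega> ** annih k)"
      by (simp add: matrix_mul_assoc pp mat_simps)
    have t2: "ctrace (creat j ** parity ** \<omega> ** (creat k ** parity)) = - ctrace (creat j ** \<omega> ** creat k)"
    proof -
      have "creat j ** parity ** \<omega> ** (creat k ** parity) = creat j ** par (\<omega> ** creat k)"
        by (simp add: par_def matrix_mul_assoc)
      thus ?thesis by (simp add: mat_simps par_creat pw matrix_mul_assoc)
    qed
    have t3: "ctrace (parity ** annih j ** \<omega> ** (creat k ** parity)) = ctrace (annih j ** \<omega> ** creat k)"
      using ctrace_par[of "annih j ** \<omega> ** creat k"] by (simp add: par_def matrix_mul_assoc)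
    have t4: "ctrace (creat j ** parity ** \<omega> ** (parity ** annih k)) = ctrace (creat j ** \<omega> ** annih k)"
    proof -
      have "creat j ** parity ** \<omega> ** (parity ** annih k) = creat j ** par \<omega> ** annih k"
        by (simp add: par_def matrix_mul_assoc)
      thus ?thesis by (simp add: pw)
    qed
    show "ctrace (?B (True, j) ** \<omega> ** ?B (True, k)) = 0"
      by (simp add: bath_part_def t1 ctrace_two_annih[OF assms(2)])
    show "ctrace (?B (False, j) ** \<omega> ** ?B (False, k)) = 0"
      by (simp add: bath_part_def t2 ctrace_two_creat[OF assms(2) h])
    show "ctrace (?B (True, j) ** \<omega> ** ?B (False, k)) = covariance \<omega> $ j $ k"
      by (simp add: bath_part_def t3 covariance_def)
    show "ctrace (?B (False, j) ** \<omega> ** ?B (True, k)) = (if j = k then 1 else 0) - covariance \<omega> $ k $ j"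
      by (cases sb) (simp_all add: bath_part_def t4 ctrace_creat_annih[OF tr] del: if_split)
  qed
  have B': "ctrace (?B s ** ?B t ** \<omega>) = ctrace (?B t ** \<omega> ** ?B s)" for s t
    using ctrace_commute[of "?B s" "?B t ** \<omega>"] by (simp add: matrix_mul_assoc)
  let ?a = "\<lambda>j. fa (column j Th)"
  let ?r = "if sb then par \<rho> else \<rho>"
  have A: "?A (True, j) ** \<rho> ** ?A (False, k) = cadj (?a j) ** ?r ** ?a k"
    "?A (False, j) ** \<rho> ** ?A (True, k) = ?a j ** ?r ** cadj (?a k)"
    "?A (True, j) ** ?A (False, k) = cadj (?a j) ** ?a k"
    "?A (False, j) ** ?A (True, k) = ?a j ** cadj (?a k)" for j k
  proof -
    have f: "parity ** ?a j ** \<rho> ** (cadj (?a k) ** parity) = par (?a j ** \<rho> ** cadj (?a k))"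
       "parity ** ?a j ** (cadj (?a k) ** parity) = par (?a j ** cadj (?a k))"
      by (simp_all add: par_def matrix_mul_assoc)
    have g: "cadj (?a j) ** parity ** \<rho> ** (parity ** ?a k) = cadj (?a j) ** par \<rho> ** ?a k"
      "cadj (?a j) ** parity ** (parity ** ?a k) = cadj (?a j) ** ?a k"
      by (simp_all add: par_def matrix_mul_assoc parity_cancel)
    show "?A (True, j) ** \<rho> ** ?A (False, k) = cadj (?a j) ** ?r ** ?a k"
      "?A (False, j) ** \<rho> ** ?A (True, k) = ?a j ** ?r ** cadj (?a k)"
      "?A (True, j) ** ?A (False, k) = cadj (?a j) ** ?a k"
      "?A (False, j) ** ?A (True, k) = ?a j ** cadj (?a k)"
      by (simp_all add: sys_part_def Let_def f g mat_simps par_fa par_cadj_fa)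
  qed
  have "Phi_star sb Th \<omega> \<rho> = (\<Sum>j\<in>UNIV. \<Sum>k\<in>UNIV. csc (covariance \<omega> $ j $ k) (cadj (?a j) ** ?r ** ?a k))
     + (\<Sum>j\<in>UNIV. \<Sum>k\<in>UNIV. csc ((if j = k then 1 else 0) - covariance \<omega> $ k $ j) (?a j ** ?r ** cadj (?a k)))"
    unfolding Phi_star_def ptrace_B_sandwich(1)[OF interaction_eq] sum_bool_prod B A
    by (simp add: csc_simps(8) sum.distrib del: if_split)
  also have "(\<Sum>j\<in>UNIV. \<Sum>k\<in>UNIV. csc ((if j = k then 1 else 0) - covariance \<omega> $ k $ j) (?a j ** ?r ** cadj (?a k)))
     = (\<Sum>j\<in>UNIV. \<Sum>k\<in>UNIV. csc ((if j = k then 1 else 0) - covariance \<omega> $ j $ k) (?a k ** ?r ** cadj (?a j)))"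
    by (subst sum.swap) (simp add: eq_commute)
  finally show "Phi_star sb Th \<omega> \<rho> = dissip (covariance \<omega>) Th (if sb then par \<rho> else \<rho>)"
    unfolding dissip_def sum.distrib .
  have "Phi sb Th \<omega> (mat 1) = (\<Sum>j\<in>UNIV. \<Sum>k\<in>UNIV. csc ((if k = j then 1 else 0) - covariance \<omega> $ j $ k) (cadj (?a j) ** ?a k))
     + (\<Sum>j\<in>UNIV. \<Sum>k\<in>UNIV. csc (covariance \<omega> $ k $ j) (?a j ** cadj (?a k)))"
    unfolding Phi_def ptrace_B_sandwich(2)[OF interaction_eq] B' sum_bool_prod B A
    by (simp add: csc_simps(8) sum.distrib del: if_split)
  also have "(\<Sum>j\<in>UNIV. \<Sum>k\<in>UNIV. csc (covariance \<omega> $ k $ j) (?a j ** cadj (?a k)))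
     = (\<Sum>j\<in>UNIV. \<Sum>k\<in>UNIV. csc (covariance \<omega> $ j $ k) (?a k ** cadj (?a j)))"
    by (subst sum.swap) simp
  finally show "Phi sb Th \<omega> (mat 1) = damping (covariance \<omega>) Th"
    unfolding damping_def sum.distrib by (simp add: add.commute eq_commute)
qed

definition quasi_free_gen :: "((complex, 'n::{finite,linorder}) vec, 'n) vec \<Rightarrow> ((complex, 'm::{finite,linorder}) vec, 'n) vec \<Rightarrow> ((complex, 'm) vec, 'm) vec \<Rightarrow> 'n fockop \<Rightarrow> 'n fockop" where
  "quasi_free_gen T Th Z X = inf_temp_gen T Th X + pair_op (Th ** Z ** cadj Th) X"

text \<open>With \<open>a\<close> annihilating and \<open>b\<close> creating, the product of graded
  multiplications is the gain term minus the loss term of Lindblad form;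
  \<open>inf_temp_gen_term\<close> supplies their sum.\<close>

lemma gain_loss_split:
  assumes "a ** b + b ** a = csc z (mat 1)" "par a = - a" "par b = - b"
  shows "gmult b (gmult a X) = (b ** par X ** a - csc (1/2) (a ** b ** X + X ** a ** b))
    - (a ** par X ** b - csc (1/2) (b ** a ** X + X ** b ** a))"
proof -
  have 1: "b ** a = csc z (mat 1) - a ** b" using assms(1) by (simp add: algebra_simps)
  have 2: "b ** a ** X = csc z X - a ** b ** X" "X ** b ** a = csc z X - X ** a ** b"
    by (simp_all add: matrix_mul_assoc[symmetric] 1 mat_simps)
  have m: "gmult b (gmult a X) = b ** a ** X + b ** par X ** a - a ** par X ** b - X ** a ** b"
    by (simp add: gmult_def mat_simps assms(2,3) matrix_mul_assoc)
  show ?thesis unfolding m 2 by (intro mat_eqI) (simp add: field_simps)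
qed

lemma inf_temp_gen_term:
  assumes "par a = - a" "par b = - b"
  shows "csc (1/4) (gmult b (gcomm a X) + gmult a (gcomm b X))
    = - csc (1/2) ((b ** par X ** a - csc (1/2) (a ** b ** X + X ** a ** b))
      + (a ** par X ** b - csc (1/2) (b ** a ** X + X ** b ** a)))"
proof -
  have m: "gmult b (gcomm a X) + gmult a (gcomm b X) = b ** a ** X + X ** a ** b + a ** b ** X + X ** b ** a
    - csc 2 (b ** par X ** a + a ** par X ** b)"
    unfolding csc_2 by (simp add: gmult_def gcomm_def assms mat_simps matrix_mul_assoc)
  show ?thesis unfolding m by (intro mat_eqI) (simp add: field_simps)
qed

lemma pair_op_sum: "pair_op (\<Sum>i\<in>I. f i) X = (\<Sum>i\<in>I. pair_op (f i) X)"
proof -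
  have "pair_op 0 X = 0" by (simp add: pair_op_def mat_simps)
  thus ?thesis by (induction I rule: infinite_finite_induct) (auto simp: mat_simps)
qed

lemma sandwich_eq_sum_outer:
  "Th ** Z ** cadj Th = (\<Sum>j\<in>UNIV. \<Sum>k\<in>UNIV. csc (Z $ j $ k) (outer (column j Th) (column k Th)))"
  by (rule mat_eqI)
     (simp add: matrix_mult_nth outer_def column_def sum_distrib_right sum_distrib_left, subst sum.swap, simp add: algebra_simps)

lemma quasi_free_gen_eq:
  "csc (- \<i>) (commutator (sys_ham T) X) + dissip G Th (par X) - csc (1/2) (anticommutator (damping G Th) X)
   = quasi_free_gen T Th (G - csc (1/2) (mat 1)) X"
proof -
  define U where "U j k = cadj (fa (column j Th)) ** par X ** fa (column k Th)
     - csc (1/2) (fa (column k Th) ** cadj (fa (column j Th)) ** X + X ** fa (column k Th) ** cadj (fa (column j Th)))" for j k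
  define V where "V j k = fa (column k Th) ** par X ** cadj (fa (column j Th))
     - csc (1/2) (cadj (fa (column j Th)) ** fa (column k Th) ** X + X ** cadj (fa (column j Th)) ** fa (column k Th))" for j k
  have lhs: "dissip G Th (par X) - csc (1/2) (anticommutator (damping G Th) X)
    = (\<Sum>j\<in>UNIV. \<Sum>k\<in>UNIV. csc (G $ j $ k) (U j k) + csc ((if j = k then 1 else 0) - G $ j $ k) (V j k))"
    unfolding dissip_def damping_def anticommutator_def matrix_mult_sum_left matrix_mult_sum_right csc_sum
      sum_subtractf[symmetric] sum.distrib[symmetric] U_def V_def
    by (intro sum.cong refl mat_eqI) (simp add: mat_simps matrix_mul_assoc field_simps)
  have q: "pair_op (Th ** Z ** cadj Th) X = (\<Sum>j\<in>UNIV. \<Sum>k\<in>UNIV. csc (Z $ j $ k) (U j k - V j k))" for Z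
    unfolding sandwich_eq_sum_outer pair_op_sum pair_op_simps pair_op_outer U_def V_def gain_loss_split[OF fa_cadj_fa par_fa par_cadj_fa] ..
  have "csc (1/4) (\<Sum>j\<in>UNIV.
     gmult (cadj (fa (column j Th))) (gcomm (fa (column j Th)) X)
     + gmult (fa (column j Th)) (gcomm (cadj (fa (column j Th))) X)) = - (\<Sum>j\<in>UNIV. csc (1/2) (U j j + V j j))"
    unfolding csc_sum inf_temp_gen_term[OF par_fa par_cadj_fa] sum_negf U_def V_def ..
  also have "(\<Sum>j\<in>UNIV. csc (1/2) (U j j + V j j)) = (\<Sum>j\<in>UNIV. \<Sum>k\<in>UNIV. csc (if j = k then 1/2 else 0) (U j k + V j k))"
  proof (intro sum.cong refl)
    fix j
    have "(\<Sum>k\<in>UNIV. csc (if j = k then 1/2 else 0) (U j k + V j k)) = (\<Sum>k\<in>UNIV. if j = k then csc (1/2) (U j k + V j k) else 0)"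
      by (intro sum.cong refl) (simp add: mat_simps)
    thus "csc (1/2) (U j j + V j j) = (\<Sum>k\<in>UNIV. csc (if j = k then 1/2 else 0) (U j k + V j k))" by simp
  qed
  finally have h: "inf_temp_gen T Th X = csc (- \<i>) (commutator (sys_ham T) X)
     + (\<Sum>j\<in>UNIV. \<Sum>k\<in>UNIV. csc (if j = k then 1/2 else 0) (U j k + V j k))"
    by (simp add: inf_temp_gen_def)
  \<comment> \<open>Centring the rates: with \<delta> the Kronecker symbol,
    \<open>G U + (\<delta> - G) V\<close> is half of \<open>\<delta> (U + V)\<close> plus
    \<open>(G - \<delta>/2) (U - V)\<close>. The sums belong to infinite temperature, the
    differences to \<open>pair_op\<close>.\<close>
  have "csc (G $ j $ k) (U j k) + csc ((if j = k then 1 else 0) - G $ j $ k) (V j k)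
    = csc (if j = k then 1/2 else 0) (U j k + V j k) + csc ((G - csc (1/2) (mat 1)) $ j $ k) (U j k - V j k)" for j k
    by (rule mat_eqI) (simp add: mat_def field_simps)
  thus ?thesis
    unfolding quasi_free_gen_def h q add_diff_eq[symmetric] lhs by (simp only: sum.distrib add.assoc)
qed

section \<open>Gibbs states\<close>

text \<open>\<open>mpow\<close> multiplies on the right, so \<open>mexp A\<close> is the exponential
  of this map applied to the identity; products reverse their order.\<close>

definition rmult :: "complex^'n^'n \<Rightarrow> (complex^'n^'n) endo" where
  "rmult A = endo (\<lambda>X. X ** A)"

lemma app_rmult [simp]:
  fixes A :: "complex^'n^'n"
  shows "app (rmult A) X = X ** A"
proof -
  have "linear (\<lambda>X :: complex^'n^'n. X ** A)" by (rule linear_csc_iff) (simp_all add: mat_simps)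
  thus ?thesis by (simp add: rmult_def app_endo)
qed

lemma rmult_simps: "rmult (A + B) = rmult A + rmult B" "rmult A * rmult B = rmult (B ** A)"
  "rmult (csc (complex_of_real r) A) = r *\<^sub>R rmult A"
  by (rule endo_eqI; simp add: app.add_left app.scaleR_left mat_simps matrix_mul_assoc scaleR_csc)+

lemma mexp_eq: "mexp A = app (exp (rmult A)) (mat 1)"
proof -
  have "(app (rmult A) ^^ k) (mat 1) = mpow A k" for k
    by (induction k) (simp_all add: mpow_def)
  thus ?thesis by (simp add: mexp_def app_exp)
qed

lemma mult_mexp:
  fixes A :: "complex^'n^'n"
  shows "X ** mexp A = app (exp (rmult A)) X"
proof -
  have "linear (\<lambda>Y :: complex^'n^'n. X ** Y)" by (rule linear_csc_iff) (simp_all add: mat_simps)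
  from app_exp_intertwine[OF this, of "rmult A" "rmult A" "mat 1"]
  show ?thesis by (simp add: mexp_eq matrix_mul_assoc)
qed

lemma mexp_add:
  assumes "A ** B = B ** A" shows "mexp (A + B) = mexp A ** mexp B"
proof -
  have "exp (rmult (B + A)) = exp (rmult B) * exp (rmult A)"
    unfolding rmult_simps(1) by (rule exp_add_commuting) (simp add: rmult_simps assms)
  thus ?thesis by (simp add: mult_mexp) (simp add: mexp_eq add.commute)
qed

lemma mexp_commute:
  fixes A :: "complex^'n^'n"
  assumes "X ** A = A ** X" shows "X ** mexp A = mexp A ** X"
proof -
  have "linear (\<lambda>Y :: complex^'n^'n. Y ** X)" by (rule linear_csc_iff) (simp_all add: mat_simps)
  from app_exp_intertwine[OF this, of "rmult A" "rmult A" "mat 1"]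
  show ?thesis by (simp add: mexp_eq[symmetric] mult_mexp matrix_mul_assoc[symmetric] assms)
qed

lemma mexp_par:
  fixes A :: "'n::finite fockop"
  assumes "par A = A" shows "par (mexp A) = mexp A"
proof -
  have "linear (par :: 'n fockop \<Rightarrow> 'n fockop)" by (rule linear_csc_iff) (simp_all add: mat_simps)
  from app_exp_intertwine[OF this, of "rmult A" "rmult A" "mat 1"]
  show ?thesis by (simp add: mexp_eq mat_simps assms)
qed

lemma mexp_idempotent:
  assumes "P ** P = P"
  shows "mexp (csc (complex_of_real r) P) = mat 1 + csc (complex_of_real (exp r - 1)) P"
proof -
  have "rmult P * rmult P = rmult P" by (simp add: rmult_simps assms)
  from exp_idempotent[OF this, of r] show ?thesis
    by (simp add: mexp_eq rmult_simps app.add_left app.scaleR_left scaleR_csc)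
qed

lemma mexp_0: "mexp 0 = mat 1"
  using mexp_idempotent[of 0 0] by (simp add: mat_simps)

lemma cadj_mexp:
  fixes A :: "complex^'a^'a"
  assumes "hermitian A" shows "cadj (mexp A) = mexp A"
proof -
  have lin: "linear (\<lambda>X :: complex^'a^'a. A ** X)" by (rule linear_csc_iff) (simp_all add: mat_simps)
  have "linear (cadj :: complex^'a^'a \<Rightarrow> complex^'a^'a)"
    by (rule linearI) (simp_all add: mat_simps scaleR_csc)
  from app_exp_intertwine[OF this, of "rmult A" "endo (\<lambda>X. A ** X)" "mat 1"]
  have "cadj (mexp A) = app (exp (endo (\<lambda>X. A ** X))) (mat 1)"
    by (simp add: mexp_eq app_endo[OF lin] mat_simps hermitianD[OF assms])
  also have "\<dots> = mexp A"
  proof -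
    have "((\<lambda>X. A ** X) ^^ k) (mat 1) = mpow A k" for k
      by (induction k) (simp_all add: mpow_Suc', simp add: mpow_def)
    thus ?thesis by (simp add: mexp_def app_exp app_endo[OF lin])
  qed
  finally show ?thesis .
qed

lemma psd_mexp:
  assumes "hermitian A" shows "psd (mexp A)"
proof -
  let ?B = "csc (1/2) A"
  have "?B + ?B = A" using csc_2[of ?B] by (simp add: csc_simps)
  hence "mexp A = mexp ?B ** mexp ?B" using mexp_add[of ?B ?B] by simp
  moreover have "cadj (mexp ?B) = mexp ?B"
    by (rule cadj_mexp) (simp add: hermitian_def mat_simps hermitianD[OF assms])
  ultimately show ?thesis using psd_cadj_mult[of "mexp ?B"] by simp
qed

section \<open>Quadratic exponents and Gibbs states\<close>

lemma sum_sum_type: "(\<Sum>a\<in>UNIV. f a) = (\<Sum>i\<in>UNIV. f (Inl i)) + (\<Sum>i\<in>UNIV. f (Inr i))"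
  for f :: "'a::finite + 'b::finite \<Rightarrow> 'c::comm_monoid_add"
  unfolding UNIV_Plus_UNIV[symmetric] by (subst sum.Plus) auto

lemma quad_ham_eq_sys_ham:
  fixes K :: "((complex, 'n::{finite,linorder}) vec, 'n) vec"
  obtains T where "quad_ham T = sys_ham K"
proof -
  \<comment> \<open>Since \<open>annih j\<close> is half of \<open>majorana (Inl j)\<close> plus
    \<i> times \<open>majorana (Inr j)\<close>, and \<open>creat i\<close> is half of the
    corresponding difference, these are the coefficients in the expansion of
    \<open>creat i ** annih j\<close>.\<close>
  define T :: "complex^('n + 'n)^('n + 'n)" where "T = (\<chi> a b.
    (case a of Inl i \<Rightarrow> (case b of Inl j \<Rightarrow> K $ i $ j / 4 | Inr j \<Rightarrow> \<i> * K $ i $ j / 4)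
      | Inr i \<Rightarrow> (case b of Inl j \<Rightarrow> - \<i> * K $ i $ j / 4 | Inr j \<Rightarrow> K $ i $ j / 4)))"
  have t: "csc (T $ Inl i $ Inl j) (majorana (Inl i) ** majorana (Inl j))
    + csc (T $ Inl i $ Inr j) (majorana (Inl i) ** majorana (Inr j))
    + (csc (T $ Inr i $ Inl j) (majorana (Inr i) ** majorana (Inl j))
    + csc (T $ Inr i $ Inr j) (majorana (Inr i) ** majorana (Inr j))) = csc (K $ i $ j) (creat i ** annih j)" for i j
    by (simp add: T_def majorana_def mat_simps) (rule mat_eqI, simp add: field_simps)
  have "quad_ham T = (\<Sum>i\<in>UNIV. \<Sum>j\<in>UNIV. csc (T $ Inl i $ Inl j) (majorana (Inl i) ** majorana (Inl j))
    + csc (T $ Inl i $ Inr j) (majorana (Inl i) ** majorana (Inr j))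
    + (csc (T $ Inr i $ Inl j) (majorana (Inr i) ** majorana (Inl j))
    + csc (T $ Inr i $ Inr j) (majorana (Inr i) ** majorana (Inr j))))"
    unfolding quad_ham_def sum_sum_type sum.distrib by (simp add: add.assoc)
  also have "\<dots> = sys_ham K" unfolding t sys_ham_def ..
  finally show ?thesis using that by blast
qed

lemma gibbs_stateI:
  assumes "hermitian K" "\<rho> = csc z (mexp (sys_ham K))" "ctrace \<rho> = 1"
  shows "\<rho> \<in> gibbs_states"
proof -
  \<comment> \<open>Taking \<beta> equal to 1 and the opposite sign of \<open>K\<close> absorbs the
    minus sign of the Gibbs exponent; the trace condition fixes the prefactor.\<close>
  obtain T where T: "quad_ham T = sys_ham (- K)" by (rule quad_ham_eq_sys_ham)
  have m: "sys_ham (- K) = - sys_ham K"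
    using sys_ham_simps(2)[of "-1" K] by (simp add: csc_simps)
  have "z * ctrace (mexp (sys_ham K)) = 1" using assms by simp
  hence "z = 1 / ctrace (mexp (sys_ham K))" by (metis mult_zero_right nonzero_eq_divide_eq zero_neq_one)
  hence "\<rho> = csc (1 / ctrace (mexp (csc (- complex_of_real 1) (quad_ham T)))) (mexp (csc (- complex_of_real 1) (quad_ham T)))"
    by (simp add: T m csc_simps assms(2))
  moreover have "hermitian (quad_ham T)"
    by (simp add: T m hermitian_def cadj_sys_ham mat_simps hermitianD[OF assms(1)])
  ultimately show ?thesis unfolding gibbs_states_def by (blast intro: zero_less_one)
qed

text \<open>For one mode the exponent squares to zero, so its exponential is affine. On an even
  \<open>Y\<close> commuting with the mode it multiplies by \<open>1 - 2 * \<kappa>\<close> where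
  the mode is empty and by \<open>1 + 2 * \<kappa>\<close> where it is filled; the logarithm of the
  ratio is the Gibbs exponent.\<close>

lemma mode_exp:
  fixes Y :: "'n::{finite,linorder} fockop"
  assumes f: "cinner f f = 1" and Y: "par Y = Y" "fa f ** Y = Y ** fa f" "cadj (fa f) ** Y = Y ** cadj (fa f)"
    and \<kappa>: "\<bar>\<kappa>\<bar> < 1/2"
  shows "app (exp (endo (pair_op (csc (complex_of_real \<kappa>) (outer f f))))) Y
    = csc (complex_of_real (1 - 2 * \<kappa>)) (mexp (csc (complex_of_real (ln ((1 + 2 * \<kappa>) / (1 - 2 * \<kappa>)))) (cadj (fa f) ** fa f)) ** Y)"
proof -
  let ?a = "fa f" and ?b = "cadj (fa f)"
  let ?n = "?b ** ?a"
  let ?Q = "endo (pair_op (csc (complex_of_real \<kappa>) (outer f f)))"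
  have Q: "app ?Q X = csc (complex_of_real \<kappa>) (gmult ?b (gmult ?a X))" for X
    by (simp add: app_endo[OF linear_pair_op] mat_simps pair_op_outer)
  have aa: "?a ** ?a = 0" using fa_fa[of f f] csc_2[of "?a ** ?a"]
    by (metis csc_simps(7,9,10) mult.commute nonzero_eq_divide_eq zero_neq_numeral)
  have ab: "?a ** ?b = mat 1 - ?n" using fa_cadj_fa_minus[of f f] by (simp add: f mat_simps)
  have nn: "?n ** ?n = ?n"
  proof -
    have "?n ** ?n = ?b ** (?a ** ?b) ** ?a" by (simp add: matrix_mul_assoc)
    also have "\<dots> = ?n - ?b ** ?b ** (?a ** ?a)" by (simp add: ab mat_simps matrix_mul_assoc)
    finally show ?thesis by (simp add: aa mat_simps)
  qed
  have gaa: "gmult ?a (gmult ?a X) = 0" for X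
    by (simp add: gmult_def mat_simps par_fa matrix_mul_assoc aa)
       (simp add: matrix_mul_assoc[symmetric] aa mat_simps)
  have anti: "gmult ?a (gmult ?b X) = - gmult ?b (gmult ?a X)" for X
    by (rule gmult_anticommute[OF par_fa par_cadj_fa fa_cadj_fa])
  have "?Q * ?Q = 0"
    by (rule endo_eqI) (simp add: Q mat_simps anti gaa app.zero_left)
  hence "app (exp ?Q) Y = Y + app ?Q Y" by (simp add: exp_square_zero app.add_left)
  also have "app ?Q Y = csc (complex_of_real \<kappa>) (csc 4 (?n ** Y) - csc 2 Y)"
  proof -
    have "gmult ?b (gmult ?a Y) = ?b ** ?a ** Y + ?b ** (Y ** ?a) - ?a ** (Y ** ?b) - Y ** ?a ** ?b"
      by (simp add: gmult_def mat_simps par_fa Y(1) matrix_mul_assoc)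
    also have "\<dots> = csc 2 (?n ** Y) - csc 2 (?a ** ?b ** Y)"
      unfolding csc_2 Y(2,3)[symmetric] by (simp add: matrix_mul_assoc[symmetric] Y(3)[symmetric])
    also have "\<dots> = csc 4 (?n ** Y) - csc 2 Y"
      unfolding ab by (simp add: mat_simps) (rule mat_eqI, simp)
    finally show ?thesis by (simp add: Q)
  qed
  also have "Y + csc (complex_of_real \<kappa>) (csc 4 (?n ** Y) - csc 2 Y)
     = csc (complex_of_real (1 - 2 * \<kappa>)) ((mat 1 + csc (complex_of_real ((1 + 2 * \<kappa>) / (1 - 2 * \<kappa>) - 1)) ?n) ** Y)"
  proof -
    have "(1 + 2 * \<kappa>) / (1 - 2 * \<kappa>) - 1 = 4 * \<kappa> / (1 - 2 * \<kappa>)" using \<kappa> by (simp add: field_simps)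
    hence "csc (complex_of_real (1 - 2 * \<kappa>)) (csc (complex_of_real ((1 + 2 * \<kappa>) / (1 - 2 * \<kappa>) - 1)) (?n ** Y))
      = csc (complex_of_real (4 * \<kappa>)) (?n ** Y)"
      unfolding csc_simps(7) of_real_mult[symmetric] using \<kappa> by simp
    thus ?thesis by (simp add: mat_simps) (rule mat_eqI, simp add: algebra_simps)
  qed
  also have "complex_of_real ((1 + 2 * \<kappa>) / (1 - 2 * \<kappa>) - 1) = complex_of_real (exp (ln ((1 + 2 * \<kappa>) / (1 - 2 * \<kappa>))) - 1)"
    using \<kappa> by (simp add: abs_less_iff)
  finally show ?thesis by (simp only: mexp_idempotent[OF nn])
qed

lemma hermitian_sum: "(\<And>i. i \<in> I \<Longrightarrow> hermitian (f i)) \<Longrightarrow> hermitian (\<Sum>i\<in>I. f i)"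
  by (simp add: hermitian_def cadj_sum)

lemma hermitian_outer: "hermitian (csc (complex_of_real r) (outer f f))"
  unfolding hermitian_def by (rule mat_eqI) (simp add: outer_def mult.commute)

text \<open>The exponents of different modes commute, so modes can be added one at a time. The
  exponential built so far involves only modes orthogonal to the new one, hence is even and commutes
  with its field operators. The constant \<open>c\<close> stays unspecified, as the trace determines
  it later.\<close>

lemma exp_pair_op_gibbs:
  fixes u :: "'n::{finite,linorder} \<Rightarrow> (complex, 'n) vec"
  assumes u: "\<And>i j. cinner (u i) (u j) = (if i = j then 1 else 0)" and \<kappa>: "\<And>i. \<bar>\<kappa> i\<bar> < 1/2"
  shows "\<exists>c>0. app (exp (endo (pair_op (\<Sum>i\<in>F. csc (complex_of_real (\<kappa> i)) (outer (u i) (u i)))))) (mat 1)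
    = csc (complex_of_real c) (mexp (sys_ham (\<Sum>i\<in>F. csc (complex_of_real (ln ((1 + 2 * \<kappa> i) / (1 - 2 * \<kappa> i)))) (outer (u i) (u i)))))"
proof -
  define \<theta> where "\<theta> i = ln ((1 + 2 * \<kappa> i) / (1 - 2 * \<kappa> i))" for i
  let ?H = "\<lambda>F. sys_ham (\<Sum>i\<in>F. csc (complex_of_real (\<theta> i)) (outer (u i) (u i)))"
  let ?Q = "\<lambda>F. \<Sum>i\<in>F. csc (complex_of_real (\<kappa> i)) (outer (u i) (u i))"
  have "finite F" by simp
  thus ?thesis unfolding \<theta>_def[symmetric]
  proof (induction F)
    case empty
    have "pair_op 0 X = 0" for X :: "'n fockop" by (simp add: pair_op_def mat_simps)
    hence "app (exp (endo (pair_op 0))) (mat 1) = (mat 1 :: 'n fockop)"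
      by (intro app_exp_fixed) (simp add: app_endo[OF linear_pair_op])
    moreover have "sys_ham 0 = (0 :: 'n fockop)" by (simp add: sys_ham_def mat_simps)
    ultimately show ?case by (intro exI[of _ 1]) (simp add: mexp_0 mat_simps)
  next
    case (insert j F)
    then obtain c where c: "c > 0" "app (exp (endo (pair_op (?Q F)))) (mat 1) = csc (complex_of_real c) (mexp (?H F))"
      by blast
    define Y where "Y = mexp (?H F)"
    let ?q = "csc (complex_of_real (\<kappa> j)) (outer (u j) (u j))"
    let ?n = "cadj (fa (u j)) ** fa (u j)"
    have hK: "hermitian (\<Sum>i\<in>F. csc (complex_of_real (\<theta> i)) (outer (u i) (u i)))"
      by (intro hermitian_sum hermitian_outer)
    have K0: "(\<Sum>i\<in>F. csc (complex_of_real (\<theta> i)) (outer (u i) (u i))) *v u j = 0"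
    proof -
      have "outer (u i) (u i) *v u j = cinner (u i) (u j) *s u i" for i
        by (simp add: vec_eq_iff matrix_vector_nth outer_def cinner_def sum_distrib_left sum_distrib_right algebra_simps)
      hence z: "csc (complex_of_real (\<theta> i)) (outer (u i) (u i)) *v u j = 0" if "i \<in> F" for i
        using that insert.hyps u[of i j] by (auto simp: csc_matrix_vector)
      have "finite G \<Longrightarrow> G \<subseteq> F \<Longrightarrow> (\<Sum>i\<in>G. csc (complex_of_real (\<theta> i)) (outer (u i) (u i))) *v u j = 0" for G
        by (induction G rule: finite_induct) (auto simp: matrix_vector_mult_add_rdistrib z)
      thus ?thesis using insert.hyps by blast
    qed
    have comH: "fa (u j) ** ?H F = ?H F ** fa (u j)" "cadj (fa (u j)) ** ?H F = ?H F ** cadj (fa (u j))"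
      using commutator_sys_ham_fa[of "\<Sum>i\<in>F. csc (complex_of_real (\<theta> i)) (outer (u i) (u i))" "u j"]
        commutator_sys_ham_cadj_fa[OF hK, of "u j"]
      by (simp_all add: hermitianD[OF hK] K0 fa_simps commutator_def mat_simps)
    have Y: "par Y = Y" "fa (u j) ** Y = Y ** fa (u j)" "cadj (fa (u j)) ** Y = Y ** cadj (fa (u j))"
      unfolding Y_def by (rule mexp_par mexp_commute par_sys_ham comH)+
    have "endo (pair_op (?Q (insert j F))) = endo (pair_op ?q) + endo (pair_op (?Q F))"
      using insert.hyps
      by (intro endo_eqI) (simp add: app_endo[OF linear_pair_op] app.add_left mat_simps)
    moreover have "endo (pair_op ?q) * endo (pair_op (?Q F)) = endo (pair_op (?Q F)) * endo (pair_op ?q)"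
      by (rule endo_eqI) (simp add: app_endo[OF linear_pair_op] pair_op_commute[of ?q])
    ultimately have "app (exp (endo (pair_op (?Q (insert j F))))) (mat 1)
        = app (exp (endo (pair_op ?q))) (csc (complex_of_real c) Y)"
      by (simp add: exp_add_commuting c(2) Y_def)
    also have "\<dots> = csc (complex_of_real c) (app (exp (endo (pair_op ?q))) Y)"
      unfolding scaleR_csc[symmetric] by (rule app.scaleR_right)
    also have "app (exp (endo (pair_op ?q))) Y
        = csc (complex_of_real (1 - 2 * \<kappa> j)) (mexp (csc (complex_of_real (\<theta> j)) ?n) ** Y)"
      unfolding \<theta>_def by (rule mode_exp[OF _ Y \<kappa>]) (simp add: u)
    also have "mexp (csc (complex_of_real (\<theta> j)) ?n) ** Y = mexp (csc (complex_of_real (\<theta> j)) ?n + ?H F)"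
    proof -
      have "?n ** ?H F = ?H F ** ?n"
        by (simp only: matrix_mul_assoc[symmetric] comH(1)) (simp only: matrix_mul_assoc comH(2))
      thus ?thesis unfolding Y_def by (intro mexp_add[symmetric]) (simp add: mat_simps)
    qed
    also have "csc (complex_of_real (\<theta> j)) ?n + ?H F = ?H (insert j F)"
      using insert.hyps by (simp add: mat_simps sys_ham_outer)
    finally have "app (exp (endo (pair_op (?Q (insert j F))))) (mat 1)
        = csc (complex_of_real (c * (1 - 2 * \<kappa> j))) (mexp (?H (insert j F)))"
      by (simp only: csc_simps(7) of_real_mult)
    moreover have "0 < c * (1 - 2 * \<kappa> j)" using c(1) \<kappa>[of j] by (simp add: abs_less_iff)
    ultimately show ?case by blast
  qed
qed

lemma commutator_numop_sys_ham: "commutator numop (sys_ham K) = 0"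
proof (induction K rule: cmat_outer_induct)
  case (outer f g)
  have a: "numop ** fa g = fa g ** numop - fa g" for g :: "(complex, 'a) vec"
    using commutator_numop_fa[of g] by (simp add: commutator_def algebra_simps)
  have b: "numop ** cadj (fa f) = cadj (fa f) ** numop + cadj (fa f)" for f :: "(complex, 'a) vec"
    using arg_cong[OF a[of f], of cadj] by (simp add: mat_simps algebra_simps)
  have "numop ** (cadj (fa f) ** fa g) = cadj (fa f) ** (numop ** fa g) + cadj (fa f) ** fa g"
    by (simp add: matrix_mul_assoc b mat_simps)
  thus ?case by (simp add: commutator_def sys_ham_outer a mat_simps matrix_mul_assoc)
qed (simp_all add: mat_simps)

text \<open>Modes with \<open>\<bar>d i\<bar> = 1/2\<close> are empty or full, so \<open>\<sigma>\<close> is in general only a limit of Gibbs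
  states, reached by shrinking \<open>d\<close>.\<close>

lemma quasi_free_limit:
  fixes u :: "'n::{finite,linorder} \<Rightarrow> (complex, 'n) vec"
  assumes u: "\<And>i j. cinner (u i) (u j) = (if i = j then 1 else 0)" and d: "\<And>i. \<bar>d i\<bar> \<le> 1/2"
    and \<sigma>: "\<sigma> = csc (1 / of_nat CARD('n set)) (app (exp (endo (pair_op (\<Sum>i\<in>UNIV. csc (complex_of_real (d i)) (outer (u i) (u i)))))) (mat 1))"
  shows "is_state \<sigma> \<and> quasi_free \<sigma> \<and> commutator numop \<sigma> = 0"
proof -
  let ?Q = "endo (pair_op (\<Sum>i\<in>UNIV. csc (complex_of_real (d i)) (outer (u i) (u i)))) :: 'n fockop endo"
  \<comment> \<open>Each factor lies strictly between 0 and 1 from the start, which keeps every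
    \<open>r n * d i\<close> in the open interval where the logarithm is defined.\<close>
  define r where "r n = 1 - 1 / real (n + 2)" for n
  define S where "S n = csc (1 / of_nat CARD('n set)) (app (exp (r n *\<^sub>R ?Q)) (mat 1))" for n
  have r: "0 < r n" "r n < 1" for n by (simp_all add: r_def)
  have "(\<lambda>n. 1 / real (n + 2)) \<longlonglongrightarrow> 0"
    using LIMSEQ_ignore_initial_segment[OF lim_1_over_n, of 2] by simp
  from tendsto_diff[OF tendsto_const[of 1] this] have rl: "r \<longlonglongrightarrow> 1"
    by (simp add: r_def[abs_def])
  have "(\<lambda>n. exp (r n *\<^sub>R ?Q)) \<longlonglongrightarrow> exp (1 *\<^sub>R ?Q)"
    using has_vector_derivative_continuous[OF exp_scaleR_has_vector_derivative_left[of ?Q 1]] rl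
    by (rule isCont_tendsto_compose)
  hence lim: "S \<longlonglongrightarrow> \<sigma>"
    unfolding S_def \<sigma> by (intro tendsto_csc tendsto_const app.tendsto) simp_all
  \<comment> \<open>\<open>pair_op\<close> has traceless values, so the trace of the identity is
    preserved for every scaling and all approximants share one normalisation.\<close>
  have trace: "ctrace (app (exp (c *\<^sub>R ?Q)) (mat 1)) = of_nat CARD('n set)" for c
  proof -
    have "linear (ctrace :: 'n fockop \<Rightarrow> complex)"
      by (rule linearI) (simp_all add: scaleR_csc scaleR_conv_of_real)
    from app_exp_intertwine[OF this, of "c *\<^sub>R ?Q" 0 "mat 1"]
    show ?thesis
      by (simp add: app.scaleR_left app_endo[OF linear_pair_op] scaleR_csc ctrace_pair_op app.zero_left ctrace_one)
  qed
  have N: "(of_nat CARD('n set) :: complex) \<noteq> 0" by (simp add: zero_less_card_finite)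
  have S: "S n \<in> gibbs_states \<and> psd (S n) \<and> commutator numop (S n) = 0" for n
  proof -
    have "\<bar>r n * d i\<bar> < 1/2" for i
    proof -
      have "\<bar>r n * d i\<bar> \<le> r n * (1/2)" using r[of n] d[of i] by (simp add: abs_mult)
      thus ?thesis using r[of n] by simp
    qed
    define K where "K = (\<Sum>i\<in>UNIV. csc (complex_of_real (ln ((1 + 2 * (r n * d i)) / (1 - 2 * (r n * d i))))) (outer (u i) (u i)))"
    from exp_pair_op_gibbs[where \<kappa> = "\<lambda>i. r n * d i" and F = UNIV, OF u \<open>\<And>i. \<bar>r n * d i\<bar> < 1/2\<close>]
    obtain c where cK: "c > 0" "app (exp (endo (pair_op (\<Sum>i\<in>UNIV. csc (complex_of_real (r n * d i)) (outer (u i) (u i)))))) (mat 1)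
      = csc (complex_of_real c) (mexp (sys_ham K))"
      unfolding K_def by blast
    have hK: "hermitian K" unfolding K_def by (intro hermitian_sum hermitian_outer)
    have "endo (pair_op (\<Sum>i\<in>UNIV. csc (complex_of_real (r n * d i)) (outer (u i) (u i)))) = r n *\<^sub>R ?Q"
      by (rule endo_eqI) (simp add: app_endo[OF linear_pair_op] app.scaleR_left scaleR_csc pair_op_sum csc_sum mat_simps)
    hence S: "S n = csc (complex_of_real (c / real CARD('n set))) (mexp (sys_ham K))"
      using cK(2) by (simp add: S_def mat_simps)
    have "ctrace (S n) = 1" using N by (simp add: S_def trace)
    with hK S have "S n \<in> gibbs_states" by (rule gibbs_stateI)
    moreover have "psd (S n)" unfolding S using cK(1)
      by (intro psd_csc psd_mexp) (simp_all add: hermitian_def cadj_sys_ham hermitianD[OF hK])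
    moreover have "commutator numop (S n) = 0"
    proof -
      have "numop ** sys_ham K = sys_ham K ** numop"
        using commutator_numop_sys_ham[of K] by (simp add: commutator_def)
      from mexp_commute[OF this] show ?thesis by (simp add: S commutator_def mat_simps)
    qed
    ultimately show ?thesis by blast
  qed
  have "psd \<sigma>" by (rule psd_limit[OF lim]) (simp_all add: S)
  moreover have "ctrace \<sigma> = 1" using trace[of 1] N by (simp add: \<sigma>)
  moreover have "quasi_free \<sigma>"
    unfolding quasi_free_def closure_sequential using S lim by blast
  moreover have "commutator numop \<sigma> = 0"
  proof -
    have "(\<lambda>n. commutator numop (S n)) \<longlonglongrightarrow> commutator numop \<sigma>"
      unfolding commutator_def by (intro tendsto_intros lim)
    thus ?thesis by (simp add: S LIMSEQ_const_iff)
  qed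
  ultimately show ?thesis by (simp add: is_state_def)
qed

section \<open>The semigroup\<close>

text \<open>For the embedding \<open>E\<^sub>B\<^sub>S\<close> the generator is not quasi-free on odd operators; right multiplication
  of the odd part by the parity turns it into the generator for \<open>E\<^sub>S\<^sub>B\<close>.\<close>

definition parity_twist :: "'n::finite fockop \<Rightarrow> 'n fockop" where
  "parity_twist X = csc (1/2) (X + par X) + csc (1/2) ((X - par X) ** parity)"

lemma parity_twist_simps: "parity_twist (X + Y) = parity_twist X + parity_twist Y" "parity_twist (csc z X) = csc z (parity_twist X)"
  by (simp_all add: parity_twist_def mat_simps mult.commute)

lemma linear_parity_twist: "linear parity_twist"
  by (rule linear_csc_iff) (rule parity_twist_simps)+

lemma csc_half: "csc (1/2) (X + X) = X"
  unfolding csc_2[symmetric] by (simp add: csc_simps)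

lemma parity_twist_even: "par X = X \<Longrightarrow> parity_twist X = X"
  by (rule mat_eqI) (simp add: parity_twist_def mat_simps)

lemma parity_twist_odd:
  assumes "par X = - X" shows "parity_twist X = X ** parity"
  unfolding parity_twist_def assms diff_minus_eq_add matrix_mult_simps(1) csc_half
  by (simp add: csc_simps)

lemma even_odd_decomposition:
  obtains E U where "X = E + U" "par E = E" "par U = - U"
proof
  show "X = csc (1/2) (X + par X) + csc (1/2) (X - par X)"
    by (rule mat_eqI) (simp add: field_simps)
  show "par (csc (1/2) (X + par X)) = csc (1/2) (X + par X)" by (simp add: mat_simps)
  show "par (csc (1/2) (X - par X)) = - csc (1/2) (X - par X)" by (simp add: mat_simps)
qed

lemma parity_twist_parity_twist: "parity_twist (parity_twist X) = X"
proof -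
  obtain E U where EO: "X = E + U" "par E = E" "par U = - U" by (rule even_odd_decomposition)
  have "par (U ** parity) = - (U ** parity)" by (simp add: mat_simps EO)
  thus ?thesis by (simp add: EO(1) parity_twist_simps parity_twist_even parity_twist_odd EO parity_cancel)
qed

lemma par_dissip: "par (dissip G Th X) = dissip G Th (par X)"
  by (simp add: dissip_def par_sum mat_simps par_fa par_cadj_fa)

lemma dissip_add: "dissip G Th (X + Y) = dissip G Th X + dissip G Th Y"
  by (simp add: dissip_def mat_simps sum.distrib)

lemma dissip_minus: "dissip G Th (- X) = - dissip G Th X"
  using dissip_add[of G Th "- X" X] dissip_add[of G Th 0 0] by (simp add: eq_neg_iff_add_eq_0 add.commute)

lemma dissip_diff: "dissip G Th (X - Y) = dissip G Th X - dissip G Th Y"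
  using dissip_add[of G Th X "- Y"] by (simp add: dissip_minus)

lemma fa_parity: "fa f ** parity = - (parity ** fa f)" "cadj (fa f) ** parity = - (parity ** cadj (fa f))"
  by (simp_all add: parity_mult par_fa par_cadj_fa mat_simps)

text \<open>Parity passes one of the two field operators of each jump, which costs one sign; by this
  sign the jump terms of the two embeddings differ on odd operators.\<close>

lemma dissip_parity: "dissip G Th (X ** parity) = - (dissip G Th X ** parity)"
proof -
  have "cadj (fa f) ** (X ** parity) ** fa g = - (cadj (fa f) ** X ** fa g ** parity)"
    "fa f ** (X ** parity) ** cadj (fa g) = - (fa f ** X ** cadj (fa g) ** parity)" for f g
    by (simp_all add: matrix_mul_assoc[symmetric] fa_parity mat_simps)
  thus ?thesis
    unfolding dissip_def matrix_mult_sum_left sum_negf[symmetric]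
    by (intro sum.cong refl) (simp add: mat_simps)
qed

lemma par_damping: "par (damping G Th) = damping G Th"
  by (simp add: damping_def par_sum mat_simps par_fa par_cadj_fa)

lemma par_eq_commute: "par X = X \<Longrightarrow> parity ** X = X ** parity"
  by (simp add: parity_mult)

text \<open>The embeddings share the part \<open>K\<close> and agree on even operators; on odd ones
  their jump terms have opposite signs. Right multiplication by parity commutes with
  \<open>K\<close> and flips that sign.\<close>

lemma lindbladian_eq:
  fixes T0 :: "((complex, 'n::{finite,linorder}) vec, 'n) vec" and Th :: "((complex, 'm::{finite,linorder}) vec, 'n) vec"
  assumes "is_state \<omega>" "commutator numop \<omega> = 0"
  shows "lindbladian True T0 Th \<omega> X = quasi_free_gen T0 Th (covariance \<omega> - csc (1/2) (mat 1)) X" (is ?T)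
    and "lindbladian False T0 Th \<omega> X = parity_twist (quasi_free_gen T0 Th (covariance \<omega> - csc (1/2) (mat 1)) (parity_twist X))" (is ?F)
proof -
  define G where "G = covariance \<omega>"
  define D where "D = damping G Th"
  define K where "K Y = csc (- \<i>) (commutator (sys_ham T0) Y) - csc (1/2) (anticommutator D Y)" for Y
  define L where "L Y = K Y + dissip G Th (par Y)" for Y
  have K_add: "K (Y + Z) = K Y + K Z" for Y Z
    by (simp add: K_def anticommutator_def mat_simps)
  have K_par: "par (K Y) = K (par Y)" for Y
    by (simp add: K_def anticommutator_def commutator_def mat_simps par_sys_ham par_damping D_def)
  have K_parity: "K (Y ** parity) = K Y ** parity" for Y
  proof -
    have "Y ** parity ** sys_ham T0 = Y ** sys_ham T0 ** parity" "Y ** parity ** D = Y ** D ** parity"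
      unfolding matrix_mul_assoc[symmetric] D_def
      by (simp_all add: par_eq_commute par_sys_ham par_damping)
    thus ?thesis by (simp add: K_def anticommutator_def commutator_def mat_simps matrix_mul_assoc)
  qed
  have L: "lindbladian True T0 Th \<omega> Y = L Y" "lindbladian False T0 Th \<omega> Y = K Y + dissip G Th Y" for Y
    by (simp_all add: lindbladian_def Phi_star_eq[OF assms] Phi_one_eq[OF assms] K_def D_def G_def L_def)
  have L_eq: "quasi_free_gen T0 Th (covariance \<omega> - csc (1/2) (mat 1)) Y = L Y" for Y
    by (simp add: quasi_free_gen_eq[symmetric] L_def K_def D_def G_def)
  show ?T by (simp add: L L_eq)
  show ?F
  proof -
    obtain E U where EO: "X = E + U" "par E = E" "par U = - U" by (rule even_odd_decomposition)
    have P: "par (U ** parity) = - (U ** parity)" by (simp add: mat_simps EO)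
    have "L (parity_twist X) = (K E + dissip G Th E) + (K U ** parity + dissip G Th U ** parity)"
      by (simp add: EO(1) parity_twist_simps parity_twist_even parity_twist_odd EO L_def mat_simps K_add K_parity dissip_add
          dissip_diff dissip_minus dissip_parity)
    moreover have "parity_twist (K E + dissip G Th E) = K E + dissip G Th E"
      by (rule parity_twist_even) (simp add: mat_simps K_par par_dissip EO)
    moreover have "parity_twist (K U ** parity + dissip G Th U ** parity) = K U + dissip G Th U"
    proof -
      have "K (- U) = - K U"
        using K_add[of "- U" U] K_add[of 0 0] by (simp add: eq_neg_iff_add_eq_0 add.commute)
      hence "par (K U ** parity + dissip G Th U ** parity) = - (K U ** parity + dissip G Th U ** parity)"
        by (simp add: mat_simps K_par par_dissip EO dissip_minus)
      from parity_twist_odd[OF this] show ?thesis by (simp add: mat_simps parity_cancel)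
    qed
    ultimately have "parity_twist (L (parity_twist X)) = (K E + dissip G Th E) + (K U + dissip G Th U)"
      by (simp only: parity_twist_simps(1))
    thus ?thesis by (simp add: L L_eq EO(1) K_add dissip_add)
  qed
qed

section \<open>From generators to semigroups\<close>

lemma linear_quasi_free_gen: "linear (quasi_free_gen T Th Z)"
  unfolding quasi_free_gen_def by (rule linear_compose_add[OF linear_inf_temp_gen linear_pair_op])

lemma semigroup_eq:
  assumes "linear (lindbladian sb T0 Th \<omega>)"
  shows "semigroup sb T0 Th \<omega> t X = app (exp (t *\<^sub>R endo (lindbladian sb T0 Th \<omega>))) X"
proof -
  have "(app (t *\<^sub>R endo (lindbladian sb T0 Th \<omega>)) ^^ k) X = t ^ k *\<^sub>R (lindbladian sb T0 Th \<omega> ^^ k) X" for k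
    by (simp add: app_power[symmetric] app.scaleR_left) (simp add: app_power app_endo[OF assms])
  thus ?thesis by (simp add: semigroup_def app_exp)
qed

text \<open>The twist is an involution carrying one generator into the other, hence also their
  exponentials.\<close>

lemma semigroup_conj:
  fixes T0 :: "((complex, 'n::{finite,linorder}) vec, 'n) vec" and Th :: "((complex, 'm::{finite,linorder}) vec, 'n) vec"
  assumes "is_state \<omega>" "commutator numop \<omega> = 0"
  defines "E \<equiv> \<lambda>t. app (exp (t *\<^sub>R endo (quasi_free_gen T0 Th (covariance \<omega> - csc (1/2) (mat 1)))))"
  shows "semigroup sb T0 Th \<omega> t X = (if sb then E t X else parity_twist (E t (parity_twist X)))"
proof -
  let ?g = "quasi_free_gen T0 Th (covariance \<omega> - csc (1/2) (mat 1))"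
  have T: "lindbladian True T0 Th \<omega> = ?g"
    by (rule ext) (rule lindbladian_eq(1)[OF assms(1,2)])
  have F: "lindbladian False T0 Th \<omega> = (\<lambda>X. parity_twist (?g (parity_twist X)))"
    by (rule ext) (rule lindbladian_eq(2)[OF assms(1,2)])
  have lF: "linear (\<lambda>X. parity_twist (?g (parity_twist X)))"
    using linear_compose[OF linear_compose[OF linear_parity_twist linear_quasi_free_gen] linear_parity_twist]
    by (simp add: o_def)
  have "parity_twist (E t (parity_twist X)) = app (exp (t *\<^sub>R endo (\<lambda>X. parity_twist (?g (parity_twist X))))) (parity_twist (parity_twist X))"
    unfolding E_def
  proof (rule app_exp_intertwine[OF linear_parity_twist])
    fix Y
    show "parity_twist (app (t *\<^sub>R endo ?g) Y) = app (t *\<^sub>R endo (\<lambda>X. parity_twist (?g (parity_twist X)))) (parity_twist Y)"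
      by (simp add: app.scaleR_left app_endo[OF lF] app_endo[OF linear_quasi_free_gen] parity_twist_parity_twist linear_scale[OF linear_parity_twist])
  qed
  thus ?thesis
    using semigroup_eq[of sb T0 Th \<omega> t X] lF linear_quasi_free_gen[of T0 Th]
    by (cases sb) (simp_all add: T F E_def parity_twist_parity_twist)
qed

section \<open>The conserved occupation of a decoupled mode\<close>

lemma ctrace_odd: "par X = - X \<Longrightarrow> ctrace X = 0"
  using ctrace_par[of X] by simp

lemma ctrace_even_parity_twist:
  assumes "par n = n" shows "ctrace (n ** parity_twist X) = ctrace (n ** X)"
proof -
  obtain E U where EO: "X = E + U" "par E = E" "par U = - U" by (rule even_odd_decomposition)
  have "ctrace (n ** U) = 0" "ctrace (n ** (U ** parity)) = 0"
    by (rule ctrace_odd; simp add: mat_simps EO assms)+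
  thus ?thesis by (simp add: EO(1) parity_twist_simps parity_twist_even parity_twist_odd EO mat_simps)
qed

text \<open>The number operator of the mode \<open>v\<close> commutes with the Hamiltonian and with
  every field operator entering the coupling. It can therefore be moved inside the outer graded
  multiplication, whose values are traceless.\<close>

lemma occupation_conserved:
  fixes T0 :: "((complex, 'n::{finite,linorder}) vec, 'n) vec" and Th :: "((complex, 'm::{finite,linorder}) vec, 'n) vec"
  assumes "hermitian T0" "is_state \<omega>" "commutator numop \<omega> = 0"
    and v: "T0 *v v = c *s v" "cadj Th *v v = 0"
  shows "ctrace (cadj (fa v) ** fa v ** semigroup sb T0 Th \<omega> t X) = ctrace (cadj (fa v) ** fa v ** X)"
proof (cases "v = 0")
  case True thus ?thesis by (simp add: fa_simps mat_simps)
next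
  case False
  define n where "n = cadj (fa v) ** fa v"
  have pn: "par n = n" by (simp add: n_def mat_simps par_fa par_cadj_fa)
  \<comment> \<open>The eigenvalue is real, so the commutators of the Hamiltonian with the creator
    and with the antilinear annihilator of \<open>v\<close> contribute opposite terms.\<close>
  have "cnj c * cinner v v = cinner (T0 *v v) v" by (simp add: v)
  also have "\<dots> = cinner v (T0 *v v)" by (simp only: cinner_cadj hermitianD[OF assms(1)])
  also have "\<dots> = c * cinner v v" by (simp add: v)
  finally have c: "cnj c = c" using False by simp
  have comm: "commutator (sys_ham T0) n = 0"
  proof -
    let ?H = "sys_ham T0"
    have "commutator ?H n = commutator ?H (cadj (fa v)) ** fa v + cadj (fa v) ** commutator ?H (fa v)"
      by (simp add: commutator_def n_def mat_simps matrix_mul_assoc)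
    also have "\<dots> = 0"
      by (simp add: commutator_sys_ham_fa commutator_sys_ham_cadj_fa[OF assms(1)] hermitianD[OF assms(1)] v fa_simps c mat_simps)
    finally show ?thesis .
  qed
  have orth: "cinner (column j Th) v = 0" "cinner v (column j Th) = 0" for j
    using v(2) cadj_apply_nth[of Th v j] by (simp_all add: cinner_commute[of v])
  have na: "n ** fa (column j Th) = fa (column j Th) ** n" for j
  proof -
    have "n ** fa (column j Th) = - (cadj (fa v) ** fa (column j Th) ** fa v)"
      unfolding n_def matrix_mul_assoc[symmetric] fa_fa_minus[of v] by (simp add: mat_simps)
    also have "\<dots> = fa (column j Th) ** n"
      using fa_cadj_fa_minus[of "column j Th" v] by (simp add: orth n_def mat_simps matrix_mul_assoc)
    finally show ?thesis .
  qed
  have cn: "cadj n = n" by (simp add: n_def mat_simps)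
  have nb: "n ** cadj (fa (column j Th)) = cadj (fa (column j Th)) ** n" for j
    using arg_cong[OF na[of j], of cadj] by (simp add: mat_simps cn)
  have gm: "ctrace (n ** gmult a Y) = 0" if "n ** a = a ** n" "par a = - a" for a Y
  proof -
    have "n ** gmult a Y = gmult a (n ** Y)"
      by (simp add: gmult_def mat_simps pn matrix_mul_assoc that(1))
    thus ?thesis by (simp add: ctrace_gmult that(2))
  qed
  have gen0: "ctrace (n ** quasi_free_gen T0 Th Z X) = 0" for Z X
  proof -
    have "ctrace (n ** commutator (sys_ham T0) X) = - ctrace (commutator (sys_ham T0) n ** X)"
      using ctrace_commute[of "sys_ham T0" "n ** X"]
      by (simp add: commutator_def mat_simps matrix_mul_assoc)
    hence h: "ctrace (n ** commutator (sys_ham T0) X) = 0" by (simp add: comm mat_simps)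
    have "Th ** Z ** cadj Th = (\<Sum>j\<in>UNIV. \<Sum>k\<in>UNIV. csc (Z $ j $ k) (outer (column j Th) (column k Th)))"
      by (rule sandwich_eq_sum_outer)
    hence q: "ctrace (n ** pair_op (Th ** Z ** cadj Th) X) = 0"
      by (simp add: pair_op_sum pair_op_simps pair_op_outer matrix_mult_sum_right ctrace_sum mat_simps gm nb par_cadj_fa)
    show ?thesis
      by (simp add: quasi_free_gen_def inf_temp_gen_def mat_simps matrix_mult_sum_right ctrace_sum h q gm na nb par_fa par_cadj_fa)
  qed
  have E: "ctrace (n ** app (exp (t *\<^sub>R endo (quasi_free_gen T0 Th Z))) X) = ctrace (n ** X)" for t Z X
  proof -
    have "linear (\<lambda>X. ctrace (n ** X))"
      by (rule linearI) (simp_all add: scaleR_csc scaleR_conv_of_real mat_simps)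
    from app_exp_intertwine[OF this, of "t *\<^sub>R endo (quasi_free_gen T0 Th Z)" 0 X]
    show ?thesis by (simp add: app.scaleR_left app_endo[OF linear_quasi_free_gen] scaleR_csc mat_simps gen0 app.zero_left)
  qed
  show ?thesis unfolding n_def[symmetric]
    by (simp add: semigroup_conj[OF assms(2,3)] ctrace_even_parity_twist[OF pn] E)
qed

definition basis_state :: "'n::finite set \<Rightarrow> 'n fockop" where
  "basis_state S = (\<chi> A B. if A = S \<and> B = S then 1 else 0)"

lemma is_state_basis_state: "is_state (basis_state S)"
proof -
  have "cadj (basis_state S) = basis_state S" by (rule mat_eqI) (auto simp: basis_state_def)
  moreover have "basis_state S ** basis_state S = basis_state S"
    by (rule mat_eqI) (auto simp: matrix_mult_nth basis_state_def if_distrib[of "\<lambda>z. z * _"] cong: if_cong)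
  ultimately have "psd (basis_state S)" using psd_cadj_mult[of "basis_state S"] by simp
  moreover have "ctrace (basis_state S) = 1" by (simp add: ctrace_def basis_state_def)
  ultimately show ?thesis by (simp add: is_state_def)
qed

lemma ctrace_basis_state: "ctrace (A ** basis_state S) = A $ S $ S"
proof -
  have "A $ R $ Q * basis_state S $ Q $ R = (if Q = S then if R = S then A $ S $ S else 0 else 0)" for R Q
    by (simp add: basis_state_def)
  thus ?thesis by (simp add: ctrace_def matrix_mult_nth)
qed

text \<open>Vacuum and completely filled state give different occupations for every nonzero
  \<open>v\<close>, whatever its direction among the modes.\<close>

lemma occupation_basis_states:
  fixes v :: "(complex, 'n::{finite,linorder}) vec"
  shows "ctrace (cadj (fa v) ** fa v ** basis_state {}) = 0"
    and "ctrace (cadj (fa v) ** fa v ** basis_state UNIV) = cinner v v"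
proof -
  have "fa v $ R $ {} = 0" for R by (simp add: fa_def annih_nth)
  thus "ctrace (cadj (fa v) ** fa v ** basis_state {}) = 0"
    by (simp add: ctrace_basis_state matrix_mult_nth)
  have "creat i $ R $ UNIV = 0" for i :: 'n and R by (auto simp: creat_nth)
  hence "cadj (fa v) $ R $ UNIV = 0" for R by (simp add: cadj_fa del: cadj_nth)
  hence "(fa v ** cadj (fa v)) $ UNIV $ UNIV = 0" by (simp add: matrix_mult_nth del: cadj_nth)
  moreover have "cadj (fa v) ** fa v = csc (cinner v v) (mat 1) - fa v ** cadj (fa v)"
    by (simp add: fa_cadj_fa_minus)
  ultimately show "ctrace (cadj (fa v) ** fa v ** basis_state UNIV) = cinner v v"
    by (simp add: ctrace_basis_state mat_def)
qed

section \<open>Covariance bounds\<close>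

lemma ctrace_psd_sandwich:
  assumes "psd \<omega>" shows "0 \<le> Re (ctrace (A ** \<omega> ** cadj A))"
proof -
  have "(A ** \<omega> ** cadj A) $ i $ i = cinner (cadj A *v axis i 1) (\<omega> *v (cadj A *v axis i 1))" for i
  proof -
    have "cinner (axis i 1) ((A ** \<omega> ** cadj A) *v axis i 1) = (A ** \<omega> ** cadj A) $ i $ i"
      by (simp add: cinner_def matrix_vector_nth axis_def if_distrib[of cnj] if_distrib[of "\<lambda>z. z * _"] if_distrib[of "\<lambda>z. _ * z"] cong: if_cong)
    thus ?thesis by (simp add: cinner_cadj' matrix_vector_mul_assoc[symmetric])
  qed
  thus ?thesis using assms by (simp add: ctrace_def psd_def sum_nonneg)
qed

lemma covariance_form: "cinner y (covariance \<omega> *v y) = ctrace (fa y ** \<omega> ** cadj (fa y))"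
  unfolding fa_def[of y] cadj_fa[of y, unfolded fa_def]
  by (simp add: matrix_mult_sum_left matrix_mult_sum_right csc_sum ctrace_sum mat_simps cinner_def
      matrix_vector_nth covariance_def sum_distrib_left mult_ac)
     (rule sum.swap)

text \<open>The Pauli principle: the occupations of \<open>y\<close> by a particle and by a hole are
  nonnegative and add up to the squared norm, so subtracting half of it leaves at most half of it in
  modulus.\<close>

lemma covariance_bounds:
  assumes "is_state \<omega>"
  shows "hermitian (covariance \<omega> - csc (1/2) (mat 1))"
    and "\<bar>Re (cinner y ((covariance \<omega> - csc (1/2) (mat 1)) *v y))\<bar> \<le> 1/2 * (norm y)\<^sup>2"
proof -
  have psd: "psd \<omega>" and h: "hermitian \<omega>" and tr: "ctrace \<omega> = 1" using assms by (auto simp: is_state_def psd_def)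
  have "cnj (ctrace (annih k ** \<omega> ** creat j)) = ctrace (annih j ** \<omega> ** creat k)" for j k :: 'a
  proof -
    have "cnj (ctrace (annih k ** \<omega> ** creat j)) = ctrace (cadj (annih k ** \<omega> ** creat j))" by simp
    thus ?thesis by (simp only: cadj_mult cadj_annih cadj_creat hermitianD[OF h]) (simp add: matrix_mul_assoc)
  qed
  hence "cadj (covariance \<omega>) = covariance \<omega>" by (intro mat_eqI) (simp add: covariance_def)
  thus "hermitian (covariance \<omega> - csc (1/2) (mat 1))" by (simp add: hermitian_def mat_simps)
  define x where "x = Re (cinner y (covariance \<omega> *v y))"
  have "0 \<le> x" unfolding x_def covariance_form by (rule ctrace_psd_sandwich[OF psd])
  moreover have "x + Re (ctrace (cadj (fa y) ** \<omega> ** fa y)) = (norm y)\<^sup>2"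
  proof -
    have "ctrace (fa y ** \<omega> ** cadj (fa y)) + ctrace (cadj (fa y) ** \<omega> ** fa y)
      = ctrace ((cadj (fa y) ** fa y + fa y ** cadj (fa y)) ** \<omega>)"
      by (simp add: mat_simps ctrace_commute[of _ "fa y"] ctrace_commute[of _ "cadj (fa y)"] matrix_mul_assoc)
    also have "\<dots> = (norm y)\<^sup>2" by (simp add: cadj_fa_fa mat_simps tr cinner_self)
    finally show ?thesis unfolding x_def covariance_form by (metis Re_complex_of_real plus_complex.sel(1))
  qed
  moreover have "0 \<le> Re (ctrace (cadj (fa y) ** \<omega> ** fa y))"
    using ctrace_psd_sandwich[OF psd, of "cadj (fa y)"] by (simp add: mat_simps)
  ultimately have x: "0 \<le> x" "x \<le> (norm y)\<^sup>2" by linarith+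
  have "Re (cinner y ((covariance \<omega> - csc (1/2) (mat 1)) *v y)) = x - (norm y)\<^sup>2 / 2"
    by (simp add: x_def matrix_vector_mult_diff_rdistrib csc_matrix_vector cinner_self)
  thus "\<bar>Re (cinner y ((covariance \<omega> - csc (1/2) (mat 1)) *v y))\<bar> \<le> 1/2 * (norm y)\<^sup>2"
    using x unfolding abs_le_iff by linarith
qed

section \<open>Convergence to a quasi-free state\<close>

lemma quasi_free_gen_tendsto:
  fixes T :: "((complex, 'n::{finite,linorder}) vec, 'n) vec" and Th :: "((complex, 'm::{finite,linorder}) vec, 'n) vec"
  assumes T: "hermitian T" and K: "krylov_span T Th = UNIV" and Z: "hermitian Z"
    "\<And>y. \<bar>Re (cinner y (Z *v y))\<bar> \<le> 1/2 * (norm y)\<^sup>2"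
  obtains \<sigma> where "is_state \<sigma>" "quasi_free \<sigma>" "commutator numop \<sigma> = 0"
    "\<And>X. ((\<lambda>t. app (exp (t *\<^sub>R endo (quasi_free_gen T Th Z))) X) \<longlongrightarrow> csc (ctrace X) \<sigma>) at_top"
    "\<And>t. app (exp (t *\<^sub>R endo (quasi_free_gen T Th Z))) \<sigma> = \<sigma>"
proof -
  obtain C where C: "hermitian C" "drift T Th ** C + C ** cadj (drift T Th) = - (Th ** Z ** cadj Th)"
    by (rule lyapunov_solution[OF T K Z(1)])
  obtain u :: "'n \<Rightarrow> (complex, 'n) vec" and d :: "'n \<Rightarrow> real" where
    ud: "\<And>i j. cinner (u i) (u j) = (if i = j then 1 else 0)" "\<And>i. C *v u i = complex_of_real (d i) *s u i"
    by (rule hermitian_orthonormal_eigenvectors[OF C(1)]) blast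
  have d: "\<bar>d i\<bar> \<le> 1/2" for i
  proof (rule lyapunov_eigenvalue_bound[OF T K C Z(2) ud(2)])
    show "u i \<noteq> 0" using ud(1)[of i i] by auto
  qed
  have Csum: "C = (\<Sum>i\<in>UNIV. csc (complex_of_real (d i)) (outer (u i) (u i)))"
    by (rule mat_eqI) (simp add: hermitian_spectral[OF ud] outer_def)
  let ?N = "of_nat CARD('n set) :: complex"
  define Q where "Q = (endo (pair_op C) :: 'n fockop endo)"
  define A where "A = (endo (inf_temp_gen T Th) :: 'n fockop endo)"
  define L where "L = (endo (quasi_free_gen T Th Z) :: 'n fockop endo)"
  define \<sigma> where "\<sigma> = csc (1 / ?N) (app (exp Q) (mat 1))"
  note app_simps = app_endo[OF linear_pair_op] app_endo[OF linear_inf_temp_gen] app_endo[OF linear_quasi_free_gen]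
  have state: "is_state \<sigma> \<and> quasi_free \<sigma> \<and> commutator numop \<sigma> = 0"
    by (rule quasi_free_limit[OF ud(1) d]) (simp add: \<sigma>_def Q_def Csum)
  have neg: "pair_op (- D) X = - pair_op D X" for D and X :: "'n fockop"
    using pair_op_simps(2)[of "-1" D X] by (simp add: csc_simps)
  \<comment> \<open>The Lyapunov equation enters here: the commutator of \<open>Q\<close> and
    \<open>A\<close> is \<open>pair_op\<close> of \<open>Th ** Z ** cadj Th\<close>.\<close>
  have "L = A + (Q * A - A * Q)"
    by (rule endo_eqI)
       (simp add: L_def A_def Q_def app_simps app.add_left app.diff_left quasi_free_gen_def inf_temp_gen_pair_op[OF T] C(2) neg)
  moreover have "Q * (Q * A - A * Q) = (Q * A - A * Q) * Q"
    by (rule endo_eqI)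
       (simp add: A_def Q_def app_simps app.diff_left app.diff_right inf_temp_gen_pair_op[OF T] C(2) neg
          linear_diff[OF linear_pair_op] linear_neg[OF linear_pair_op] linear_add[OF linear_pair_op] pair_op_commute[of C "Th ** Z ** cadj Th"])
  ultimately have sim: "exp Q * A = L * exp Q" using exp_similarity[of Q A, OF refl] by simp
  have E: "app (exp (t *\<^sub>R L)) X = app (exp Q) (app (exp (t *\<^sub>R A)) (app (exp (- Q)) X))" for t X
  proof -
    have "app (exp Q) (app (exp (t *\<^sub>R A)) (app (exp (- Q)) X))
        = app (exp (t *\<^sub>R L)) (app (exp Q) (app (exp (- Q)) X))"
    proof (rule app_exp_intertwine)
      show "linear (app (exp Q))"
        using app.bounded_linear_right bounded_linear.linear by blast
      show "app (exp Q) (app (t *\<^sub>R A) Y) = app (t *\<^sub>R L) (app (exp Q) Y)" for Y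
        using arg_cong[OF sim, of "\<lambda>M. app M Y"] by (simp add: app.scaleR_left app.scaleR_right)
    qed
    thus ?thesis by (simp add: app_mult[symmetric] exp_minus_inverse del: app_mult)
  qed
  \<comment> \<open>\<open>exp (- Q)\<close> preserves the trace, and the infinite-temperature
    evolution forgets everything else.\<close>
  have trQ: "ctrace (app (exp (- Q)) X) = ctrace X" for X
  proof -
    have "linear (ctrace :: 'n fockop \<Rightarrow> complex)"
      by (rule linearI) (simp_all add: scaleR_csc scaleR_conv_of_real)
    from app_exp_intertwine[OF this, of "- Q" 0 X]
    show ?thesis by (simp add: app.minus_left app_simps Q_def ctrace_pair_op app.zero_left)
  qed
  have Q_csc: "app (exp Q) (csc z (mat 1)) = csc z (app (exp Q) (mat 1))" for z
  proof -
    have "linear (\<lambda>X. csc z X :: 'n fockop)"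
      by (rule linear_csc_iff) (simp_all add: mat_simps mult.commute)
    from app_exp_intertwine[OF this, of Q Q "mat 1"]
    show ?thesis by (simp add: Q_def app_simps mat_simps)
  qed
  have lim: "((\<lambda>t. app (exp (t *\<^sub>R L)) X) \<longlongrightarrow> csc (ctrace X) \<sigma>) at_top" for X
  proof -
    have "((\<lambda>t. app (exp (t *\<^sub>R L)) X) \<longlongrightarrow> app (exp Q) (csc (ctrace (app (exp (- Q)) X) / ?N) (mat 1))) at_top"
      unfolding E A_def by (intro app.tendsto tendsto_const inf_temp_gen_tendsto[OF T K])
    thus ?thesis by (simp add: trQ Q_csc \<sigma>_def mat_simps)
  qed
  have "app (exp (t *\<^sub>R L)) \<sigma> = \<sigma>" for t
  proof (rule app_exp_fixed)
    have "app L \<sigma> = csc (1 / ?N) (app L (app (exp Q) (mat 1)))"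
      by (simp add: \<sigma>_def L_def app_simps quasi_free_gen_def mat_simps)
    also have "app L (app (exp Q) (mat 1)) = app (exp Q) (app A (mat 1))"
      using arg_cong[OF sim, of "\<lambda>M. app M (mat 1)"] by simp
    finally show "app (t *\<^sub>R L) \<sigma> = 0"
      by (simp add: A_def app_simps inf_temp_gen_one app.zero_right app.scaleR_left mat_simps)
  qed
  with state lim show ?thesis using that unfolding L_def by blast
qed

theorem theorem3p13:
  fixes sb :: bool
    and T0 :: "((complex, 'n::{finite,linorder}) vec, 'n) vec"
    and Th :: "((complex, 'm::{finite,linorder}) vec, 'n) vec"
    and \<omega> :: "'m fockop"
  assumes "hermitian T0"
    and "is_state \<omega>" and "quasi_free \<omega>" and "commutator numop \<omega> = 0"
  shows "((\<exists>!\<sigma>. stationary sb T0 Th \<omega> \<sigma>) \<and>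
          (\<forall>\<sigma>. stationary sb T0 Th \<omega> \<sigma> \<longrightarrow>
             quasi_free \<sigma> \<and> commutator (numop :: 'n fockop) \<sigma> = 0 \<and>
             (\<forall>\<rho>0. is_state \<rho>0 \<longrightarrow>
                ((\<lambda>t. semigroup sb T0 Th \<omega> t \<rho>0) \<longlongrightarrow> \<sigma>) at_top))
         \<longleftrightarrow> \<not> (\<exists>v c. v \<noteq> 0 \<and> T0 *v v = c *s v \<and> cadj Th *v v = 0))
       \<and> ((\<not> (\<exists>v c. v \<noteq> 0 \<and> T0 *v v = c *s v \<and> cadj Th *v v = 0))
          \<longleftrightarrow> krylov_span T0 Th = UNIV)"
    (is "(?conv \<longleftrightarrow> \<not> ?ev) \<and> (\<not> ?ev \<longleftrightarrow> ?kr)")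
proof (intro conjI iffI)
  show kr: "?kr" if "\<not> ?ev" using that krylov_span_UNIV_iff[OF assms(1)] by blast
  show "\<not> ?ev" if "?kr" using that krylov_span_UNIV_iff[OF assms(1)] by blast
  show "\<not> ?ev" if conv: "?conv"
  proof
    assume ?ev
    then obtain v c where v: "v \<noteq> 0" "T0 *v v = c *s v" "cadj Th *v v = 0" by blast
    obtain \<sigma> where "stationary sb T0 Th \<omega> \<sigma>" using conv by blast
    hence lim: "((\<lambda>t. semigroup sb T0 Th \<omega> t \<rho>) \<longlongrightarrow> \<sigma>) at_top" if "is_state \<rho>" for \<rho>
      using conv that by blast
    define n where "n = cadj (fa v) ** fa v"
    have F: "ctrace (n ** \<rho>) = ctrace (n ** \<sigma>)" if "is_state \<rho>" for \<rho>
    proof -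
      have "((\<lambda>t. ctrace (n ** semigroup sb T0 Th \<omega> t \<rho>)) \<longlongrightarrow> ctrace (n ** \<sigma>)) at_top"
        by (intro tendsto_intros lim that)
      hence "((\<lambda>t :: real. ctrace (n ** \<rho>)) \<longlongrightarrow> ctrace (n ** \<sigma>)) at_top"
        unfolding n_def occupation_conserved[OF assms(1,2,4) v(2,3)] .
      thus ?thesis by (simp add: tendsto_const_iff)
    qed
    \<comment> \<open>The vacuum and the filled state would have to share the occupation of
      \<open>v\<close>.\<close>
    from F[OF is_state_basis_state[of "{}"]] F[OF is_state_basis_state[of UNIV]]
    have "cinner v v = 0" unfolding n_def occupation_basis_states by simp
    thus False using v(1) by simp
  qed
  assume "\<not> ?ev"
  hence K: ?kr by (rule kr)
  define E where "E t = app (exp (t *\<^sub>R endo (quasi_free_gen T0 Th (covariance \<omega> - csc (1/2) (mat 1)))))" for t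
  obtain \<sigma> where \<sigma>: "is_state \<sigma>" "quasi_free \<sigma>" "commutator (numop :: 'n fockop) \<sigma> = 0"
    and lim: "\<And>X. ((\<lambda>t. E t X) \<longlongrightarrow> csc (ctrace X) \<sigma>) at_top" and fixp: "\<And>t. E t \<sigma> = \<sigma>"
    unfolding E_def by (rule quasi_free_gen_tendsto[OF assms(1) K covariance_bounds[OF assms(2)]]) blast
  have S: "semigroup sb T0 Th \<omega> t X = (if sb then E t X else parity_twist (E t (parity_twist X)))" for t X
    unfolding E_def by (rule semigroup_conj[OF assms(2,4)])
  \<comment> \<open>The limit is gauge invariant, hence even, so the twist fixes it and both
    embeddings have the same one.\<close>
  have J\<sigma>: "parity_twist \<sigma> = \<sigma>" by (rule parity_twist_even[OF par_gauge_invariant[OF \<sigma>(3)]])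
  have stat: "stationary sb T0 Th \<omega> \<sigma>"
    using \<sigma>(1) by (simp add: stationary_def S fixp J\<sigma>)
  have slim: "((\<lambda>t. semigroup sb T0 Th \<omega> t \<rho>) \<longlongrightarrow> \<sigma>) at_top" if "is_state \<rho>" for \<rho>
  proof (cases sb)
    case True
    hence "semigroup sb T0 Th \<omega> t \<rho> = E t \<rho>" for t using S by simp
    thus ?thesis using lim[of \<rho>] that by (simp add: is_state_def mat_simps)
  next
    case False
    \<comment> \<open>The twist makes the odd part of a state anti-Hermitian, so convergence is
      applied to an operator that need not be a state; only its trace matters.\<close>
    have "bounded_linear (parity_twist :: 'n fockop \<Rightarrow> 'n fockop)"
      using linear_parity_twist by (simp add: linear_conv_bounded_linear)
    from bounded_linear.tendsto[OF this lim[of "parity_twist \<rho>"]]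
    have "((\<lambda>t. parity_twist (E t (parity_twist \<rho>))) \<longlongrightarrow> csc (ctrace (parity_twist \<rho>)) \<sigma>) at_top"
      by (simp add: parity_twist_simps J\<sigma>)
    moreover have "ctrace (parity_twist \<rho>) = 1"
      using ctrace_even_parity_twist[of "mat 1" \<rho>] that by (simp add: mat_simps is_state_def)
    moreover have "semigroup sb T0 Th \<omega> t \<rho> = parity_twist (E t (parity_twist \<rho>))" for t using S False by simp
    ultimately show ?thesis by (simp add: mat_simps)
  qed
  have uniq: "\<sigma>' = \<sigma>" if "stationary sb T0 Th \<omega> \<sigma>'" for \<sigma>'
  proof -
    have "((\<lambda>t. semigroup sb T0 Th \<omega> t \<sigma>') \<longlongrightarrow> \<sigma>') at_top"
    proof (rule tendsto_eventually)
      show "\<forall>\<^sub>F t in at_top. semigroup sb T0 Th \<omega> t \<sigma>' = \<sigma>'"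
        using eventually_ge_at_top[of 0] by eventually_elim (use that in \<open>simp add: stationary_def\<close>)
    qed
    moreover have "((\<lambda>t. semigroup sb T0 Th \<omega> t \<sigma>') \<longlongrightarrow> \<sigma>) at_top"
      using slim that by (simp add: stationary_def)
    ultimately show ?thesis using tendsto_unique[OF trivial_limit_at_top_linorder] by blast
  qed
  show "\<exists>!\<sigma>. stationary sb T0 Th \<omega> \<sigma>" using stat uniq by blast
  show "\<forall>\<sigma>. stationary sb T0 Th \<omega> \<sigma> \<longrightarrow>
             quasi_free \<sigma> \<and> commutator (numop :: 'n fockop) \<sigma> = 0 \<and>
             (\<forall>\<rho>0. is_state \<rho>0 \<longrightarrow>
                ((\<lambda>t. semigroup sb T0 Th \<omega> t \<rho>0) \<longlongrightarrow> \<sigma>) at_top)"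
    using uniq \<sigma> slim by blast
qed

end
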